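(* Let $\beta>0$, $L>0$, $M>0$, $x_0\in[0,1]^d$, $c>0$, and let $\rho$ be a fixed contrast function. Let $\bar h=(L^2n)^{-\frac{1}{2\beta+d}}$, let $\varphi_n(\beta)=n^{-\frac{\beta}{2\beta+d}}$, and let $\hat f^{\bar h}(x_0)$ be the $\rho$-LPA estimator with bandwidth $h=\bar h$ and polynomial degree $b=\lfloor\beta\rfloor$. Then for any $(g_i)_i\in\mathcal G_\rho^{(c)}$, $$\limsup_{n\to\infty}\ \varphi_n^{-r}(\beta)\ \sup_{f\in\mathbb H_d(\beta,L,M)}\mathbb E_f\big|\hat f^{\bar h}(x_0)-f(x_0)\big|^r<\infty,\qquad\forall r\ge 1.$$
   Context: Model. $d,n$ are positive integers. One observes $Z^{(n)}=(X_i,Y_i)_{i=1,\dots,n}$ with $Y_i=f(X_i)+\xi_i$, where $f:[0,1]^d\to\mathbb R$ is unknown. The design points $X_i$ are independent and uniformly distributed on $[0,1]^d$; the noise variables $\xi_i$ are independent, and $\xi_i$ has a density $g_i$ with respect to Lebesgue measure on $\mathbb R$ which is symmetric and monotone on $\mathbb R_+$; the vectors $(X_i)_i$ and $(\xi_i)_i$ are independent. $\mathbb P_f$, $\mathbb E_f$ denote the law of $Z^{(n)}$ and the corresponding expectation. $x_0\in[0,1]^d$ is a fixed point. Hölder class. $\lfloor\beta\rfloor$ is the largest integer strictly smaller than $\beta$. For a multi-index $p=(p_1,\dots,p_d)\in\mathbb N^d$, $|p|=p_1+\dots+p_d$. For an integer $m\ge 0$, $\mathcal S_m=\{p\in\mathbb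 N^d:0\le|p|\le m\}$. $\mathbb H_d(\beta,L,M)$ is the set of functions $f:[0,1]^d\to\mathbb R$ admitting all partial derivatives of order $\lfloor\beta\rfloor$ on $[0,1]^d$ and such that for all $x,y\in[0,1]^d$ $$\Big|\frac{\partial^{|p|}f(x)}{\partial x_1^{p_1}\cdots\partial x_d^{p_d}}-\frac{\partial^{|p|}f(y)}{\partial y_1^{p_1}\cdots\partial y_d^{p_d}}\Big|\le L\|x-y\|_1^{\beta-\lfloor\beta\rfloor}\ \ \forall |p|=\lfloor\beta\rfloor,\qquad \sum_{p\in\mathcal S_{\lfloor\beta\rfloor}}\sup_{x\in[0,1]^d}\Big|\frac{\partial^{|p|}f(x)}{\partial x_1^{p_1}\cdots\partial x_d^{p_d}}\Big|\le M.$$ Contrast function. $\rho$ is a contrast function if: (1) $\rho:\mathbb R\to\mathbb R_+$ is symmetric, convex and $\rho(0)=0$; (2) $\rho'$ is $1$-Lipschitz on $\mathbb R$ and bounded; (3) $\rho''$ is defined almost everywhere and there exist $L_\rho>0$, $\alpha>0$ such that $\sup_{i}\int_{\mathbb R}|\rho''(z+u)-\rho''(z+v)|\,g_i(z)\,dz\le L_\rho|u-v|^\alpha$ for all $u,v\in\mathbb R$. Density class. $\mathcal G_\rho^{(c)}$ is the set of sequences $(g_i)_i$ of densities that are symmetric and monotone on $\mathbb R_+$ such that $\inf_{i}\int_{\mathbb R}\rho''(z)g_i(z)\,dz\ge c$ (infimum and supremum over the indices $i$ of the observations). Estimator. $K$ is a fixed kernel: a nonnegative bounded function with compact support included in $[-1/2,1/2]^d$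 and $\int_{\mathbb R^d}K(z)\,dz=1$. For an integer $b\ge 0$ let $N_b$ be the cardinality of $\mathcal S_b$. For $h>0$ let $V_{x_0}(h)=\prod_{j=1}^d[x_{0,j}-h/2,x_{0,j}+h/2]\cap[0,1]^d$. For $t=(t_p)_{p\in\mathcal S_b}\in\mathbb R^{N_b}$ put $f_t(x)=\sum_{p\in\mathcal S_b}t_p\big(\frac{x-x_0}{h}\big)^p\,\mathbb I_{V_{x_0}(h)}(x)$ with $z^p=z_1^{p_1}\cdots z_d^{p_d}$. Let $\Theta(M)=\{t\in\mathbb R^{N_b}:\|t\|_1\le M\}$, $$\tilde\pi_h(t)=\frac{1}{nh^d}\sum_{i=1}^n\rho\big(Y_i-f_t(X_i)\big)K\Big(\frac{X_i-x_0}{h}\Big),\qquad \hat\theta(h)=\arg\min_{t\in\Theta(M)}\tilde\pi_h(t).$$ The $\rho$-LPA estimator is $\hat f^h(x_0)=\hat\theta_{0,\dots,0}(h)$ (the component with index $p=(0,\dots,0)$).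
   Formalization: Added assumption: the kernel K has positive integral over the directions pointing from x_0 into the cube [0,1]^d (automatic for interior x_0). Otherwise, e.g. d=1, x_0=0, K=4 on [-1/2,-1/4], the criterion is identically 0, the argmin is arbitrary, and the claimed rate fails. *)

theory Defs
  imports "HOL-Probability.Probability"
begin

section \<open>Multi-indices, the unit cube and Hoelder classes\<close>

text \<open>Points live in \<open>real ^ 'd\<close>, the dimension is \<open>CARD('d)\<close>, and a multi-index is a function
  \<open>'d \<Rightarrow> nat\<close>.\<close>

definition unit_cube :: "(real ^ 'd) set" where
  "unit_cube = cbox 0 1"

definition multi_indices :: "nat \<Rightarrow> ('d::finite \<Rightarrow> nat) set" where
  "multi_indices m = {p. (\<Sum>j\<in>UNIV. p j) \<le> m}"

definition monomial :: "('d::finite \<Rightarrow> nat) \<Rightarrow> real ^ 'd \<Rightarrow> real" where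
  "monomial p z = (\<Prod>j\<in>UNIV. (z $ j) ^ p j)"

definition norm1 :: "real ^ 'd \<Rightarrow> real" where
  "norm1 z = (\<Sum>j\<in>UNIV. \<bar>z $ j\<bar>)"

text \<open>The largest integer strictly smaller than \<open>\<beta>\<close> (a natural number, since \<open>\<beta> > 0\<close>); it differs from
  \<open>\<lfloor>\<beta>\<rfloor>\<close> when \<open>\<beta>\<close> is an integer.\<close>

definition strict_floor :: "real \<Rightarrow> nat" where
  "strict_floor \<beta> = nat (GREATEST k::int. real_of_int k < \<beta>)"

text \<open>\<open>D p\<close> is the partial derivative of \<open>f\<close> with multi-index \<open>p\<close>, for all orders up to \<open>m\<close>. Derivatives
  are taken within the cube, hence one-sided on its faces. Indexing by multi-indices means that mixed
  derivatives do not depend on the order of differentiation. On the cube, \<open>D p\<close> is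
  determined by \<open>f\<close> for these \<open>p\<close>; values off the cube are irrelevant throughout.\<close>

definition partial_derivatives ::
    "nat \<Rightarrow> (real ^ 'd \<Rightarrow> real) \<Rightarrow> (('d::finite \<Rightarrow> nat) \<Rightarrow> real ^ 'd \<Rightarrow> real) \<Rightarrow> bool" where
  "partial_derivatives m f D \<longleftrightarrow>
     (\<forall>x\<in>unit_cube. D (\<lambda>_. 0) x = f x) \<and>
     (\<forall>p j. (\<Sum>i\<in>UNIV. p i) < m \<longrightarrow> (\<forall>x\<in>unit_cube.
        ((\<lambda>s. D p (x + s *\<^sub>R axis j 1)) has_real_derivative D (p(j := Suc (p j))) x)
          (at 0 within {s. x + s *\<^sub>R axis j 1 \<in> unit_cube})))"

text \<open>The suprema are taken in \<open>ennreal\<close>, so that the bound by \<open>M\<close> includes their finiteness.\<close>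

definition holder_class :: "real \<Rightarrow> real \<Rightarrow> real \<Rightarrow> (real ^ 'd::finite \<Rightarrow> real) set" where
  "holder_class \<beta> L M = {f. \<exists>D. partial_derivatives (strict_floor \<beta>) f D \<and>
     (\<forall>p. (\<Sum>j\<in>UNIV. p j) = strict_floor \<beta> \<longrightarrow> (\<forall>x\<in>unit_cube. \<forall>y\<in>unit_cube.
        \<bar>D p x - D p y\<bar> \<le> L * norm1 (x - y) powr (\<beta> - real (strict_floor \<beta>)))) \<and>
     (\<Sum>p\<in>multi_indices (strict_floor \<beta>). SUP x\<in>unit_cube. ennreal \<bar>D p x\<bar>) \<le> ennreal M}"


section \<open>The regression model\<close>

definition sym_monotone_density :: "(real \<Rightarrow> real) \<Rightarrow> bool" where
  "sym_monotone_density g \<longleftrightarrow>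
     g \<in> borel_measurable borel \<and> (\<forall>z. 0 \<le> g z) \<and> (\<integral>\<^sup>+ z. ennreal (g z) \<partial>lborel) = 1 \<and>
     (\<forall>z. g (- z) = g z) \<and> antimono_on {0..} g"

text \<open>Joint law of \<open>((X\<^sub>1, \<xi>\<^sub>1), \<dots>, (X\<^sub>n, \<xi>\<^sub>n))\<close>: the design points, uniform on the cube (which has
  Lebesgue measure 1), and the noise variables are all independent. Observations are numbered from 0.\<close>

definition design_noise_law ::
    "nat \<Rightarrow> (nat \<Rightarrow> real \<Rightarrow> real) \<Rightarrow> (nat \<Rightarrow> (real ^ 'd::finite) \<times> real) measure" where
  "design_noise_law n g =
     (\<Pi>\<^sub>M i\<in>{..<n}. restrict_space lborel unit_cube \<Otimes>\<^sub>M density lborel (\<lambda>z. ennreal (g i z)))"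

definition sample_space :: "nat \<Rightarrow> (nat \<Rightarrow> (real ^ 'd::finite) \<times> real) measure" where
  "sample_space n = (\<Pi>\<^sub>M i\<in>{..<n}. borel \<Otimes>\<^sub>M borel)"

text \<open>The law of \<open>(X\<^sub>i, Y\<^sub>i)\<close>, \<open>i < n\<close>, where \<open>Y\<^sub>i = f X\<^sub>i + \<xi>\<^sub>i\<close>.\<close>

definition sample_law ::
    "nat \<Rightarrow> (nat \<Rightarrow> real \<Rightarrow> real) \<Rightarrow> (real ^ 'd::finite \<Rightarrow> real) \<Rightarrow> (nat \<Rightarrow> (real ^ 'd) \<times> real) measure" where
  "sample_law n g f = distr (design_noise_law n g) (sample_space n)
     (\<lambda>\<omega>. \<lambda>i\<in>{..<n}. (fst (\<omega> i), f (fst (\<omega> i)) + snd (\<omega> i)))"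


section \<open>Contrast functions and kernels\<close>

text \<open>\<open>deriv (deriv \<rho>)\<close> plays the role of the almost everywhere defined second derivative of \<open>\<rho>\<close>.\<close>

definition contrast_function :: "(nat \<Rightarrow> real \<Rightarrow> real) \<Rightarrow> (real \<Rightarrow> real) \<Rightarrow> bool" where
  "contrast_function g \<rho> \<longleftrightarrow>
     (\<forall>x. 0 \<le> \<rho> x) \<and> (\<forall>x. \<rho> (- x) = \<rho> x) \<and> convex_on UNIV \<rho> \<and> \<rho> 0 = 0 \<and>
     (\<forall>x. \<rho> field_differentiable at x) \<and> 1-lipschitz_on UNIV (deriv \<rho>) \<and> bounded (range (deriv \<rho>)) \<and>
     (AE x in lborel. deriv \<rho> field_differentiable at x) \<and>
     (\<exists>L\<^sub>\<rho>>0. \<exists>\<alpha>>0. \<forall>i u v.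
        (LINT z|lborel. \<bar>deriv (deriv \<rho>) (z + u) - deriv (deriv \<rho>) (z + v)\<bar> * g i z)
          \<le> L\<^sub>\<rho> * \<bar>u - v\<bar> powr \<alpha>)"

definition noise_class :: "(real \<Rightarrow> real) \<Rightarrow> real \<Rightarrow> (nat \<Rightarrow> real \<Rightarrow> real) set" where
  "noise_class \<rho> c = {g. (\<forall>i. sym_monotone_density (g i)) \<and>
     (\<forall>i. c \<le> (LINT z|lborel. deriv (deriv \<rho>) z * g i z))}"

definition smoothing_kernel :: "(real ^ 'd::finite \<Rightarrow> real) \<Rightarrow> bool" where
  "smoothing_kernel K \<longleftrightarrow>
     (\<forall>z. 0 \<le> K z) \<and> bounded (range K) \<and>
     compact (closure {z. K z \<noteq> 0}) \<and> closure {z. K z \<noteq> 0} \<subseteq> cbox (vec (- 1 / 2)) (vec (1 / 2)) \<and>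
     integrable lborel K \<and> (LINT z|lborel. K z) = 1"

text \<open>The directions \<open>z\<close> such that \<open>x\<^sub>0 + h z\<close> is in the cube for all small \<open>h > 0\<close>.\<close>

definition inward_cone :: "real ^ 'd \<Rightarrow> (real ^ 'd) set" where
  "inward_cone x\<^sub>0 = {z. \<forall>j. (x\<^sub>0 $ j = 0 \<longrightarrow> 0 \<le> z $ j) \<and> (x\<^sub>0 $ j = 1 \<longrightarrow> z $ j \<le> 0)}"

text \<open>If \<open>K\<close> vanishes almost everywhere on the inward cone then, for small bandwidths, almost surely no
  observation has a positive weight, and the criterion below is identically 0. This can only
  happen at boundary points of the cube.\<close>

definition kernel_charges_cube :: "(real ^ 'd::finite \<Rightarrow> real) \<Rightarrow> real ^ 'd \<Rightarrow> bool" where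
  "kernel_charges_cube K x\<^sub>0 \<longleftrightarrow> 0 < (LINT z:inward_cone x\<^sub>0|lborel. K z)"

lemma kernel_charges_cube_interior:
  assumes "smoothing_kernel K" and "x\<^sub>0 \<in> box 0 1"
  shows "kernel_charges_cube K x\<^sub>0"
proof -
  have "x\<^sub>0 $ j \<noteq> 0" "x\<^sub>0 $ j \<noteq> 1" for j
    using assms(2)[unfolded mem_box_cart, rule_format, of j] by auto
  then have "inward_cone x\<^sub>0 = UNIV"
    by (simp add: inward_cone_def)
  then show ?thesis
    using assms(1) by (simp add: kernel_charges_cube_def smoothing_kernel_def set_lebesgue_integral_def)
qed


section \<open>The estimator\<close>

definition local_window :: "real ^ 'd \<Rightarrow> real \<Rightarrow> (real ^ 'd) set" where
  "local_window x\<^sub>0 h = {x. \<forall>j. x\<^sub>0 $ j - h / 2 \<le> x $ j \<and> x $ j \<le> x\<^sub>0 $ j + h / 2} \<inter> unit_cube"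

definition local_poly ::
    "nat \<Rightarrow> real ^ 'd \<Rightarrow> real \<Rightarrow> (('d::finite \<Rightarrow> nat) \<Rightarrow> real) \<Rightarrow> real ^ 'd \<Rightarrow> real" where
  "local_poly b x\<^sub>0 h t x =
     (\<Sum>p\<in>multi_indices b. t p * monomial p ((x - x\<^sub>0) /\<^sub>R h)) * indicator (local_window x\<^sub>0 h) x"

definition param_set :: "nat \<Rightarrow> real \<Rightarrow> (('d::finite \<Rightarrow> nat) \<Rightarrow> real) set" where
  "param_set b M = {t \<in> multi_indices b \<rightarrow>\<^sub>E UNIV. (\<Sum>p\<in>multi_indices b. \<bar>t p\<bar>) \<le> M}"

definition rho_criterion ::
    "(real \<Rightarrow> real) \<Rightarrow> (real ^ 'd::finite \<Rightarrow> real) \<Rightarrow> nat \<Rightarrow> real ^ 'd \<Rightarrow> real \<Rightarrow> nat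
      \<Rightarrow> (nat \<Rightarrow> (real ^ 'd) \<times> real) \<Rightarrow> (('d \<Rightarrow> nat) \<Rightarrow> real) \<Rightarrow> real" where
  "rho_criterion \<rho> K b x\<^sub>0 h n z t =
     1 / (real n * h ^ CARD('d)) *
     (\<Sum>i<n. \<rho> (snd (z i) - local_poly b x\<^sub>0 h t (fst (z i))) * K ((fst (z i) - x\<^sub>0) /\<^sub>R h))"

text \<open>The minimizer need not be unique, so the estimator is any selection \<open>\<theta>\<close> of minimizers, as a
  function of the sample, whose component with index 0 is a measurable statistic.\<close>

definition rho_lpa ::
    "(real \<Rightarrow> real) \<Rightarrow> (real ^ 'd::finite \<Rightarrow> real) \<Rightarrow> nat \<Rightarrow> real \<Rightarrow> real ^ 'd \<Rightarrow> real \<Rightarrow> nat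
      \<Rightarrow> ((nat \<Rightarrow> (real ^ 'd) \<times> real) \<Rightarrow> ('d \<Rightarrow> nat) \<Rightarrow> real) \<Rightarrow> bool" where
  "rho_lpa \<rho> K b M x\<^sub>0 h n \<theta> \<longleftrightarrow>
     (\<forall>z\<in>space (sample_space n).
        is_arg_min (rho_criterion \<rho> K b x\<^sub>0 h n z) (\<lambda>t. t \<in> param_set b M) (\<theta> z)) \<and>
     (\<lambda>z. \<theta> z (\<lambda>_. 0)) \<in> borel_measurable (sample_space n)"

definition bandwidth :: "real \<Rightarrow> real \<Rightarrow> nat \<Rightarrow> nat \<Rightarrow> real" where
  "bandwidth \<beta> L d n = (L\<^sup>2 * real n) powr (- 1 / (2 * \<beta> + real d))"

definition rate :: "real \<Rightarrow> nat \<Rightarrow> nat \<Rightarrow> real" where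
  "rate \<beta> d n = real n powr (- \<beta> / (2 * \<beta> + real d))"

end

theory Submission
  imports Defs "HOL-Real_Asymp.Real_Asymp"
begin

text \<open>Let \<open>t\<close> be the rescaled Taylor coefficients of \<open>f\<close> at \<open>x\<^sub>0\<close>; they belong to the parameter set and
  reproduce \<open>f\<close> in the window up to an error of order \<open>h\<^sup>\<beta>\<close>. If the minimizer is further than \<open>s\<close> from
  \<open>t\<close>, convexity of \<open>\<rho>\<close> gives a \<open>\<delta>\<close> of norm exactly \<open>s\<close> such that the derivative of the criterion at
  \<open>t + \<delta>\<close> in the direction \<open>\<delta>\<close> is nonpositive. The expectation of this derivative is at least of order
  \<open>s\<^sup>2 - s h\<^sup>\<beta>\<close>: symmetry of the noise, monotonicity of \<open>\<rho>'\<close> and the lower bound on \<open>\<integral> \<rho>'' g\<^sub>i\<close> make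
  \<open>u \<mapsto> \<integral> \<rho>' (z + u) g\<^sub>i z dz\<close> odd and at least linear on bounded sets, and a nonzero polynomial vanishes
  only on a null set. Since the derivative is a Lipschitz function of \<open>\<delta>\<close>, a net of \<open>\<delta>\<close>'s whose size does
  not depend on \<open>s\<close> is enough, and an exponential inequality at its points bounds the probability of such
  a \<open>\<delta>\<close> by \<open>C exp (- c s\<^sup>2 n h\<^sup>d)\<close>, as soon as \<open>s\<close> exceeds a multiple of \<open>h\<^sup>\<beta>\<close>. For the given bandwidth
  \<open>n h\<^sup>d\<close> is of order \<open>h\<^sup>-\<^sup>2\<^sup>\<beta>\<close>, so all moments of the error are of order \<open>h\<^sup>\<beta>\<close>.\<close>

section \<open>Taylor expansion on the cube\<close>

text \<open>Two features of \<open>\<rho>\<close> shape the argument. Its derivative is bounded, so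
  the expected score cannot grow linearly for ever and the quadratic drift holds on bounded sets
  only; this is enough because \<open>t\<close> and the minimizer both lie in an l1 ball of radius
  \<open>M\<close>, so that no distance beyond \<open>2 * M\<close> occurs. Its second derivative
  exists only almost everywhere, so the criterion is never expanded to second order; smoothness
  appears after integration against the noise density. Testing at distance exactly \<open>s\<close>
  gives every deviation level its own finite union bound and needs no preliminary consistency of the
  estimator. The exceptional event depends on the sample alone, not on the selection
  \<open>\<theta>\<close>, of which only one coordinate is known to be measurable. The factor
  \<open>n h^d\<close> in the exponent comes from the kernel: a score vanishes where its weight
  does, so its second moment is of order \<open>h^d\<close>. After recentring at \<open>t\<close>,
  \<open>f\<close> enters only through its Taylor remainder, whose bound depends on
  \<open>L\<close>, \<open>\<beta>\<close> and the dimension. All constants therefore serve the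
  whole Hoelder class.\<close>

lemma finite_multi_indices [simp]: "finite (multi_indices m :: ('d::finite \<Rightarrow> nat) set)"
proof (rule finite_subset)
  show "multi_indices m \<subseteq> (PiE UNIV (\<lambda>_. {..m}) :: ('d \<Rightarrow> nat) set)"
  proof
    fix p :: "'d \<Rightarrow> nat" assume "p \<in> multi_indices m"
    then have "p j \<le> m" for j
      using member_le_sum[of j UNIV p] by (simp add: multi_indices_def)
    then show "p \<in> PiE UNIV (\<lambda>_. {..m})" by auto
  qed
qed (simp add: finite_PiE)

lemma zero_in_multi_indices [simp]: "(\<lambda>_. 0) \<in> multi_indices m"
  by (simp add: multi_indices_def)

lemma monomial_zero [simp]: "monomial (\<lambda>_. 0) z = 1"
  by (simp add: monomial_def)

text \<open>The truncated subtraction \<open>p j - 1\<close> is harmless for \<open>p j = 0\<close>,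
  because the factor \<open>real (p j)\<close> then vanishes.\<close>

lemma monomial_has_derivative_axis:
  "((\<lambda>s. monomial p (z + s *\<^sub>R axis j 1)) has_real_derivative
     real (p j) * monomial (p(j := p j - 1)) (z + s *\<^sub>R axis j 1)) (at s within S)"
proof -
  have eq: "monomial q (z + t *\<^sub>R axis j 1) = (z $ j + t) ^ q j * (\<Prod>i\<in>UNIV - {j}. (z $ i) ^ q i)" for q t
    unfolding monomial_def by (subst prod.remove[of _ j]) (auto simp: axis_def intro!: prod.cong)
  have *: "(\<Prod>i\<in>UNIV - {j}. (z $ i) ^ (p(j := p j - 1)) i) = (\<Prod>i\<in>UNIV - {j}. (z $ i) ^ p i)"
    by (intro prod.cong) auto
  show ?thesis
    unfolding eq * by (auto intro!: derivative_eq_intros)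
qed

text \<open>The argument is a whole family \<open>D\<close> of derivatives and not a function, so
  that a partial derivative of the polynomial is again a \<open>taylor_poly\<close>, for the family
  shifted by one index.\<close>

definition taylor_poly :: "nat \<Rightarrow> (('d::finite \<Rightarrow> nat) \<Rightarrow> real ^ 'd \<Rightarrow> real) \<Rightarrow> real ^ 'd \<Rightarrow> real ^ 'd \<Rightarrow> real" where
  "taylor_poly m D x0 x = (\<Sum>p\<in>multi_indices m. D p x0 / (\<Prod>j\<in>UNIV. fact (p j)) * monomial p (x - x0))"

lemma sum_fun_upd:
  fixes p :: "'d::finite \<Rightarrow> nat"
  shows "(\<Sum>i\<in>UNIV. (p(j := k)) i) + p j = (\<Sum>i\<in>UNIV. p i) + k"
proof -
  have "(\<Sum>i\<in>UNIV. (p(j := k)) i) = k + (\<Sum>i\<in>UNIV - {j}. p i)"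
    by (subst sum.remove[of _ j]) (auto intro!: sum.cong)
  moreover have "(\<Sum>i\<in>UNIV. p i) = p j + (\<Sum>i\<in>UNIV - {j}. p i)"
    by (subst sum.remove[of _ j]) auto
  ultimately show ?thesis by simp
qed

text \<open>Terms with \<open>p j = 0\<close> drop out; the others are indexed by raising the
  \<open>j\<close>-th entry of a multi-index of order at most \<open>m\<close>, and the factor
  \<open>p j\<close> produced by differentiation cancels one factor of the factorial.\<close>

lemma taylor_poly_has_derivative_axis:
  "((\<lambda>s. taylor_poly (Suc m) D x0 (x + s *\<^sub>R axis j 1)) has_real_derivative
     taylor_poly m (\<lambda>q. D (q(j := Suc (q j)))) x0 (x + s *\<^sub>R axis j 1)) (at s within S)"
proof -
  let ?F = "\<lambda>p::'a \<Rightarrow> nat. \<Prod>i\<in>UNIV. fact (p i) :: real"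
  let ?z = "x + s *\<^sub>R axis j 1 - x0"
  have fact_upd: "?F (q(j := Suc (q j))) = real (Suc (q j)) * ?F q" for q
  proof -
    have "?F (q(j := Suc (q j))) = fact (Suc (q j)) * (\<Prod>i\<in>UNIV - {j}. fact (q i))"
      by (subst prod.remove[of _ j]) (auto intro!: prod.cong)
    moreover have "?F q = fact (q j) * (\<Prod>i\<in>UNIV - {j}. fact (q i))"
      by (subst prod.remove[of _ j]) auto
    ultimately show ?thesis by simp
  qed
  have diff: "((\<lambda>s. taylor_poly (Suc m) D x0 (x + s *\<^sub>R axis j 1)) has_real_derivative
     (\<Sum>p\<in>multi_indices (Suc m). D p x0 / ?F p * (real (p j) * monomial (p(j := p j - 1)) ?z))) (at s within S)"
  proof -
    have eq: "x + t *\<^sub>R axis j 1 - x0 = (x - x0) + t *\<^sub>R axis j 1" for t by simp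
    show ?thesis
      unfolding taylor_poly_def eq by (intro DERIV_sum DERIV_cmult monomial_has_derivative_axis)
  qed
  have inj: "inj_on (\<lambda>q::'a \<Rightarrow> nat. q(j := Suc (q j))) (multi_indices m)"
  proof (rule inj_onI, rule ext)
    fix p q :: "'a \<Rightarrow> nat" and i assume "p(j := Suc (p j)) = q(j := Suc (q j))"
    from fun_cong[OF this, of i] show "p i = q i" by (auto split: if_splits)
  qed
  have img: "(\<lambda>q. q(j := Suc (q j))) ` multi_indices m = {p \<in> multi_indices (Suc m). p j \<noteq> 0}" (is "?A = ?B")
  proof
    show "?A \<subseteq> ?B"
    proof safe
      fix q :: "'a \<Rightarrow> nat" assume "q \<in> multi_indices m"
      then show "q(j := Suc (q j)) \<in> multi_indices (Suc m)"
        using sum_fun_upd[of q j "Suc (q j)"] by (simp add: multi_indices_def)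
    qed simp
    show "?B \<subseteq> ?A"
    proof
      fix p assume p: "p \<in> ?B"
      then have "p(j := p j - 1) \<in> multi_indices m" "p = (p(j := p j - 1))(j := Suc ((p(j := p j - 1)) j))"
        using sum_fun_upd[of p j "p j - 1"] by (auto simp: multi_indices_def)
      then show "p \<in> ?A" by blast
    qed
  qed
  have "(\<Sum>p\<in>multi_indices (Suc m). D p x0 / ?F p * (real (p j) * monomial (p(j := p j - 1)) ?z)) =
     (\<Sum>p\<in>?B. D p x0 / ?F p * (real (p j) * monomial (p(j := p j - 1)) ?z))"
    by (rule sum.mono_neutral_right) auto
  also have "\<dots> = (\<Sum>q\<in>multi_indices m. D (q(j := Suc (q j))) x0 / ?F q * monomial q ?z)"
    unfolding img[symmetric]
  proof (subst sum.reindex[OF inj], intro sum.cong refl)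
    fix q :: "'a \<Rightarrow> nat"
    let ?q = "q(j := Suc (q j))"
    have "?q(j := ?q j - 1) = q" by auto
    then show "((\<lambda>p. D p x0 / ?F p * (real (p j) * monomial (p(j := p j - 1)) ?z)) \<circ> (\<lambda>q. q(j := Suc (q j)))) q
        = D ?q x0 / ?F q * monomial q ?z"
      unfolding o_def fact_upd by (simp del: of_nat_Suc fun_upd_apply add: fun_upd_same)
  qed
  finally show ?thesis
    using diff unfolding taylor_poly_def by simp
qed

lemma taylor_poly_self: "taylor_poly m D x0 x0 = D (\<lambda>_. 0) x0"
proof -
  have "monomial p (0::real^'a) = (if p = (\<lambda>_. 0) then 1 else 0)" for p
  proof (cases "p = (\<lambda>_. 0)")
    case False
    then obtain j where "p j \<noteq> 0" by auto
    then have "(\<Prod>j\<in>UNIV. ((0::real^'a) $ j) ^ p j) = 0"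
      by (intro prod_zero) (auto intro!: exI[of _ j])
    with False show ?thesis by (simp add: monomial_def)
  qed simp
  then have "taylor_poly m D x0 x0 = (\<Sum>p\<in>multi_indices m. if p = (\<lambda>_. 0) then D p x0 / (\<Prod>j\<in>UNIV. fact (p j)) else 0)"
    unfolding taylor_poly_def by (intro sum.cong) auto
  also have "\<dots> = D (\<lambda>_. 0) x0" by simp
  finally show ?thesis .
qed

lemma mem_unit_cube: "x \<in> unit_cube \<longleftrightarrow> (\<forall>i. 0 \<le> x $ i \<and> x $ i \<le> 1)"
  by (simp add: unit_cube_def mem_box_cart)

lemma norm1_nonneg: "0 \<le> norm1 z"
  by (simp add: norm1_def sum_nonneg)

lemma norm1_le_mono: "(\<And>i. \<bar>y $ i\<bar> \<le> \<bar>z $ i\<bar>) \<Longrightarrow> norm1 y \<le> norm1 z"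
  by (simp add: norm1_def sum_mono)

text \<open>The remainder of order \<open>m + 1\<close> has as its partial derivatives the remainders of order \<open>m\<close> of the
  partial derivatives of \<open>f\<close>; moving from \<open>x0\<close> to \<open>x\<close> one coordinate at a time needs no joint
  differentiability.\<close>

lemma taylor_remainder_aux:
  fixes x0 x :: "real ^ 'd::finite"
  assumes "\<And>p j x. (\<Sum>i\<in>UNIV. p i) < m \<Longrightarrow> x \<in> unit_cube \<Longrightarrow>
        ((\<lambda>s. D p (x + s *\<^sub>R axis j 1)) has_real_derivative D (p(j := Suc (p j))) x)
          (at 0 within {s. x + s *\<^sub>R axis j 1 \<in> unit_cube})"
    and "\<And>p x y. (\<Sum>i\<in>UNIV. p i) = m \<Longrightarrow> x \<in> unit_cube \<Longrightarrow> y \<in> unit_cube \<Longrightarrow>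
        \<bar>D p x - D p y\<bar> \<le> L * norm1 (x - y) powr \<alpha>"
    and "0 \<le> L" "0 \<le> \<alpha>" "x0 \<in> unit_cube" "x \<in> unit_cube"
  shows "\<bar>D (\<lambda>_. 0) x - taylor_poly m D x0 x\<bar> \<le> L * norm1 (x - x0) powr (real m + \<alpha>)"
  using assms
proof (induction m arbitrary: D x)
  case 0
  have "multi_indices 0 = {(\<lambda>_. 0) :: 'd \<Rightarrow> nat}" by (auto simp: multi_indices_def)
  then have "taylor_poly 0 D x0 x = D (\<lambda>_. 0) x0" unfolding taylor_poly_def by (simp only:) simp
  then show ?case using 0(2)[of "\<lambda>_. 0" x x0] 0(3-6) by simp
next
  case (Suc m)
  define R where "R y = D (\<lambda>_. 0) y - taylor_poly (Suc m) D x0 y" for y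
  define B where "B = L * norm1 (x - x0) powr (real m + \<alpha>)"
  define E where "E j = (\<lambda>q::'d \<Rightarrow> nat. D (q(j := Suc (q j))))" for j
  have B0: "0 \<le> B" using Suc.prems(3) by (simp add: B_def)
  have IH: "\<bar>E j (\<lambda>_. 0) y - taylor_poly m (E j) x0 y\<bar> \<le> L * norm1 (y - x0) powr (real m + \<alpha>)"
    if "y \<in> unit_cube" for y j
  proof (rule Suc.IH)
    fix p :: "'d \<Rightarrow> nat" and i and y :: "real^'d" assume p: "(\<Sum>i\<in>UNIV. p i) < m" "y \<in> unit_cube"
    \<comment> \<open>Raising the entries \<open>i\<close> and \<open>j\<close> commutes, also for
      \<open>i = j\<close>. Through the indexing by multi-indices, this takes the place of the
      symmetry of mixed derivatives.\<close>
    have "E j (p(i := Suc (p i))) = D ((p(j := Suc (p j)))(i := Suc ((p(j := Suc (p j))) i)))"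
      unfolding E_def by (rule arg_cong[of _ _ D]) auto
    then show "((\<lambda>s. E j p (y + s *\<^sub>R axis i 1)) has_real_derivative E j (p(i := Suc (p i))) y)
          (at 0 within {s. y + s *\<^sub>R axis i 1 \<in> unit_cube})"
      using Suc.prems(1)[of "p(j := Suc (p j))" y i] p sum_fun_upd[of p j "Suc (p j)"]
      by (simp only: E_def)
  next
    fix p :: "'d \<Rightarrow> nat" and z y :: "real^'d" assume p: "(\<Sum>i\<in>UNIV. p i) = m" "z \<in> unit_cube" "y \<in> unit_cube"
    then show "\<bar>E j p z - E j p y\<bar> \<le> L * norm1 (z - y) powr \<alpha>"
      using Suc.prems(2)[of "p(j := Suc (p j))" z y] p sum_fun_upd[of p j "Suc (p j)"]
      by (simp only: E_def)
  qed (use Suc.prems(3-5) that in auto)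
  \<comment> \<open>Mean value estimate along one coordinate. The segment has to stay in the cube
    and no further from \<open>x0\<close> than \<open>x\<close> is, so that the bound of the
    induction hypothesis is at most \<open>B\<close> all along it.\<close>
  have step: "\<bar>R (y + a *\<^sub>R axis j 1) - R y\<bar> \<le> B * \<bar>a\<bar>"
    if y: "\<And>s. s \<in> closed_segment 0 a \<Longrightarrow> y + s *\<^sub>R axis j 1 \<in> unit_cube \<and> norm1 (y + s *\<^sub>R axis j 1 - x0) \<le> norm1 (x - x0)"
    for y j a
  proof -
    have "norm (R (y + a *\<^sub>R axis j 1) - R (y + 0 *\<^sub>R axis j 1)) \<le> B * norm (a - 0)"
    proof (rule field_differentiable_bound[of "closed_segment 0 a" "\<lambda>s. R (y + s *\<^sub>R axis j 1)" "\<lambda>s. E j (\<lambda>_. 0) (y + s *\<^sub>R axis j 1) - taylor_poly m (E j) x0 (y + s *\<^sub>R axis j 1)"])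
      fix s assume s: "s \<in> closed_segment 0 a"
      have "((\<lambda>t. D (\<lambda>_. 0) ((y + s *\<^sub>R axis j 1) + t *\<^sub>R axis j 1)) has_real_derivative E j (\<lambda>_. 0) (y + s *\<^sub>R axis j 1))
          (at 0 within {t. y + s *\<^sub>R axis j 1 + t *\<^sub>R axis j 1 \<in> unit_cube})"
        using Suc.prems(1)[of "\<lambda>_. 0" "y + s *\<^sub>R axis j 1" j] y[OF s] by (simp add: E_def del: fun_upd_apply)
      then have "((\<lambda>t. D (\<lambda>_. 0) ((y + s *\<^sub>R axis j 1) + t *\<^sub>R axis j 1)) has_real_derivative E j (\<lambda>_. 0) (y + s *\<^sub>R axis j 1))
          (at 0 within ((\<lambda>t. t - s) ` closed_segment 0 a))"
      proof (rule has_field_derivative_subset, safe)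
        fix t assume "t \<in> closed_segment 0 a"
        with y[OF this] show "y + s *\<^sub>R axis j 1 + (t - s) *\<^sub>R axis j 1 \<in> unit_cube"
          by (simp add: scaleR_diff_left)
      qed
      then have "((\<lambda>t. D (\<lambda>_. 0) (y + t *\<^sub>R axis j 1)) has_real_derivative E j (\<lambda>_. 0) (y + s *\<^sub>R axis j 1))
          (at s within closed_segment 0 a)"
      proof -
        have sub: "((\<lambda>t. t - s) has_real_derivative 1) (at s within closed_segment 0 a)"
          by (auto intro!: derivative_eq_intros)
        assume "((\<lambda>t. D (\<lambda>_. 0) ((y + s *\<^sub>R axis j 1) + t *\<^sub>R axis j 1)) has_real_derivative E j (\<lambda>_. 0) (y + s *\<^sub>R axis j 1))
          (at 0 within ((\<lambda>t. t - s) ` closed_segment 0 a))"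
        then have "((\<lambda>t. D (\<lambda>_. 0) ((y + s *\<^sub>R axis j 1) + t *\<^sub>R axis j 1)) has_real_derivative E j (\<lambda>_. 0) (y + s *\<^sub>R axis j 1))
          (at (s - s) within ((\<lambda>t. t - s) ` closed_segment 0 a))" by simp
        from DERIV_image_chain[OF this sub] show ?thesis
          by (simp add: o_def scaleR_diff_left)
      qed
      then show "((\<lambda>s. R (y + s *\<^sub>R axis j 1)) has_field_derivative E j (\<lambda>_. 0) (y + s *\<^sub>R axis j 1) - taylor_poly m (E j) x0 (y + s *\<^sub>R axis j 1)) (at s within closed_segment 0 a)"
        unfolding R_def E_def by (intro DERIV_diff taylor_poly_has_derivative_axis)
      have "L * norm1 (y + s *\<^sub>R axis j 1 - x0) powr (real m + \<alpha>) \<le> B"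
        unfolding B_def using y[OF s] Suc.prems(3-4) by (intro mult_left_mono powr_mono2) (auto simp: norm1_nonneg)
      with IH[of "y + s *\<^sub>R axis j 1" j] y[OF s]
      show "norm (E j (\<lambda>_. 0) (y + s *\<^sub>R axis j 1) - taylor_poly m (E j) x0 (y + s *\<^sub>R axis j 1)) \<le> B" by auto
    qed auto
    then show ?thesis by simp
  qed
  \<comment> \<open>\<open>A\<close> is the set of coordinates already moved from \<open>x0\<close>
    to \<open>x\<close>. For \<open>A = UNIV\<close> the sum is \<open>norm1 (x - x0)\<close>, the
    extra factor that raises the exponent by one.\<close>
  have path: "\<bar>R (\<chi> i. if i \<in> A then x $ i else x0 $ i)\<bar> \<le> B * (\<Sum>i\<in>A. \<bar>x $ i - x0 $ i\<bar>)" for A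
    using finite[of A]
  proof (induction A rule: finite_induct)
    case empty
    have "(\<chi> i. x0 $ i) = x0" by (simp add: vec_eq_iff)
    then show ?case by (simp add: R_def taylor_poly_self)
  next
    case (insert j A)
    let ?y = "\<chi> i. if i \<in> A then x $ i else x0 $ i"
    have "(\<chi> i. if i \<in> insert j A then x $ i else x0 $ i) = ?y + (x $ j - x0 $ j) *\<^sub>R axis j 1"
      using insert by (auto simp: vec_eq_iff axis_def)
    moreover have "\<bar>R (?y + (x $ j - x0 $ j) *\<^sub>R axis j 1) - R ?y\<bar> \<le> B * \<bar>x $ j - x0 $ j\<bar>"
    proof (rule step)
      fix s assume "s \<in> closed_segment 0 (x $ j - x0 $ j)"
      then obtain u where u: "0 \<le> u" "u \<le> 1" "s = u * (x $ j - x0 $ j)"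
        by (auto simp: closed_segment_def)
      have "x0 $ j + u * (x $ j - x0 $ j) = (1 - u) * x0 $ j + u * x $ j" by (simp add: algebra_simps)
      moreover have "0 \<le> (1 - u) * x0 $ j + u * x $ j \<and> (1 - u) * x0 $ j + u * x $ j \<le> 1"
        using u Suc.prems(5,6) convex_bound_le[of "x0 $ j" 1 "x $ j" "1-u" u] by (auto simp: mem_unit_cube)
      ultimately have "?y + s *\<^sub>R axis j 1 \<in> unit_cube"
        using u Suc.prems(5,6) insert by (auto simp: mem_unit_cube axis_def)
      moreover have "norm1 (?y + s *\<^sub>R axis j 1 - x0) \<le> norm1 (x - x0)"
        using u insert by (intro norm1_le_mono) (auto simp: axis_def abs_mult mult_left_le_one_le)
      ultimately show "?y + s *\<^sub>R axis j 1 \<in> unit_cube \<and> norm1 (?y + s *\<^sub>R axis j 1 - x0) \<le> norm1 (x - x0)" ..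
    qed
    ultimately have "\<bar>R (\<chi> i. if i \<in> insert j A then x $ i else x0 $ i) - R ?y\<bar> \<le> B * \<bar>x $ j - x0 $ j\<bar>" by metis
    then have "\<bar>R (\<chi> i. if i \<in> insert j A then x $ i else x0 $ i)\<bar> \<le> B * \<bar>x $ j - x0 $ j\<bar> + \<bar>R ?y\<bar>" by linarith
    with insert.IH insert.hyps show ?case by (simp add: distrib_left)
  qed
  have "(\<chi> i. if i \<in> UNIV then x $ i else x0 $ i) = x" by (simp add: vec_eq_iff)
  with path[of UNIV] have "\<bar>R x\<bar> \<le> B * norm1 (x - x0)"
    by (simp add: norm1_def)
  also have "\<dots> = L * norm1 (x - x0) powr (real (Suc m) + \<alpha>)"
    using norm1_nonneg[of "x - x0"] powr_add[of "norm1 (x - x0)" 1 "real m + \<alpha>"] 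
    by (simp add: B_def algebra_simps)
  finally show ?case by (simp add: R_def)
qed

text \<open>The greatest integer below \<beta> is its ceiling minus one; it is nonnegative for
  positive \<beta>, so \<open>nat\<close> changes nothing.\<close>

lemma strict_floor_less:
  assumes "0 < \<beta>"
  shows "real (strict_floor \<beta>) < \<beta>"
proof -
  let ?P = "\<lambda>k::int. real_of_int k < \<beta>"
  have P: "?P (\<lceil>\<beta>\<rceil> - 1)" by linarith
  moreover have "k \<le> \<lceil>\<beta>\<rceil> - 1" if "?P k" for k using that by linarith
  ultimately have "(GREATEST k. ?P k) = \<lceil>\<beta>\<rceil> - 1" by (rule Greatest_equality)
  moreover have "0 \<le> \<lceil>\<beta>\<rceil> - 1" using assms by linarith
  ultimately show ?thesis using P by (simp add: strict_floor_def)
qed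

lemma taylor_remainder:
  fixes x0 x :: "real ^ 'd::finite"
  assumes "partial_derivatives (strict_floor \<beta>) f D"
    and "\<forall>p. (\<Sum>j\<in>UNIV. p j) = strict_floor \<beta> \<longrightarrow> (\<forall>x\<in>unit_cube. \<forall>y\<in>unit_cube.
        \<bar>D p x - D p y\<bar> \<le> L * norm1 (x - y) powr (\<beta> - real (strict_floor \<beta>)))"
    and "0 \<le> L" "0 < \<beta>" "x0 \<in> unit_cube" "x \<in> unit_cube"
  shows "\<bar>f x - taylor_poly (strict_floor \<beta>) D x0 x\<bar> \<le> L * norm1 (x - x0) powr \<beta>"
proof -
  have "\<bar>D (\<lambda>_. 0) x - taylor_poly (strict_floor \<beta>) D x0 x\<bar>
      \<le> L * norm1 (x - x0) powr (real (strict_floor \<beta>) + (\<beta> - real (strict_floor \<beta>)))"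
  proof (rule taylor_remainder_aux)
  qed (use assms strict_floor_less[of \<beta>] in \<open>auto simp: partial_derivatives_def\<close>)
  then show ?thesis using assms by (simp add: partial_derivatives_def)
qed

text \<open>Existence of partial derivatives alone does not yield joint continuity; the Taylor bound
  at each point does, since the remainder tends to 0 and the polynomial is continuous. This is what
  makes \<open>f\<close> measurable on the cube.\<close>

lemma holder_class_continuous:
  fixes f :: "real ^ 'd::finite \<Rightarrow> real"
  assumes "f \<in> holder_class \<beta> L M" "0 \<le> L" "0 < \<beta>"
  shows "continuous_on unit_cube f"
proof -
  obtain D where D: "partial_derivatives (strict_floor \<beta>) f D"
     "\<forall>p. (\<Sum>j\<in>UNIV. p j) = strict_floor \<beta> \<longrightarrow> (\<forall>x\<in>unit_cube. \<forall>y\<in>unit_cube.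
        \<bar>D p x - D p y\<bar> \<le> L * norm1 (x - y) powr (\<beta> - real (strict_floor \<beta>)))"
    using assms(1) by (auto simp: holder_class_def)
  have D0: "D (\<lambda>_. 0) x = f x" if "x \<in> unit_cube" for x
    using D(1) that by (auto simp: partial_derivatives_def)
  show ?thesis
    unfolding continuous_on_def
  proof
    fix x0 :: "real ^ 'd" assume x0: "x0 \<in> unit_cube"
    let ?T = "taylor_poly (strict_floor \<beta>) D x0"
    have at_x0: "(q \<longlongrightarrow> q x0) (at x0 within unit_cube)" if "continuous_on UNIV q" for q :: "real ^ 'd \<Rightarrow> real"
      using that by (simp add: continuous_on_eq_continuous_at continuous_at_imp_continuous_at_within flip: continuous_within)
    have T: "(?T \<longlongrightarrow> f x0) (at x0 within unit_cube)"
    proof -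
      have "continuous_on UNIV ?T"
        unfolding taylor_poly_def monomial_def by (intro continuous_intros)
      then have "(?T \<longlongrightarrow> ?T x0) (at x0 within unit_cube)"
        by (rule at_x0)
      then show ?thesis using D0[OF x0] by (simp add: taylor_poly_self)
    qed
    have z: "((\<lambda>x. L * norm1 (x - x0) powr \<beta>) \<longlongrightarrow> 0) (at x0 within unit_cube)"
    proof -
      have "continuous_on UNIV (\<lambda>x. norm1 (x - x0))"
        unfolding norm1_def by (intro continuous_intros)
      then have "((\<lambda>x. norm1 (x - x0)) \<longlongrightarrow> norm1 (x0 - x0)) (at x0 within unit_cube)"
        by (rule at_x0)
      then have "((\<lambda>x. norm1 (x - x0)) \<longlongrightarrow> 0) (at x0 within unit_cube)" by (simp add: norm1_def)
      then have "((\<lambda>x. norm1 (x - x0) powr \<beta>) \<longlongrightarrow> 0) (at x0 within unit_cube)"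
        by (rule tendsto_zero_powrI) (use assms norm1_nonneg in \<open>auto intro!: always_eventually\<close>)
      then show ?thesis by (rule tendsto_mult_right_zero)
    qed
    have "((\<lambda>x. f x - ?T x) \<longlongrightarrow> 0) (at x0 within unit_cube)"
    proof (rule tendsto_rabs_zero_cancel, rule tendsto_sandwich[OF _ _ tendsto_const z])
      show "\<forall>\<^sub>F x in at x0 within unit_cube. \<bar>f x - ?T x\<bar> \<le> L * norm1 (x - x0) powr \<beta>"
        using taylor_remainder[OF D assms(2,3) x0] by (auto simp: eventually_at_filter)
    qed auto
    from tendsto_add[OF this T] show "(f \<longlongrightarrow> f x0) (at x0 within unit_cube)" by simp
  qed
qed

section \<open>Nondegeneracy of the local design\<close>

text \<open>Induction on the variables: for fixed values of the others, the polynomial in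
  \<open>x j\<close> has a nonzero coefficient at the power \<open>e s0 j\<close> for almost every
  choice, hence finitely many roots, and Fubini concludes. Terms are indexed by an arbitrary set
  with distinct exponents because the coefficient only collects the terms with a given power of
  \<open>x j\<close>.\<close>

lemma AE_PiM_polynomial_nonzero:
  fixes t :: "'s \<Rightarrow> real" and e :: "'s \<Rightarrow> 'i \<Rightarrow> nat"
  assumes "finite I" "finite S" "s0 \<in> S" "t s0 \<noteq> 0" "inj_on (\<lambda>s. restrict (e s) I) S"
  shows "AE x in Pi\<^sub>M I (\<lambda>_. lborel). (\<Sum>s\<in>S. t s * (\<Prod>i\<in>I. x i ^ e s i)) \<noteq> 0"
  using assms
proof (induction I arbitrary: S s0 rule: finite_induct)
  case empty
  \<comment> \<open>Without variables all restricted exponents coincide, so injectivity leaves a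
    single term, a nonzero constant.\<close>
  have "S = {s0}" using empty by (auto simp: inj_on_def)
  then show ?case using empty by simp
next
  case (insert j I)
  interpret product_sigma_finite "\<lambda>_::'i. lborel :: real measure" ..
  define F where "F x = (\<Sum>s\<in>S. t s * (\<Prod>i\<in>insert j I. x i ^ e s i))" for x
  define n where "n = (\<Sum>s\<in>S. e s j)"
  define q where "q k x = (\<Sum>s\<in>{s\<in>S. e s j = k}. t s * (\<Prod>i\<in>I. x i ^ e s i))" for k and x :: "'i \<Rightarrow> real"
  have le_n: "e s j \<le> n" if "s \<in> S" for s
    unfolding n_def using that insert.prems by (intro member_le_sum) auto
  have F_upd: "F (x(j := y)) = (\<Sum>k\<le>n. q k x * y ^ k)" for x y
  proof -
    have "F (x(j := y)) = (\<Sum>s\<in>S. t s * (\<Prod>i\<in>I. x i ^ e s i) * y ^ e s j)"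
      unfolding F_def
    proof (intro sum.cong refl)
      fix s
      have "(\<Prod>i\<in>I. (x(j := y)) i ^ e s i) = (\<Prod>i\<in>I. x i ^ e s i)"
        using insert.hyps by (intro prod.cong) auto
      then show "t s * (\<Prod>i\<in>insert j I. (x(j := y)) i ^ e s i) = t s * (\<Prod>i\<in>I. x i ^ e s i) * y ^ e s j"
        using insert.hyps by simp
    qed
    also have "\<dots> = (\<Sum>k\<le>n. \<Sum>s\<in>{s\<in>S. e s j = k}. t s * (\<Prod>i\<in>I. x i ^ e s i) * y ^ e s j)"
      using insert.prems le_n by (intro sum.group[symmetric]) auto
    also have "\<dots> = (\<Sum>k\<le>n. q k x * y ^ k)"
      unfolding q_def sum_distrib_right by (intro sum.cong) auto
    finally show ?thesis .
  qed
  have [measurable]: "F \<in> borel_measurable (Pi\<^sub>M (insert j I) (\<lambda>_. lborel))"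
    unfolding F_def by measurable
  define G :: "('i \<Rightarrow> real) \<Rightarrow> ennreal" where "G x = (if F x = 0 then 1 else 0)" for x
  have [measurable]: "G \<in> borel_measurable (Pi\<^sub>M (insert j I) (\<lambda>_. lborel))"
    unfolding G_def by measurable
  \<comment> \<open>The terms of this coefficient share the exponent of \<open>x j\<close>, so their
    exponents still differ on \<open>I\<close>, as the induction hypothesis requires.\<close>
  have "AE x in Pi\<^sub>M I (\<lambda>_. lborel). q (e s0 j) x \<noteq> 0"
    unfolding q_def
  proof (rule insert.IH)
    show "inj_on (\<lambda>s. restrict (e s) I) {s \<in> S. e s j = e s0 j}"
    proof (rule inj_onI)
      fix s s' assume s: "s \<in> {s \<in> S. e s j = e s0 j}" "s' \<in> {s \<in> S. e s j = e s0 j}"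
        and eq: "restrict (e s) I = restrict (e s') I"
      have "restrict (e s) (insert j I) = restrict (e s') (insert j I)"
      proof
        fix i show "restrict (e s) (insert j I) i = restrict (e s') (insert j I) i"
          using s fun_cong[OF eq, of i] by (auto simp: restrict_def)
      qed
      then show "s = s'" by (rule inj_onD[OF insert.prems(4)]) (use s in auto)
    qed
  qed (use insert.prems in auto)
  then have "AE x in Pi\<^sub>M I (\<lambda>_. lborel). (\<integral>\<^sup>+ y. G (x(j := y)) \<partial>lborel) = 0"
  proof (rule AE_mp, intro AE_I2 impI)
    fix x assume "q (e s0 j) x \<noteq> 0"
    then have "finite {y. F (x(j := y)) = 0}"
      unfolding F_upd using polyfun_finite_roots[of "\<lambda>k. q k x" n] le_n[OF insert.prems(2)] by blast
    then have "AE y in lborel. y \<notin> {y. F (x(j := y)) = 0}"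
      by (intro AE_not_in countable_imp_null_set_lborel countable_finite)
    then have "AE y in lborel. G (x(j := y)) = 0"
      by eventually_elim (auto simp: G_def)
    then show "(\<integral>\<^sup>+ y. G (x(j := y)) \<partial>lborel) = 0"
      by (rule nn_integral_zero')
  qed
  then have "(\<integral>\<^sup>+ x. (\<integral>\<^sup>+ y. G (x(j := y)) \<partial>lborel) \<partial>Pi\<^sub>M I (\<lambda>_. lborel)) = 0"
    by (rule nn_integral_zero')
  then have "integral\<^sup>N (Pi\<^sub>M (insert j I) (\<lambda>_. lborel)) G = 0"
    by (subst product_nn_integral_insert) (use insert.hyps in auto)
  then have "AE x in Pi\<^sub>M (insert j I) (\<lambda>_. lborel). F x \<noteq> 0"
    by (subst (asm) nn_integral_0_iff_AE) (auto simp: G_def)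
  then show ?case by (simp add: F_def)
qed

text \<open>The polynomial inside \<open>local_poly\<close>, in the rescaled variable and without
  the window indicator, which equals 1 at every design point in the cube with nonzero kernel
  weight.\<close>

definition poly_sum :: "nat \<Rightarrow> (('d::finite \<Rightarrow> nat) \<Rightarrow> real) \<Rightarrow> real ^ 'd \<Rightarrow> real" where
  "poly_sum b t z = (\<Sum>p\<in>multi_indices b. t p * monomial p z)"

lemma monomial_measurable [measurable]: "monomial p \<in> borel_measurable borel"
  unfolding monomial_def by measurable

lemma poly_sum_measurable [measurable]: "poly_sum b t \<in> borel_measurable borel"
  unfolding poly_sum_def by measurable

text \<open>Lebesgue measure on the vector type is the image of the product measure over
  \<open>Basis\<close>, so the statement is the product version read in coordinates.\<close>

lemma AE_poly_sum_nonzero: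
  fixes t :: "('d::finite \<Rightarrow> nat) \<Rightarrow> real"
  assumes "p0 \<in> multi_indices b" "t p0 \<noteq> 0"
  shows "AE z in lborel. poly_sum b t z \<noteq> 0"
proof -
  let ?e = "\<lambda>p::'d \<Rightarrow> nat. \<lambda>v::real^'d. p (axis_index v)"
  have "AE x in Pi\<^sub>M (Basis :: (real^'d) set) (\<lambda>_. lborel).
      (\<Sum>p\<in>multi_indices b. t p * (\<Prod>i\<in>Basis. x i ^ ?e p i)) \<noteq> 0"
  proof (rule AE_PiM_polynomial_nonzero[where t = t and e = ?e, OF _ _ assms])
    show "inj_on (\<lambda>p. restrict (?e p) Basis) (multi_indices b)"
    proof (intro inj_onI ext)
      fix p q :: "'d \<Rightarrow> nat" and j assume "restrict (?e p) Basis = restrict (?e q) Basis"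
      from fun_cong[OF this, of "axis j 1"] show "p j = q j" by simp
    qed
  qed auto
  moreover have "monomial p (\<Sum>v\<in>Basis. x v *\<^sub>R v) = (\<Prod>i\<in>Basis. x i ^ ?e p i)" for p and x :: "real^'d \<Rightarrow> real"
  proof -
    have "(\<Prod>i\<in>Basis. x i ^ ?e p i) = (\<Prod>j\<in>UNIV. x (axis j 1) ^ p j)"
      by (rule prod.reindex_bij_witness[of _ "\<lambda>j. axis j 1" axis_index]) (auto simp: axis_index[symmetric])
    also have "\<dots> = monomial p (\<Sum>v\<in>Basis. x v *\<^sub>R v)"
      unfolding monomial_def
    proof (intro prod.cong refl)
      fix j
      have "(\<Sum>v\<in>Basis. x v *\<^sub>R v) $ j = (\<Sum>v\<in>Basis. x v *\<^sub>R v) \<bullet> axis j 1"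
        by (simp add: inner_axis)
      also have "\<dots> = x (axis j 1)"
        by (subst inner_sum_left_Basis) auto
      finally show "x (axis j 1) ^ p j = ((\<Sum>v\<in>Basis. x v *\<^sub>R v) $ j) ^ p j" by simp
    qed
    finally show ?thesis ..
  qed
  ultimately show ?thesis
    unfolding poly_sum_def by (subst lborel_eq, subst AE_distr_iff) auto
qed

lemma abs_monomial_le_1:
  assumes "\<And>j. \<bar>z $ j\<bar> \<le> 1"
  shows "\<bar>monomial p z\<bar> \<le> 1"
proof -
  have "(\<Prod>j\<in>UNIV. \<bar>z $ j ^ p j\<bar>) \<le> (\<Prod>j\<in>(UNIV::'a set). 1)"
    by (intro prod_mono) (auto simp: power_abs assms power_le_one)
  then show ?thesis by (simp add: monomial_def abs_prod)
qed

lemma abs_poly_sum_le: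
  assumes "\<And>j. \<bar>z $ j\<bar> \<le> 1"
  shows "\<bar>poly_sum b t z\<bar> \<le> (\<Sum>p\<in>multi_indices b. \<bar>t p\<bar>)"
  unfolding poly_sum_def
  by (rule order_trans[OF sum_abs])
     (auto simp: abs_mult abs_monomial_le_1[OF assms] mult_left_le intro!: sum_mono)

lemma poly_sum_scale: "poly_sum b (\<lambda>p. a * t p) z = a * poly_sum b t z"
  by (simp add: poly_sum_def sum_distrib_left mult.assoc)

lemma poly_sum_add: "poly_sum b (\<lambda>p. s p + t p) z = poly_sum b s z + poly_sum b t z"
  by (simp add: poly_sum_def sum.distrib distrib_right)

lemma poly_sum_diff: "poly_sum b (\<lambda>p. s p - t p) z = poly_sum b s z - poly_sum b t z"
  by (simp add: poly_sum_def sum_subtractf left_diff_distrib)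

text \<open>The type of all functions carries the product topology over a possibly infinite index
  type. Forcing \<open>t p = 0\<close> off \<open>P\<close> makes the sphere a closed subset of a
  product of compact intervals and singletons.\<close>

lemma compact_l1_sphere:
  assumes "finite P"
  shows "compact {t :: 'a \<Rightarrow> real. (\<forall>p. p \<notin> P \<longrightarrow> t p = 0) \<and> (\<Sum>p\<in>P. \<bar>t p\<bar>) = 1}" (is "compact ?S")
proof -
  let ?B = "PiE UNIV (\<lambda>p. if p \<in> P then {-1..1::real} else {0})"
  have "compactin (product_topology (\<lambda>_. euclidean) UNIV) ?B"
    unfolding compactin_PiE by (auto simp: )
  then have B: "compact ?B"
    by (simp add: euclidean_product_topology)
  have cl: "closed {t :: 'a \<Rightarrow> real. (\<Sum>p\<in>P. \<bar>t p\<bar>) = 1}"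
    by (intro closed_Collect_eq continuous_intros continuous_on_product_coordinates)
  have eq: "?S = ?B \<inter> {t. (\<Sum>p\<in>P. \<bar>t p\<bar>) = 1}"
  proof (intro set_eqI iffI)
    fix t :: "'a \<Rightarrow> real" assume "t \<in> ?S"
    then have t: "\<forall>p. p \<notin> P \<longrightarrow> t p = 0" "(\<Sum>p\<in>P. \<bar>t p\<bar>) = 1" by auto
    have "\<bar>t p\<bar> \<le> 1" if "p \<in> P" for p
      using member_le_sum[of p P "\<lambda>p. \<bar>t p\<bar>"] that assms t by auto
    then have "t p \<in> (if p \<in> P then {-1..1} else {0})" for p
      using t \<open>\<And>p. p \<in> P \<Longrightarrow> \<bar>t p\<bar> \<le> 1\<close>[of p] by (cases "p \<in> P") (auto simp: abs_le_iff)
    then show "t \<in> ?B \<inter> {t. (\<Sum>p\<in>P. \<bar>t p\<bar>) = 1}" using t by blast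
  next
    fix t :: "'a \<Rightarrow> real" assume t: "t \<in> ?B \<inter> {t. (\<Sum>p\<in>P. \<bar>t p\<bar>) = 1}"
    have "t p = 0" if "p \<notin> P" for p
    proof -
      have "t p \<in> (if p \<in> P then {-1..1} else {0})" using t by blast
      then show ?thesis using that by simp
    qed
    then show "t \<in> ?S" using t by blast
  qed
  show ?thesis unfolding eq by (rule compact_Int_closed[OF B cl])
qed

text \<open>The right-hand side is a quadratic form. It is positive on the l1 sphere, since a
  nonzero polynomial vanishes only on a null set while \<open>\<kappa>\<close> has positive mass;
  its minimum over this compact set is the constant, and homogeneity does the rest.\<close>

lemma poly_sum_square_coercive:
  fixes \<kappa> :: "real ^ 'd::finite \<Rightarrow> real"
  assumes int: "integrable lborel \<kappa>" and nonneg: "\<And>z. 0 \<le> \<kappa> z"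
    and supp: "\<And>z j. \<kappa> z \<noteq> 0 \<Longrightarrow> \<bar>z $ j\<bar> \<le> 1" and pos: "0 < (LINT z|lborel. \<kappa> z)"
  obtains c where "0 < c"
    "\<And>t. c * (\<Sum>p\<in>multi_indices b. \<bar>t p\<bar>)\<^sup>2 \<le> (LINT z|lborel. (poly_sum b t z)\<^sup>2 * \<kappa> z)"
proof -
  let ?P = "multi_indices b :: ('d \<Rightarrow> nat) set"
  let ?n = "\<lambda>t. \<Sum>p\<in>?P. \<bar>t p :: real\<bar>"
  define S where "S = {t :: ('d \<Rightarrow> nat) \<Rightarrow> real. (\<forall>p. p \<notin> ?P \<longrightarrow> t p = 0) \<and> ?n t = 1}"
  define Q where "Q t = (LINT z|lborel. (poly_sum b t z)\<^sup>2 * \<kappa> z)" for t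
  note [measurable] = borel_measurable_integrable[OF int]
  have int_mono: "integrable lborel (\<lambda>z. monomial p z * monomial q z * \<kappa> z)" for p q
  proof (rule Bochner_Integration.integrable_bound[OF int])
    show "AE z in lborel. norm (monomial p z * monomial q z * \<kappa> z) \<le> norm (\<kappa> z)"
    proof (rule AE_I2)
      fix z
      show "norm (monomial p z * monomial q z * \<kappa> z) \<le> norm (\<kappa> z)"
      proof (cases "\<kappa> z = 0")
        case False
        then have "\<bar>monomial p z\<bar> * \<bar>monomial q z\<bar> \<le> 1"
          using supp by (intro mult_le_one abs_monomial_le_1) auto
        then show ?thesis by (simp add: abs_mult mult_left_le_one_le)
      qed simp
    qed
  qed measurable
  \<comment> \<open>The expansion into a finite Gram form turns continuity in \<open>t\<close> into
    continuity of a polynomial in finitely many coordinates.\<close>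
  have sq: "(poly_sum b t z)\<^sup>2 * \<kappa> z = (\<Sum>p\<in>?P. \<Sum>q\<in>?P. t p * t q * (monomial p z * monomial q z * \<kappa> z))" for t z
    unfolding poly_sum_def power2_eq_square sum_product
    by (simp add: sum_distrib_left mult_ac)
  have int_Q: "integrable lborel (\<lambda>z. (poly_sum b t z)\<^sup>2 * \<kappa> z)" for t
    unfolding sq by (intro Bochner_Integration.integrable_sum integrable_mult_right int_mono)
  have Q_eq: "Q t = (\<Sum>p\<in>?P. \<Sum>q\<in>?P. t p * t q * (LINT z|lborel. monomial p z * monomial q z * \<kappa> z))" for t
    unfolding Q_def sq
    by (simp add: Bochner_Integration.integral_sum Bochner_Integration.integrable_sum integrable_mult_right int_mono)
  have cont: "continuous_on S Q"
    unfolding Q_eq by (intro continuous_intros continuous_on_subset[OF continuous_on_product_coordinates]) auto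
  have Q_pos: "0 < Q t" if t: "t \<in> S" for t
  proof (rule ccontr)
    assume "\<not> 0 < Q t"
    moreover have "0 \<le> Q t" unfolding Q_def by (intro integral_nonneg_AE) (simp add: nonneg)
    ultimately have "Q t = 0" by simp
    then have "AE z in lborel. (poly_sum b t z)\<^sup>2 * \<kappa> z = 0"
      unfolding Q_def by (subst (asm) integral_nonneg_eq_0_iff_AE[OF int_Q]) (auto simp: nonneg)
    moreover obtain p where "p \<in> ?P" "t p \<noteq> 0"
    proof (rule ccontr)
      assume "\<not> thesis"
      with that have "t p = 0" if "p \<in> ?P" for p using that by blast
      then show False using t by (simp add: S_def)
    qed
    then have "AE z in lborel. poly_sum b t z \<noteq> 0" by (rule AE_poly_sum_nonzero)
    ultimately have "AE z in lborel. \<kappa> z = 0" by eventually_elim auto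
    then have "(LINT z|lborel. \<kappa> z) = 0" by (simp add: integral_eq_zero_AE)
    then show False using pos by simp
  qed
  have "S \<noteq> {}"
  proof -
    have "(\<lambda>p. if p = (\<lambda>_. 0) then 1 else 0) \<in> S" by (auto simp: S_def if_distrib cong: if_cong)
    then show ?thesis by auto
  qed
  then obtain t0 where t0: "t0 \<in> S" "\<And>t. t \<in> S \<Longrightarrow> Q t0 \<le> Q t"
    using continuous_attains_inf[OF compact_l1_sphere[of ?P, folded S_def] _ cont] by auto
  show ?thesis
  proof (rule that[OF Q_pos[OF t0(1)]])
    fix t :: "('d \<Rightarrow> nat) \<Rightarrow> real"
    show "Q t0 * (?n t)\<^sup>2 \<le> (LINT z|lborel. (poly_sum b t z)\<^sup>2 * \<kappa> z)"
    proof (cases "?n t = 0")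
      case True
      then show ?thesis by (simp, intro integral_nonneg_AE) (simp add: nonneg)
    next
      case False
      \<comment> \<open>Values of \<open>t\<close> off the multi-indices are arbitrary; they are set
        to 0 so that the normalized vector lies in \<open>S\<close>.\<close>
      define u where "u p = (if p \<in> ?P then t p / ?n t else 0)" for p
      have n: "0 < ?n t" using False by (simp add: order_less_le sum_nonneg)
      have "?n u = 1"
        using n by (simp add: u_def sum_divide_distrib[symmetric])
      then have "u \<in> S" by (auto simp: S_def u_def)
      have "poly_sum b t z = ?n t * poly_sum b u z" for z
        using n by (simp add: poly_sum_def u_def sum_distrib_left)
      then have "Q t = (?n t)\<^sup>2 * Q u"
        by (simp add: Q_def power_mult_distrib mult.assoc)
      with t0(2)[OF \<open>u \<in> S\<close>] show ?thesis by (simp add: Q_def mult.commute mult_left_mono)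
    qed
  qed
qed

text \<open>For small \<open>h\<close> the support of the rescaled kernel meets the cube exactly in the inward cone, so
  rescaling turns the design integral into one that no longer depends on \<open>h\<close>.\<close>

lemma integral_cube_rescale:
  fixes F :: "real ^ 'd::finite \<Rightarrow> real" and x0 :: "real ^ 'd"
  assumes x0: "x0 \<in> unit_cube" and [measurable]: "F \<in> borel_measurable borel"
    and supp: "\<And>z j. F z \<noteq> 0 \<Longrightarrow> \<bar>z $ j\<bar> \<le> 1"
    and h: "0 < h" "\<And>j. x0 $ j \<noteq> 0 \<Longrightarrow> h \<le> x0 $ j" "\<And>j. x0 $ j \<noteq> 1 \<Longrightarrow> h \<le> 1 - x0 $ j"
  shows "(LINT x:unit_cube|lborel. F ((x - x0) /\<^sub>R h)) = h ^ CARD('d) * (LINT z:inward_cone x0|lborel. F z)"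
proof -
  have [measurable]: "unit_cube \<in> sets (borel :: (real ^ 'd) measure)" by (simp add: unit_cube_def)
  have "(LINT x:unit_cube|lborel. F ((x - x0) /\<^sub>R h)) =
     integral\<^sup>L (density (distr lborel borel (\<lambda>x. x0 + h *\<^sub>R x)) (\<lambda>_. \<bar>h\<bar>^DIM(real^'d))) (\<lambda>x. indicator unit_cube x *\<^sub>R F ((x - x0) /\<^sub>R h))"
    unfolding set_lebesgue_integral_def using lborel_affine[of h x0] h by simp
  also have "\<dots> = h ^ CARD('d) * (LINT z|lborel. indicator unit_cube (x0 + h *\<^sub>R z) * F z)"
    using h by (subst integral_density) (auto simp: integral_distr)
  also have "(LINT z|lborel. indicator unit_cube (x0 + h *\<^sub>R z) * F z) = (LINT z:inward_cone x0|lborel. F z)"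
    unfolding set_lebesgue_integral_def
  proof (intro Bochner_Integration.integral_cong refl)
    fix z :: "real ^ 'd"
    show "indicator unit_cube (x0 + h *\<^sub>R z) * F z = indicator (inward_cone x0) z *\<^sub>R F z"
    proof (cases "F z = 0")
      case False
      \<comment> \<open>A face that does not contain \<open>x0\<close> is at distance at least
        \<open>h\<close> and cannot be crossed by a step of size at most \<open>h\<close>; at a face
        containing \<open>x0\<close> only the sign of \<open>z $ j\<close> matters.\<close>
      have "(0 \<le> x0 $ j + h * z $ j \<and> x0 $ j + h * z $ j \<le> 1) \<longleftrightarrow> 
         ((x0 $ j = 0 \<longrightarrow> 0 \<le> z $ j) \<and> (x0 $ j = 1 \<longrightarrow> z $ j \<le> 0))" for j
      proof -
        have z: "\<bar>h * z $ j\<bar> \<le> h"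
          using supp[OF False, of j] h by (simp add: abs_mult)
        have "0 \<le> x0 $ j + h * z $ j \<longleftrightarrow> (x0 $ j = 0 \<longrightarrow> 0 \<le> z $ j)"
        proof (cases "x0 $ j = 0")
          case True then show ?thesis using h(1) by (simp add: zero_le_mult_iff)
        next
          case False then show ?thesis using h(2)[of j] z by auto
        qed
        moreover have "x0 $ j + h * z $ j \<le> 1 \<longleftrightarrow> (x0 $ j = 1 \<longrightarrow> z $ j \<le> 0)"
        proof (cases "x0 $ j = 1")
          case True then show ?thesis using h(1) by (simp add: mult_le_0_iff)
        next
          case False then show ?thesis using h(3)[of j] z by auto
        qed
        ultimately show ?thesis by simp
      qed
      then have "x0 + h *\<^sub>R z \<in> unit_cube \<longleftrightarrow> z \<in> inward_cone x0"
        by (simp add: mem_unit_cube inward_cone_def)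
      then show ?thesis by (simp add: indicator_def)
    qed simp
  qed
  finally show ?thesis .
qed

text \<open>The bound is the smallest distance from \<open>x0\<close> to the faces that do not
  contain it, capped at 1. Faces through \<open>x0\<close> contribute the neutral value 1, since the
  cone takes care of them.\<close>

lemma bandwidth_fits_inward_cone:
  fixes x0 :: "real ^ 'd::finite"
  assumes "x0 \<in> unit_cube"
  obtains h0 where "0 < h0" "h0 \<le> 1" "\<And>j. x0 $ j \<noteq> 0 \<Longrightarrow> h0 \<le> x0 $ j" "\<And>j. x0 $ j \<noteq> 1 \<Longrightarrow> h0 \<le> 1 - x0 $ j"
proof -
  define A where "A = insert 1 ((\<lambda>j. if x0 $ j = 0 then 1 else x0 $ j) ` UNIV \<union> (\<lambda>j. if x0 $ j = 1 then 1 else 1 - x0 $ j) ` UNIV)"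
  have fin: "finite A" "A \<noteq> {}" by (auto simp: A_def)
  show ?thesis
  proof (rule that[of "Min A"])
    have "0 < a" if "a \<in> A" for a
      using that assms by (auto simp: A_def mem_unit_cube order_less_le split: if_splits)
    then show "0 < Min A" using fin by simp
    show "Min A \<le> 1" using fin by (auto intro!: Min_le simp: A_def)
    show "Min A \<le> x0 $ j" if "x0 $ j \<noteq> 0" for j
      using fin that by (intro Min_le) (auto simp: A_def image_iff)
    show "Min A \<le> 1 - x0 $ j" if "x0 $ j \<noteq> 1" for j
      using fin that by (intro Min_le) (auto simp: A_def image_iff)
  qed
qed

section \<open>The contrast function and the noise\<close>

text \<open>This gives a meaning to integrals of the second derivative of \<open>\<rho>\<close>,
  which need not exist everywhere. The points of differentiability form a Borel set by the Cauchy
  criterion for difference quotients; on this set the derivative is a limit of measurable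
  quotients.\<close>

lemma borel_measurable_deriv:
  fixes f :: "real \<Rightarrow> real"
  assumes f: "continuous_on UNIV f"
  shows "deriv f \<in> borel_measurable borel"
proof -
  define q where "q h x = (f (x + h) - f x) / h" for h x
  have [measurable]: "f \<in> borel_measurable borel"
    using f by (rule borel_measurable_continuous_onI)
  \<comment> \<open>Rational increments keep the quantifiers countable. Continuity of
    \<open>f\<close> later extends the Cauchy condition to real increments.\<close>
  define D where "D = {x. \<forall>k::nat. \<exists>m::nat. \<forall>h l::rat. 0 < \<bar>h\<bar> \<longrightarrow> 0 < \<bar>l\<bar> \<longrightarrow>
      \<bar>h\<bar> < 1 / of_nat (Suc m) \<longrightarrow> \<bar>l\<bar> < 1 / of_nat (Suc m) \<longrightarrow> \<bar>q (of_rat h) x - q (of_rat l) x\<bar> \<le> 1 / real (Suc k)}"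
  have [measurable]: "D \<in> sets borel"
    unfolding D_def q_def by measurable
  have D_iff: "x \<in> D \<longleftrightarrow> f field_differentiable at x" for x
  proof
    assume "f field_differentiable at x"
    then obtain d where "((\<lambda>h. q h x) \<longlongrightarrow> d) (at 0)"
      by (auto simp: field_differentiable_def DERIV_def q_def)
    have tri: "\<bar>a - b\<bar> \<le> t" if "\<bar>a - d\<bar> < t / 2" "\<bar>b - d\<bar> < t / 2" for a b d t :: real
      using that by linarith
    show "x \<in> D"
      unfolding D_def
    proof (intro CollectI allI)
      fix k
      have "0 < 1 / real (Suc k) / 2" by simp
      from tendstoD[OF \<open>((\<lambda>h. q h x) \<longlongrightarrow> d) (at 0)\<close> this]
      obtain e where e: "0 < e" "\<And>h. 0 < \<bar>h\<bar> \<Longrightarrow> \<bar>h\<bar> < e \<Longrightarrow> \<bar>q h x - d\<bar> < 1 / real (Suc k) / 2"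
        unfolding eventually_at by (auto simp: dist_real_def)
      obtain m where m: "1 / real (Suc m) < e"
        using e(1) by (meson nat_approx_posE)
      have "\<bar>q (of_rat h) x - q (of_rat l) x\<bar> \<le> 1 / real (Suc k)"
        if "0 < \<bar>h\<bar>" "0 < \<bar>l\<bar>" "\<bar>h\<bar> < 1 / of_nat (Suc m)" "\<bar>l\<bar> < 1 / of_nat (Suc m)" for h l :: rat
      proof -
        have small: "\<bar>real_of_rat a\<bar> < e" if "\<bar>a\<bar> < 1 / of_nat (Suc m)" for a
        proof -
          have "real_of_rat \<bar>a\<bar> < real_of_rat (1 / of_nat (Suc m))"
            using that by (simp only: of_rat_less)
          then show ?thesis using m by (simp add: of_rat_divide del: of_nat_Suc)
        qed
        have "\<bar>q (of_rat h) x - d\<bar> < 1 / real (Suc k) / 2" "\<bar>q (of_rat l) x - d\<bar> < 1 / real (Suc k) / 2"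
          by (rule e(2), use that in simp, rule small, rule that)+
        then show ?thesis by (rule tri)
      qed
      then show "\<exists>m. \<forall>h l::rat. 0 < \<bar>h\<bar> \<longrightarrow> 0 < \<bar>l\<bar> \<longrightarrow>
        \<bar>h\<bar> < 1 / of_nat (Suc m) \<longrightarrow> \<bar>l\<bar> < 1 / of_nat (Suc m) \<longrightarrow> \<bar>q (of_rat h) x - q (of_rat l) x\<bar> \<le> 1 / real (Suc k)"
        by blast
    qed
  next
    assume x: "x \<in> D"
    have q_lim: "((\<lambda>s. q s x) \<longlongrightarrow> q h x) (at h)" if "h \<noteq> 0" for h
    proof -
      have "isCont f (x + h)" using f by (simp add: continuous_on_eq_continuous_at)
      then have "isCont (\<lambda>s. f (x + s)) h"
        by (rule isCont_o2[rotated]) simp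
      then have "isCont (\<lambda>s. q s x) h"
        unfolding q_def using that by (intro continuous_intros)
      then show ?thesis by (simp add: isCont_def)
    qed
    have approx: "\<exists>r::rat. 0 < \<bar>r\<bar> \<and> \<bar>of_rat r\<bar> < \<delta> \<and> \<bar>q (of_rat r) x - q h x\<bar> < e"
      if hd: "0 < \<bar>h\<bar>" "\<bar>h\<bar> < \<delta>" "0 < e" for h \<delta> e
    proof -
      have "h \<noteq> 0" using hd by simp
      from tendstoD[OF q_lim[OF this] hd(3)] obtain s where s: "0 < s" "\<And>t. t \<noteq> h \<Longrightarrow> \<bar>t - h\<bar> < s \<Longrightarrow> \<bar>q t x - q h x\<bar> < e"
        by (auto simp: eventually_at dist_real_def)
      \<comment> \<open>The bound \<open>\<bar>h\<bar>\<close> on the gap keeps \<open>r\<close> on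
        the same side of 0 as \<open>h\<close>, and \<open>\<delta> - \<bar>h\<bar>\<close> keeps it
        inside the range of increments.\<close>
      obtain r where r: "h < of_rat r" "of_rat r < h + min s (min (\<delta> - \<bar>h\<bar>) \<bar>h\<bar>)"
        using of_rat_dense[of h "h + min s (min (\<delta> - \<bar>h\<bar>) \<bar>h\<bar>)"] s(1) hd by auto
      have "real_of_rat r \<noteq> 0" using r hd by auto
      moreover have "\<bar>real_of_rat r\<bar> < \<delta>" using r by linarith
      ultimately show ?thesis using r s(2)[of "of_rat r"] by (intro exI[of _ r]) auto
    qed
    have cauchy: "\<exists>\<delta>>0. \<forall>h l. 0 < \<bar>h\<bar> \<longrightarrow> \<bar>h\<bar> < \<delta> \<longrightarrow> 0 < \<bar>l\<bar> \<longrightarrow> \<bar>l\<bar> < \<delta> \<longrightarrow> \<bar>q h x - q l x\<bar> \<le> e"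
      if e0: "0 < e" for e
    proof -
      obtain k where k: "1 / real (Suc k) < e" using e0 by (meson nat_approx_posE)
      from x obtain m where m: "\<And>h l::rat. 0 < \<bar>h\<bar> \<Longrightarrow> 0 < \<bar>l\<bar> \<Longrightarrow>
        \<bar>h\<bar> < 1 / of_nat (Suc m) \<Longrightarrow> \<bar>l\<bar> < 1 / of_nat (Suc m) \<Longrightarrow> \<bar>q (of_rat h) x - q (of_rat l) x\<bar> \<le> 1 / real (Suc k)"
        unfolding D_def by blast
      have m': "\<bar>q (of_rat h) x - q (of_rat l) x\<bar> \<le> 1 / real (Suc k)"
        if "0 < \<bar>h\<bar>" "0 < \<bar>l\<bar>" "\<bar>real_of_rat h\<bar> < 1 / real (Suc m)" "\<bar>real_of_rat l\<bar> < 1 / real (Suc m)" for h l :: rat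
      proof (rule m)
        have "real_of_rat \<bar>a\<bar> < real_of_rat (1 / of_nat (Suc m)) \<Longrightarrow> \<bar>a\<bar> < 1 / of_nat (Suc m)" for a
          by (simp only: of_rat_less)
        then show "\<bar>h\<bar> < 1 / of_nat (Suc m)" "\<bar>l\<bar> < 1 / of_nat (Suc m)"
          using that by (auto simp: of_rat_divide simp del: of_nat_Suc)
      qed (use that in auto)
      have tri: "\<bar>a' - b'\<bar> \<le> e" if "\<bar>a - b\<bar> \<le> t" "\<bar>a - a'\<bar> < (e - t) / 2" "\<bar>b - b'\<bar> < (e - t) / 2"
        for a b a' b' t :: real
        using that by argo
      show ?thesis
      proof (intro exI[of _ "1 / real (Suc m)"] conjI allI impI)
        fix h l assume hl: "0 < \<bar>h\<bar>" "\<bar>h\<bar> < 1 / real (Suc m)" "0 < \<bar>l\<bar>" "\<bar>l\<bar> < 1 / real (Suc m)"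
        let ?e = "(e - 1 / real (Suc k)) / 2"
        have e: "0 < ?e" using k by simp
        obtain r where r: "0 < \<bar>r\<bar>" "\<bar>of_rat r\<bar> < 1 / real (Suc m)" "\<bar>q (of_rat r) x - q h x\<bar> < ?e"
          using approx[OF hl(1,2) e] by blast
        obtain s where s: "0 < \<bar>s\<bar>" "\<bar>of_rat s\<bar> < 1 / real (Suc m)" "\<bar>q (of_rat s) x - q l x\<bar> < ?e"
          using approx[OF hl(3,4) e] by blast
        show "\<bar>q h x - q l x\<bar> \<le> e"
          by (rule tri[OF m'[OF r(1) s(1) r(2) s(2)] r(3) s(3)])
      qed simp
    qed
    have "Cauchy (\<lambda>n. q (1 / real (Suc n)) x)"
    proof (rule CauchyI')
      fix e :: real assume "0 < e"
      then obtain \<delta> where \<delta>: "0 < \<delta>" "\<And>h l. 0 < \<bar>h\<bar> \<Longrightarrow> \<bar>h\<bar> < \<delta> \<Longrightarrow> 0 < \<bar>l\<bar> \<Longrightarrow> \<bar>l\<bar> < \<delta> \<Longrightarrow> \<bar>q h x - q l x\<bar> \<le> e / 2"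
        using cauchy[of "e / 2"] by auto
      obtain m where m: "1 / real (Suc m) < \<delta>" using \<delta>(1) by (meson nat_approx_posE)
      have small: "1 / real (Suc n) < \<delta>" if "m \<le> n" for n
      proof -
        have "1 / real (Suc n) \<le> 1 / real (Suc m)" using that by (intro divide_left_mono) auto
        then show ?thesis using m by linarith
      qed
      show "\<exists>M. \<forall>n\<ge>M. \<forall>n'>n. dist (q (1 / real (Suc n)) x) (q (1 / real (Suc n')) x) < e"
      proof (intro exI[of _ m] allI impI)
        fix n n'
        assume "m \<le> n" "n < n'"
        then have "\<bar>q (1 / real (Suc n)) x - q (1 / real (Suc n')) x\<bar> \<le> e / 2"
          using small[of n] small[of n'] by (intro \<delta>(2)) simp_all
        then show "dist (q (1 / real (Suc n)) x) (q (1 / real (Suc n')) x) < e"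
          using \<open>0 < e\<close> by (simp only: dist_real_def)
      qed
    qed
    then obtain d where d: "(\<lambda>n. q (1 / real (Suc n)) x) \<longlonglongrightarrow> d"
      using real_Cauchy_convergent by (auto simp: convergent_def)
    have "((\<lambda>h. q h x) \<longlongrightarrow> d) (at 0)"
    proof (rule tendstoI)
      fix e :: real assume "0 < e"
      then obtain \<delta> where \<delta>: "0 < \<delta>" "\<And>h l. 0 < \<bar>h\<bar> \<Longrightarrow> \<bar>h\<bar> < \<delta> \<Longrightarrow> 0 < \<bar>l\<bar> \<Longrightarrow> \<bar>l\<bar> < \<delta> \<Longrightarrow> \<bar>q h x - q l x\<bar> \<le> e / 2"
        using cauchy[of "e / 2"] by auto
      have "\<bar>q h x - d\<bar> \<le> e / 2" if h: "0 < \<bar>h\<bar>" "\<bar>h\<bar> < \<delta>" for h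
      proof (rule tendsto_upperbound)
        show "(\<lambda>n. \<bar>q h x - q (1 / real (Suc n)) x\<bar>) \<longlonglongrightarrow> \<bar>q h x - d\<bar>"
          using d by (intro tendsto_intros)
        have "(\<lambda>n. 1 / real (Suc n)) \<longlonglongrightarrow> 0"
          using LIMSEQ_Suc[OF lim_1_over_n] by simp
        from order_tendstoD(2)[OF this \<delta>(1)]
        show "\<forall>\<^sub>F n in sequentially. \<bar>q h x - q (1 / real (Suc n)) x\<bar> \<le> e / 2"
          by eventually_elim (intro \<delta>(2) h, simp_all)
      qed simp
      then show "\<forall>\<^sub>F h in at 0. dist (q h x) d < e"
        unfolding eventually_at using \<delta>(1) \<open>0 < e\<close>
        by (intro exI[of _ \<delta>]) (force simp: dist_real_def)
    qed
    then show "f field_differentiable at x"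
      by (auto simp: field_differentiable_def DERIV_def q_def)
  qed
  \<comment> \<open>Off \<open>D\<close> no number satisfies the predicate that defines
    \<open>deriv\<close>, so its value is a fixed choice that does not depend on
    \<open>x\<close>.\<close>
  have "deriv f x = (if x \<in> D then lim (\<lambda>n. q (1 / real (Suc n)) x) else (SOME d. False))" for x
  proof (cases "x \<in> D")
    case True
    then have "DERIV f x :> deriv f x"
      by (simp add: D_iff DERIV_deriv_iff_field_differentiable)
    then have "((\<lambda>h. q h x) \<longlongrightarrow> deriv f x) (at 0)" by (simp add: DERIV_def q_def)
    moreover have "filterlim (\<lambda>n. 1 / real (Suc n)) (at 0) sequentially"
      using LIMSEQ_Suc[OF lim_1_over_n] by (auto simp: filterlim_at)
    ultimately have "(\<lambda>n. q (1 / real (Suc n)) x) \<longlonglongrightarrow> deriv f x"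
      by (rule filterlim_compose)
    then show ?thesis using True by (simp add: limI)
  next
    case False
    then have "\<not> DERIV f x :> d" for d
      using D_iff field_differentiable_def by blast
    then show ?thesis using False by (simp add: deriv_def)
  qed
  then have "deriv f = (\<lambda>x. if x \<in> D then lim (\<lambda>n. q (1 / real (Suc n)) x) else (SOME d. False))"
    by auto
  also have "\<dots> \<in> borel_measurable borel"
    unfolding q_def by measurable
  finally show ?thesis .
qed

text \<open>Convexity is used as the tangent inequality; adding it at \<open>x\<close> and at
  \<open>y\<close> gives monotonicity of the derivative, and differentiating
  \<open>\<rho> (- y) = \<rho> y\<close> makes it odd.\<close>

lemma contrast_function_facts:
  assumes "contrast_function g \<rho>"
  shows contrast_tangent: "\<rho> x + deriv \<rho> x * (y - x) \<le> \<rho> y"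
    and contrast_deriv_mono: "x \<le> y \<Longrightarrow> deriv \<rho> x \<le> deriv \<rho> y"
    and contrast_deriv_odd: "deriv \<rho> (- x) = - deriv \<rho> x"
    and contrast_deriv_lipschitz: "\<bar>deriv \<rho> x - deriv \<rho> y\<bar> \<le> \<bar>x - y\<bar>"
    and contrast_deriv_bounded: "\<exists>B>0. \<forall>x. \<bar>deriv \<rho> x\<bar> \<le> B"
    and contrast_deriv_continuous: "continuous_on UNIV (deriv \<rho>)"
proof -
  note c = assms[unfolded contrast_function_def]
  have D: "(\<rho> has_real_derivative deriv \<rho> x) (at x)" for x
    using c by (simp add: DERIV_deriv_iff_field_differentiable)
  show tangent: "\<rho> x + deriv \<rho> x * (y - x) \<le> \<rho> y" for x y
    using convex_on_imp_above_tangent[of UNIV \<rho> x y "deriv \<rho> x"] D c by auto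
  show "deriv \<rho> x \<le> deriv \<rho> y" if "x \<le> y" for x y
  proof -
    have "0 \<le> (deriv \<rho> y - deriv \<rho> x) * (y - x)"
      using tangent[of x y] tangent[of y x] by (simp add: algebra_simps)
    then show ?thesis using that by (cases "x = y") (auto simp: zero_le_mult_iff)
  qed
  show "deriv \<rho> (- x) = - deriv \<rho> x"
  proof -
    have "((\<lambda>y. \<rho> (- y)) has_real_derivative deriv \<rho> (- x) * - 1) (at x)"
      by (rule DERIV_chain'[where g = \<rho>, OF _ D]) (auto intro!: derivative_eq_intros)
    moreover have "(\<lambda>y. \<rho> (- y)) = \<rho>" using c by auto
    ultimately show ?thesis using DERIV_unique[OF D] by fastforce
  qed
  show "\<bar>deriv \<rho> x - deriv \<rho> y\<bar> \<le> \<bar>x - y\<bar>"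
    using lipschitz_onD[of 1 UNIV "deriv \<rho>" x y] c by (simp add: dist_real_def)
  show "\<exists>B>0. \<forall>x. \<bar>deriv \<rho> x\<bar> \<le> B"
    using c by (auto simp: bounded_pos)
  show "continuous_on UNIV (deriv \<rho>)"
    using c lipschitz_on_continuous_on by blast
qed

lemma prob_space_density_lborel:
  assumes "sym_monotone_density g"
  shows "prob_space (density lborel (\<lambda>z. ennreal (g z)))"
proof
  show "emeasure (density lborel (\<lambda>z. ennreal (g z))) (space (density lborel (\<lambda>z. ennreal (g z)))) = 1"
    using assms by (simp add: sym_monotone_density_def emeasure_density)
qed

lemma AE_lborel_translate:
  assumes "AE x in lborel. P x"
  shows "AE x in lborel. P (x + u :: real)"
proof -
  have "AE x in distr lborel borel ((+) u). P x"
    using assms by (subst lborel_distr_plus)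
  then have "AE x in lborel. P (u + x)" by (rule AE_distrD[rotated]) simp
  then show ?thesis by (simp add: add.commute)
qed

text \<open>The averaged score \<open>G i\<close> is odd and nondecreasing, and its slope is at
  least \<open>c / 2\<close> in a neighbourhood of 0 common to all \<open>i\<close>. Beyond it,
  monotonicity keeps \<open>G i\<close> above a positive constant, which dominates a small multiple
  of \<open>u\<close> up to \<open>A\<close>. The factor \<open>u\<close> in the conclusion treats
  both signs at once.\<close>

lemma noise_drift:
  assumes \<rho>: "contrast_function g \<rho>" and g: "g \<in> noise_class \<rho> c" and c: "0 < c" and A: "0 < A"
  obtains \<gamma> where "0 < \<gamma>"
    "\<And>i u. \<bar>u\<bar> \<le> A \<Longrightarrow> \<gamma> * u\<^sup>2 \<le> u * (LINT z|density lborel (\<lambda>z. ennreal (g i z)). deriv \<rho> (z + u))"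
proof -
  define \<mu> where "\<mu> i = density lborel (\<lambda>z. ennreal (g i z))" for i
  define \<psi> where "\<psi> = deriv \<rho>"
  define G where "G i u = (LINT z|\<mu> i. \<psi> (z + u))" for i u
  define G' where "G' i u = (LINT z|\<mu> i. deriv \<psi> (z + u))" for i u
  have sym: "sym_monotone_density (g i)" for i using g by (simp add: noise_class_def)
  then have [measurable]: "g i \<in> borel_measurable borel" and g0: "0 \<le> g i z" for i z
    by (auto simp: sym_monotone_density_def)
  have [measurable_cong]: "sets (\<mu> i) = sets borel" for i by (simp add: \<mu>_def)
  have cont: "continuous_on UNIV \<psi>" unfolding \<psi>_def by (rule contrast_deriv_continuous[OF \<rho>])
  then have [measurable]: "\<psi> \<in> borel_measurable borel" "deriv \<psi> \<in> borel_measurable borel"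
    by (auto intro: borel_measurable_continuous_onI borel_measurable_deriv)
  have prob: "prob_space (\<mu> i)" for i unfolding \<mu>_def by (rule prob_space_density_lborel[OF sym])
  obtain B where B: "0 < B" "\<And>x. \<bar>\<psi> x\<bar> \<le> B" unfolding \<psi>_def using contrast_deriv_bounded[OF \<rho>] by auto
  have lip: "\<bar>\<psi> x - \<psi> y\<bar> \<le> \<bar>x - y\<bar>" for x y unfolding \<psi>_def by (rule contrast_deriv_lipschitz[OF \<rho>])
  have int_\<psi>: "integrable (\<mu> i) (\<lambda>z. \<psi> (z + u))" for i u
  proof -
    interpret prob_space "\<mu> i" by (rule prob)
    show ?thesis by (rule integrable_const_bound[of _ B]) (auto simp: B)
  qed
  have diff: "AE z in \<mu> i. \<psi> field_differentiable at (z + u)" for i u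
  proof -
    have "AE z in lborel. \<psi> field_differentiable at (z + u)"
      using \<rho> unfolding \<psi>_def contrast_function_def by (intro AE_lborel_translate) auto
    then show ?thesis unfolding \<mu>_def by (subst AE_density) auto
  qed
  \<comment> \<open>Differentiation under the integral by dominated convergence: the quotients
    converge for almost every \<open>z\<close>, because the noise has a density, and are bounded by
    1, because \<open>\<psi>\<close> is 1-Lipschitz.\<close>
  have G_deriv: "(G i has_real_derivative G' i u) (at u)" for i u
    unfolding DERIV_def tendsto_at_iff_sequentially comp_def
  proof (intro allI impI)
    fix h :: "nat \<Rightarrow> real" assume h: "\<forall>n. h n \<in> UNIV - {0}" "h \<longlonglongrightarrow> 0"
    interpret prob_space "\<mu> i" by (rule prob)
    have "(\<lambda>n. LINT z|\<mu> i. (\<psi> (z + u + h n) - \<psi> (z + u)) / h n) \<longlonglongrightarrow> (LINT z|\<mu> i. deriv \<psi> (z + u))"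
    proof (rule integral_dominated_convergence[where w = "\<lambda>_. 1"])
      show "AE z in \<mu> i. (\<lambda>n. (\<psi> (z + u + h n) - \<psi> (z + u)) / h n) \<longlonglongrightarrow> deriv \<psi> (z + u)"
        using diff[of u]
      proof eventually_elim
        case (elim z)
        then have "((\<lambda>h. (\<psi> (z + u + h) - \<psi> (z + u)) / h) \<longlongrightarrow> deriv \<psi> (z + u)) (at 0)"
          by (simp add: DERIV_deriv_iff_field_differentiable[symmetric] DERIV_def)
        moreover have "filterlim h (at 0) sequentially"
          using h by (auto simp: filterlim_at)
        ultimately show ?case by (rule filterlim_compose)
      qed
      show "AE z in \<mu> i. norm ((\<psi> (z + u + h n) - \<psi> (z + u)) / h n) \<le> 1" for n
        using lip[of "z + u + h n" "z + u" for z] h(1) by (intro AE_I2) (auto simp: divide_le_eq)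
    qed (auto)
    also have "(\<lambda>n. LINT z|\<mu> i. (\<psi> (z + u + h n) - \<psi> (z + u)) / h n) = (\<lambda>n. (G i (u + h n) - G i u) / h n)"
      using int_\<psi>[of i] int_\<psi>[of i "u + h n" for n] unfolding G_def by (simp add: add.assoc[symmetric])
    finally show "(\<lambda>n. (G i (u + h n) - G i u) / h n) \<longlonglongrightarrow> G' i u" by (simp add: G'_def)
  qed
  have int_dens: "(LINT z|\<mu> i. F z) = (LINT z|lborel. F z * g i z)" if [measurable]: "F \<in> borel_measurable borel" for F i
    unfolding \<mu>_def by (subst integral_density) (auto simp: g0 mult.commute)
  have odd: "\<psi> (- x) = - \<psi> x" for x unfolding \<psi>_def by (rule contrast_deriv_odd[OF \<rho>])
  have G_odd: "G i (- u) = - G i u" for i u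
  proof -
    have "G i (- u) = (LINT z|lborel. \<psi> (z - u) * g i z)"
      by (simp add: G_def int_dens)
    also have "\<dots> = (LINT z|lborel. \<psi> (- z - u) * g i (- z))"
      using lborel_integral_real_affine[of "-1" "\<lambda>z. \<psi> (z - u) * g i z" 0] by simp
    also have "\<dots> = (LINT z|lborel. - (\<psi> (z + u) * g i z))"
      using sym odd[of "z + u" for z] by (intro Bochner_Integration.integral_cong) (auto simp: sym_monotone_density_def)
    finally show ?thesis by (simp add: G_def int_dens)
  qed
  then have G_0: "G i 0 = 0" for i using G_odd[of i 0] by simp
  have G_mono: "G i u \<le> G i v" if "u \<le> v" for i u v
    unfolding G_def using that contrast_deriv_mono[OF \<rho>]
    by (intro integral_mono int_\<psi>) (auto simp: \<psi>_def)
  obtain L\<^sub>\<rho> \<alpha> where L: "0 < L\<^sub>\<rho>" "0 < \<alpha>" "\<And>i u v.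
        (LINT z|lborel. \<bar>deriv \<psi> (z + u) - deriv \<psi> (z + v)\<bar> * g i z) \<le> L\<^sub>\<rho> * \<bar>u - v\<bar> powr \<alpha>"
    using \<rho> unfolding contrast_function_def \<psi>_def by blast
  \<comment> \<open>Integrability of \<open>deriv \<psi>\<close> rests on this bound; at the
    exceptional points its value is not controlled.\<close>
  have deriv_le: "AE z in \<mu> i. \<bar>deriv \<psi> (z + u)\<bar> \<le> 1" for i u
    using diff[of u i]
  proof eventually_elim
    case (elim z)
    then have "((\<lambda>h. (\<psi> (z + u + h) - \<psi> (z + u)) / h) \<longlongrightarrow> deriv \<psi> (z + u)) (at 0)"
      by (simp add: DERIV_deriv_iff_field_differentiable[symmetric] DERIV_def)
    then have "((\<lambda>h. \<bar>(\<psi> (z + u + h) - \<psi> (z + u)) / h\<bar>) \<longlongrightarrow> \<bar>deriv \<psi> (z + u)\<bar>) (at 0)"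
      by (intro tendsto_intros)
    moreover have "\<forall>\<^sub>F h in at 0. \<bar>(\<psi> (z + u + h) - \<psi> (z + u)) / h\<bar> \<le> 1"
      using lip[of "z + u + h" "z + u" for h] by (auto simp: eventually_at_filter divide_le_eq)
    ultimately show ?case by (intro tendsto_upperbound[where F = "at (0::real)"]) auto
  qed
  have int_d: "integrable (\<mu> i) (\<lambda>z. deriv \<psi> (z + u))" for i u
  proof -
    interpret prob_space "\<mu> i" by (rule prob)
    show ?thesis by (rule integrable_const_bound[of _ 1]) (use deriv_le in auto)
  qed
  have G'_lower: "c - L\<^sub>\<rho> * \<bar>u\<bar> powr \<alpha> \<le> G' i u" for i u
  proof -
    have "G' i 0 - G' i u = (LINT z|\<mu> i. deriv \<psi> (z + 0) - deriv \<psi> (z + u))"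
      unfolding G'_def by (rule Bochner_Integration.integral_diff[symmetric]) (rule int_d)+
    also have "\<dots> \<le> (LINT z|\<mu> i. \<bar>deriv \<psi> (z + u) - deriv \<psi> (z + 0)\<bar>)"
      by (intro integral_mono integrable_abs Bochner_Integration.integrable_diff int_d) auto
    also have "\<dots> \<le> L\<^sub>\<rho> * \<bar>u\<bar> powr \<alpha>"
      using L(3)[of u 0 i] by (subst int_dens) auto
    finally have "G' i 0 - G' i u \<le> L\<^sub>\<rho> * \<bar>u\<bar> powr \<alpha>" .
    moreover have "c \<le> G' i 0"
      using g unfolding G'_def by (subst int_dens) (auto simp: noise_class_def simp flip: \<psi>_def)
    ultimately show ?thesis by linarith
  qed
  \<comment> \<open>Solution of \<open>L\<^sub>\<rho> * \<delta> powr \<alpha> = c / 2\<close>: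
    within this distance of 0 the slope loses at most half of its lower bound \<open>c\<close>. It
    does not depend on \<open>i\<close>.\<close>
  define \<delta> where "\<delta> = (c / (2 * L\<^sub>\<rho>)) powr (1 / \<alpha>)"
  have \<delta>0: "0 < \<delta>" using c L by (simp add: \<delta>_def)
  have G'_c: "c / 2 \<le> G' i u" if "\<bar>u\<bar> \<le> \<delta>" for i u
  proof -
    have "\<bar>u\<bar> powr \<alpha> \<le> \<delta> powr \<alpha>" using that L by (intro powr_mono2) auto
    also have "\<delta> powr \<alpha> = c / (2 * L\<^sub>\<rho>)" using c L by (simp add: \<delta>_def powr_powr)
    finally have "L\<^sub>\<rho> * \<bar>u\<bar> powr \<alpha> \<le> L\<^sub>\<rho> * (c / (2 * L\<^sub>\<rho>))" using L by (intro mult_left_mono) auto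
    also have "\<dots> = c / 2" using L by simp
    finally show ?thesis using G'_lower[of u i] by linarith
  qed
  have near: "c / 2 * u \<le> G i u" if u: "0 \<le> u" "u \<le> \<delta>" for i u
  proof -
    have "G i 0 - c / 2 * 0 \<le> G i u - c / 2 * u"
    proof (rule DERIV_nonneg_imp_nondecreasing[OF u(1)])
      fix x assume "0 \<le> x" "x \<le> u"
      then show "\<exists>y. ((\<lambda>u. G i u - c / 2 * u) has_real_derivative y) (at x) \<and> 0 \<le> y"
        using G'_c[of x i] u by (intro exI[of _ "G' i x - c / 2"]) (auto intro!: derivative_eq_intros G_deriv)
    qed
    then show ?thesis by (simp add: G_0)
  qed
  \<comment> \<open>The smaller of two slopes: \<open>c / 2\<close> near 0, and that of the chord
    from the origin to height \<open>c / 2 * \<delta>\<close> at abscissa \<open>A\<close>.\<close>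
  define \<gamma> where "\<gamma> = c / 2 * min 1 (\<delta> / A)"
  have \<gamma>0: "0 < \<gamma>" using c \<delta>0 A by (simp add: \<gamma>_def)
  have pos: "\<gamma> * u \<le> G i u" if u: "0 \<le> u" "u \<le> A" for i u
  proof (cases "u \<le> \<delta>")
    case True
    have "\<gamma> * u \<le> c / 2 * u" unfolding \<gamma>_def using c u by (intro mult_right_mono) auto
    then show ?thesis using near[OF u(1) True, of i] by linarith
  next
    case False
    have "\<gamma> * u \<le> (c / 2 * (\<delta> / A)) * A" unfolding \<gamma>_def using c u A \<delta>0 by (intro mult_mono) auto
    also have "\<dots> = c / 2 * \<delta>" using A by simp
    also have "\<dots> \<le> G i \<delta>" using near[of \<delta> i] \<delta>0 by simp
    also have "\<dots> \<le> G i u" using False by (intro G_mono) auto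
    finally show ?thesis .
  qed
  show ?thesis
  proof (rule that[OF \<gamma>0])
    fix i u assume u: "\<bar>u\<bar> \<le> A"
    have "\<gamma> * u\<^sup>2 \<le> u * G i u"
    proof (cases "0 \<le> u")
      case True
      then show ?thesis using mult_left_mono[OF pos[of u i] True] u by (simp add: power2_eq_square algebra_simps)
    next
      case False
      then have "(- u) * (\<gamma> * (- u)) \<le> (- u) * G i (- u)" using u by (intro mult_left_mono pos) auto
      then show ?thesis by (simp add: G_odd power2_eq_square algebra_simps)
    qed
    then show "\<gamma> * u\<^sup>2 \<le> u * (LINT z|density lborel (\<lambda>z. ennreal (g i z)). deriv \<rho> (z + u))"
      by (simp add: G_def \<mu>_def \<psi>_def)
  qed
qed

section \<open>Exponential deviations and moments\<close>

lemma exp_le_quadratic: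
  fixes x :: real
  assumes "\<bar>x\<bar> \<le> 1"
  shows "exp x \<le> 1 + x + x\<^sup>2"
proof (cases "0 \<le> x")
  case True
  then show ?thesis using assms exp_bound[of x] by simp
next
  case False
  define y where "y = - x"
  have y: "0 < y" using False by (simp add: y_def)
  \<comment> \<open>The product equals \<open>1 + y^3\<close>.\<close>
  have "1 \<le> (1 - y + y\<^sup>2) * (1 + y)"
    using y by (simp add: algebra_simps power2_eq_square)
  also have "\<dots> \<le> (1 - y + y\<^sup>2) * exp y"
  proof (rule mult_left_mono)
    have "0 \<le> (1 - y)\<^sup>2 + y" using y by (intro add_nonneg_nonneg) auto
    then show "0 \<le> 1 - y + y\<^sup>2" by (simp add: power2_eq_square algebra_simps)
  qed (rule exp_ge_add_one_self)
  finally have "exp (- y) \<le> 1 - y + y\<^sup>2" by (simp add: exp_minus field_simps)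
  then show ?thesis by (simp add: y_def)
qed

text \<open>Bernstein's argument: Markov's inequality for the exponential moment, with
  \<open>exp x \<le> 1 + x + x\<^sup>2\<close> for \<open>\<bar>x\<bar> \<le> 1\<close>. Writing the
  threshold as \<open>\<tau>\<close> times the variance bound makes the exponent quadratic in
  \<open>\<tau>\<close>; the condition \<open>\<tau> * a \<le> 2\<close> keeps the argument of the
  exponential in this range.\<close>

lemma chernoff_PiM:
  fixes M :: "nat \<Rightarrow> 'a measure" and f :: "nat \<Rightarrow> 'a \<Rightarrow> real"
  assumes prob: "\<And>i. prob_space (M i)" and meas: "\<And>i. f i \<in> borel_measurable (M i)"
    and bd: "\<And>i x. x \<in> space (M i) \<Longrightarrow> \<bar>f i x\<bar> \<le> a"
    and var: "\<And>i. (LINT x|M i. (f i x)\<^sup>2) \<le> v"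
    and \<tau>: "0 \<le> \<tau>" "\<tau> * a \<le> 2"
  shows "emeasure (Pi\<^sub>M {..<n} M) {\<omega> \<in> space (Pi\<^sub>M {..<n} M).
      \<tau> * (real n * v) < (\<Sum>i<n. f i (\<omega> i)) - (\<Sum>i<n. LINT x|M i. f i x)}
    \<le> ennreal (exp (- (\<tau>\<^sup>2 * (real n * v) / 4)))" (is "emeasure ?P ?A \<le> _")
proof -
  note [measurable] = meas
  \<comment> \<open>This value minimizes the exponent \<open>- l * \<tau> + l\<^sup>2\<close>, whose
    minimum is \<open>- \<tau>\<^sup>2 / 4\<close>.\<close>
  define l where "l = \<tau> / 2"
  define m where "m i = (LINT x|M i. f i x)" for i
  have int: "integrable (M i) (f i)" "integrable (M i) (\<lambda>x. (f i x)\<^sup>2)" for i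
  proof -
    interpret p: prob_space "M i" by (rule prob)
    show "integrable (M i) (f i)" by (rule p.integrable_const_bound[of _ a]) (auto simp: bd)
    show "integrable (M i) (\<lambda>x. (f i x)\<^sup>2)"
      by (rule p.integrable_const_bound[of _ "a\<^sup>2"])
        (use bd in \<open>auto intro!: AE_I2 simp: abs_le_square_iff[symmetric] order_trans[OF _ abs_ge_self]\<close>)
  qed
  have factor: "(\<integral>\<^sup>+x. ennreal (exp (l * (f i x - m i))) \<partial>M i) \<le> ennreal (exp (l\<^sup>2 * v))" for i
  proof -
    interpret p: prob_space "M i" by (rule prob)
    have int': "integrable (M i) (\<lambda>x. 1 + l * f i x + l\<^sup>2 * (f i x)\<^sup>2)"
      using int[of i] by simp
    have "(\<integral>\<^sup>+x. ennreal (exp (l * (f i x - m i))) \<partial>M i)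
        \<le> (\<integral>\<^sup>+x. ennreal (exp (- (l * m i)) * (1 + l * f i x + l\<^sup>2 * (f i x)\<^sup>2)) \<partial>M i)"
    proof (intro nn_integral_mono ennreal_leI)
      fix x assume x: "x \<in> space (M i)"
      have "\<bar>l * f i x\<bar> \<le> l * a" using bd[OF x] \<tau> by (simp add: abs_mult l_def mult_left_mono)
      also have "\<dots> \<le> 1" using \<tau> by (simp add: l_def)
      finally have "exp (l * f i x) \<le> 1 + l * f i x + (l * f i x)\<^sup>2" by (rule exp_le_quadratic)
      moreover have "exp (l * (f i x - m i)) = exp (- (l * m i)) * exp (l * f i x)"
        by (simp add: exp_add[symmetric] algebra_simps)
      ultimately show "exp (l * (f i x - m i)) \<le> exp (- (l * m i)) * (1 + l * f i x + l\<^sup>2 * (f i x)\<^sup>2)"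
        by (simp add: power_mult_distrib)
    qed
    also have "\<dots> = ennreal (LINT x|M i. exp (- (l * m i)) * (1 + l * f i x + l\<^sup>2 * (f i x)\<^sup>2))"
    proof (rule nn_integral_eq_integral)
      show "AE x in M i. 0 \<le> exp (- (l * m i)) * (1 + l * f i x + l\<^sup>2 * (f i x)\<^sup>2)"
      proof (rule AE_I2)
        fix x
        have "0 \<le> (1 + l * f i x / 2)\<^sup>2 + 3/4 * (l * f i x)\<^sup>2" by simp
        then have "0 \<le> 1 + l * f i x + l\<^sup>2 * (f i x)\<^sup>2"
          by (simp add: power2_eq_square algebra_simps)
        then show "0 \<le> exp (- (l * m i)) * (1 + l * f i x + l\<^sup>2 * (f i x)\<^sup>2)"
          by simp
      qed
    qed (use int' in simp)
    also have "(LINT x|M i. exp (- (l * m i)) * (1 + l * f i x + l\<^sup>2 * (f i x)\<^sup>2))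
        = exp (- (l * m i)) * (1 + l * m i + l\<^sup>2 * (LINT x|M i. (f i x)\<^sup>2))"
      using int[of i] by (simp add: m_def p.prob_space)
    also have "\<dots> \<le> exp (- (l * m i)) * exp (l * m i + l\<^sup>2 * v)"
    proof (rule mult_left_mono)
      have "1 + l * m i + l\<^sup>2 * (LINT x|M i. (f i x)\<^sup>2) \<le> 1 + (l * m i + l\<^sup>2 * v)"
        using mult_left_mono[OF var[of i], of "l\<^sup>2"] by simp
      also have "\<dots> \<le> exp (l * m i + l\<^sup>2 * v)" by (rule exp_ge_add_one_self)
      finally show "1 + l * m i + l\<^sup>2 * (LINT x|M i. (f i x)\<^sup>2) \<le> exp (l * m i + l\<^sup>2 * v)" .
    qed simp
    also have "\<dots> = exp (l\<^sup>2 * v)" by (simp add: exp_add[symmetric])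
    finally show ?thesis by (simp add: ennreal_leI)
  qed
  interpret product_prob_space M by (rule product_prob_spaceI) (rule prob)
  have "emeasure ?P ?A = (\<integral>\<^sup>+\<omega>. indicator ?A \<omega> \<partial>?P)"
    by (subst nn_integral_indicator) measurable
  also have "\<dots> \<le> (\<integral>\<^sup>+\<omega>. ennreal (exp (- (l * (\<tau> * (real n * v))))) * (\<Prod>i\<in>{..<n}. ennreal (exp (l * (f i (\<omega> i) - m i)))) \<partial>?P)"
  proof (rule nn_integral_mono)
    fix \<omega>
    show "indicator ?A \<omega> \<le> ennreal (exp (- (l * (\<tau> * (real n * v))))) * (\<Prod>i\<in>{..<n}. ennreal (exp (l * (f i (\<omega> i) - m i))))"
    proof (cases "\<omega> \<in> ?A")
      case True
      then have "l * (\<tau> * (real n * v)) \<le> l * ((\<Sum>i<n. f i (\<omega> i)) - (\<Sum>i<n. m i))"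
        using \<tau> by (intro mult_left_mono) (auto simp: l_def m_def)
      then have "1 \<le> exp (- (l * (\<tau> * (real n * v))) + (\<Sum>i<n. l * (f i (\<omega> i) - m i)))"
        by (simp add: sum_distrib_left[symmetric] sum_subtractf)
      also have "\<dots> = exp (- (l * (\<tau> * (real n * v)))) * (\<Prod>i\<in>{..<n}. exp (l * (f i (\<omega> i) - m i)))"
        by (simp only: exp_add exp_sum finite_lessThan)
      finally show ?thesis using True
        by (simp add: prod_ennreal ennreal_mult[symmetric] prod_nonneg)
    qed simp
  qed
  also have "\<dots> = ennreal (exp (- (l * (\<tau> * (real n * v))))) * (\<Prod>i\<in>{..<n}. \<integral>\<^sup>+x. ennreal (exp (l * (f i x - m i))) \<partial>M i)"
    by (subst nn_integral_cmult, measurable, subst product_nn_integral_prod) auto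
  also have "\<dots> \<le> ennreal (exp (- (l * (\<tau> * (real n * v))))) * (\<Prod>i\<in>{..<n}. ennreal (exp (l\<^sup>2 * v)))"
  proof (rule mult_left_mono)
    show "(\<Prod>i\<in>{..<n}. \<integral>\<^sup>+x. ennreal (exp (l * (f i x - m i))) \<partial>M i) \<le> (\<Prod>i\<in>{..<n}. ennreal (exp (l\<^sup>2 * v)))"
      by (intro prod_mono_ennreal factor)
  qed simp
  also have "\<dots> = ennreal (exp (- (l * (\<tau> * (real n * v)))) * exp (l\<^sup>2 * v) ^ n)"
    by (simp add: ennreal_power ennreal_mult[symmetric])
  also have "exp (- (l * (\<tau> * (real n * v)))) * exp (l\<^sup>2 * v) ^ n = exp (- (\<tau>\<^sup>2 * (real n * v) / 4))"
    by (simp add: exp_of_nat_mult[symmetric] exp_add[symmetric] l_def power2_eq_square field_simps)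
  finally show ?thesis .
qed

text \<open>Union bound over \<open>F\<close> and over both signs of the deviation, whence the
  factor \<open>2 * card F\<close>.\<close>

lemma chernoff_PiM_family:
  fixes M :: "nat \<Rightarrow> 'a measure" and F :: "('a \<Rightarrow> real) set"
  assumes prob: "\<And>i. prob_space (M i)" and fin: "finite F"
    and meas: "\<And>f i. f \<in> F \<Longrightarrow> f \<in> borel_measurable (M i)"
    and bd: "\<And>f i x. f \<in> F \<Longrightarrow> x \<in> space (M i) \<Longrightarrow> \<bar>f x\<bar> \<le> a"
    and var: "\<And>f i. f \<in> F \<Longrightarrow> (LINT x|M i. (f x)\<^sup>2) \<le> v"
    and \<tau>: "0 \<le> \<tau>" "\<tau> * a \<le> 2"
  shows "{\<omega> \<in> space (Pi\<^sub>M {..<n} M). \<exists>f\<in>F. \<tau> * (real n * v) < \<bar>(\<Sum>i<n. f (\<omega> i)) - (\<Sum>i<n. LINT x|M i. f x)\<bar>}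
      \<in> sets (Pi\<^sub>M {..<n} M)" (is "?A \<in> _")
    and "emeasure (Pi\<^sub>M {..<n} M) {\<omega> \<in> space (Pi\<^sub>M {..<n} M).
      \<exists>f\<in>F. \<tau> * (real n * v) < \<bar>(\<Sum>i<n. f (\<omega> i)) - (\<Sum>i<n. LINT x|M i. f x)\<bar>}
    \<le> ennreal (2 * real (card F) * exp (- (\<tau>\<^sup>2 * (real n * v) / 4)))"
proof -
  let ?P = "Pi\<^sub>M {..<n} M"
  let ?D = "\<lambda>s f \<omega>. (\<Sum>i<n. s * f (\<omega> i)) - (\<Sum>i<n. LINT x|M i. s * f x)"
  define B where "B s f = {\<omega> \<in> space ?P. \<tau> * (real n * v) < ?D s f \<omega>}" for s :: real and f
  have B_sets: "B s f \<in> sets ?P" if "f \<in> F" for s f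
  proof -
    note [measurable] = meas[OF that]
    show ?thesis unfolding B_def by measurable
  qed
  have sub: "\<bar>(\<Sum>i<n. f (\<omega> i)) - (\<Sum>i<n. LINT x|M i. f x)\<bar> = max (?D 1 f \<omega>) (?D (- 1) f \<omega>)" for f :: "'a \<Rightarrow> real" and \<omega>
  proof -
    have "?D 1 f \<omega> = (\<Sum>i<n. f (\<omega> i)) - (\<Sum>i<n. LINT x|M i. f x)"
      "?D (- 1) f \<omega> = - ((\<Sum>i<n. f (\<omega> i)) - (\<Sum>i<n. LINT x|M i. f x))"
      by (simp_all add: sum_negf)
    then show ?thesis by (simp only: max_def abs_if) simp
  qed
  have A: "?A = (\<Union>f\<in>F. B 1 f \<union> B (- 1) f)"
    unfolding B_def sub less_max_iff_disj by blast
  show "?A \<in> sets ?P"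
    unfolding A using fin B_sets by (intro sets.finite_UN) auto
  have B_le: "emeasure ?P (B s f) \<le> ennreal (exp (- (\<tau>\<^sup>2 * (real n * v) / 4)))"
    if "f \<in> F" "s = 1 \<or> s = - 1" for s f
    unfolding B_def
  proof (rule chernoff_PiM[where f = "\<lambda>_ x. s * f x" and a = a])
    fix i
    note [measurable] = meas[OF that(1)]
    show "(\<lambda>x. s * f x) \<in> borel_measurable (M i)" by measurable
    show "(LINT x|M i. (s * f x)\<^sup>2) \<le> v"
      using var[OF that(1), of i] that(2) by auto
    show "\<bar>s * f x\<bar> \<le> a" if "x \<in> space (M i)" for x
      using bd[OF \<open>f \<in> F\<close> that] \<open>s = 1 \<or> s = - 1\<close> by auto
  qed (use prob \<tau> in auto)
  have "emeasure ?P ?A \<le> (\<Sum>f\<in>F. emeasure ?P (B 1 f \<union> B (- 1) f))"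
    unfolding A using fin B_sets by (intro emeasure_subadditive_finite) auto
  also have "\<dots> \<le> (\<Sum>f\<in>F. ennreal (2 * exp (- (\<tau>\<^sup>2 * (real n * v) / 4))))"
  proof (rule sum_mono)
    fix f assume f: "f \<in> F"
    have "emeasure ?P (B 1 f \<union> B (- 1) f) \<le> emeasure ?P (B 1 f) + emeasure ?P (B (- 1) f)"
      using B_sets f by (intro emeasure_subadditive) auto
    also have "\<dots> \<le> ennreal (exp (- (\<tau>\<^sup>2 * (real n * v) / 4))) + ennreal (exp (- (\<tau>\<^sup>2 * (real n * v) / 4)))"
      by (intro add_mono B_le f) auto
    also have "\<dots> = ennreal (2 * exp (- (\<tau>\<^sup>2 * (real n * v) / 4)))"
      by (simp flip: ennreal_plus)
    finally show "emeasure ?P (B 1 f \<union> B (- 1) f) \<le> ennreal (2 * exp (- (\<tau>\<^sup>2 * (real n * v) / 4)))" .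
  qed
  also have "\<dots> = ennreal (2 * real (card F) * exp (- (\<tau>\<^sup>2 * (real n * v) / 4)))"
    by (simp add: ennreal_of_nat_eq_real_of_nat ennreal_mult[symmetric] mult_ac)
  finally show "emeasure ?P ?A \<le> ennreal (2 * real (card F) * exp (- (\<tau>\<^sup>2 * (real n * v) / 4)))" .
qed

lemma summable_powr_gaussian:
  assumes "0 < (c::real)"
  shows "summable (\<lambda>k::nat. (real k + 1) powr r * exp (- (c * (real k)\<^sup>2)))"
proof (rule summable_comparison_test_bigo)
  show "summable (\<lambda>k::nat. norm (1 / real k ^ 2))"
    using inverse_power_summable[of 2, where 'a = real] by (simp add: inverse_eq_divide)
  show "(\<lambda>k::nat. (real k + 1) powr r * exp (- (c * (real k)\<^sup>2))) \<in> O(\<lambda>k. 1 / real k ^ 2)"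
    using assms by real_asymp
qed

text \<open>Summation over integer levels. What matters is the order of quantifiers:
  \<open>R\<close> is fixed before the probability space and the variable, which makes the risk
  bound uniform in the sample size and in the regression function.\<close>

lemma moment_bound_from_gaussian_tail:
  fixes a C c r :: real
  assumes "0 < c" "0 \<le> C" "0 \<le> r"
  obtains R :: real where "0 \<le> R"
    "\<And>(\<Omega> :: 'a measure) T. prob_space \<Omega> \<Longrightarrow> T \<in> borel_measurable \<Omega> \<Longrightarrow> \<forall>x. 0 \<le> T x \<Longrightarrow>
      \<forall>k::nat. a \<le> real k \<longrightarrow> emeasure \<Omega> {x \<in> space \<Omega>. real k < T x} \<le> ennreal (C * exp (- (c * (real k)\<^sup>2))) \<Longrightarrow>
      (\<integral>\<^sup>+x. ennreal (T x powr r) \<partial>\<Omega>) \<le> ennreal R"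
proof -
  \<comment> \<open>Below the level \<open>a\<close> no tail estimate is available and the
    probability is bounded by 1; this affects finitely many terms.\<close>
  define w where "w k = (real k + 1) powr r * (if real k < a then 1 else C * exp (- (c * (real k)\<^sup>2)))" for k :: nat
  have w0: "0 \<le> w k" for k using assms by (simp add: w_def)
  have w: "summable w"
  proof (subst summable_cong)
    show "\<forall>\<^sub>F k in sequentially. w k = C * ((real k + 1) powr r * exp (- (c * (real k)\<^sup>2)))"
    proof -
      have "\<forall>\<^sub>F k in sequentially. a \<le> real k" by real_asymp
      then show ?thesis by eventually_elim (simp add: w_def)
    qed
    show "summable (\<lambda>k. C * ((real k + 1) powr r * exp (- (c * (real k)\<^sup>2))))"
      by (intro summable_mult summable_powr_gaussian assms)
  qed
  show ?thesis
  proof (rule that[of "suminf w"])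
    show "0 \<le> suminf w" using w w0 by (intro suminf_nonneg) auto
    fix \<Omega> :: "'a measure" and T :: "'a \<Rightarrow> real"
    assume \<Omega>: "prob_space \<Omega>" and [measurable]: "T \<in> borel_measurable \<Omega>" and "\<forall>x. 0 \<le> T x"
      and "\<forall>k::nat. a \<le> real k \<longrightarrow> emeasure \<Omega> {x \<in> space \<Omega>. real k < T x} \<le> ennreal (C * exp (- (c * (real k)\<^sup>2)))"
    then have T: "\<And>x. 0 \<le> T x"
      and tail: "\<And>k::nat. a \<le> real k \<Longrightarrow> emeasure \<Omega> {x \<in> space \<Omega>. real k < T x} \<le> ennreal (C * exp (- (c * (real k)\<^sup>2)))"
      by auto
    interpret prob_space \<Omega> by (rule \<Omega>)
    let ?A = "\<lambda>k::nat. {x \<in> space \<Omega>. real k < T x}"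
    have "(\<integral>\<^sup>+x. ennreal (T x powr r) \<partial>\<Omega>) \<le> (\<integral>\<^sup>+x. (\<Sum>k. ennreal ((real k + 1) powr r) * indicator (?A k) x) \<partial>\<Omega>)"
    proof (rule nn_integral_mono)
      fix x assume x: "x \<in> space \<Omega>"
      show "ennreal (T x powr r) \<le> (\<Sum>k. ennreal ((real k + 1) powr r) * indicator (?A k) x)"
      proof (cases "T x = 0")
        case True then show ?thesis by simp
      next
        case False
        \<comment> \<open>The level with \<open>k < T x \<le> k + 1\<close>; its single term already
          dominates the power of \<open>T x\<close>. The value 0 exceeds no level and is treated
          apart.\<close>
        define k where "k = nat (\<lceil>T x\<rceil> - 1)"
        have "0 < T x" using T[of x] False by simp
        then have k: "real k < T x" "T x \<le> real k + 1" unfolding k_def by linarith+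
        define q where "q j = ennreal ((real j + 1) powr r) * indicator (?A j) x" for j
        have "ennreal (T x powr r) \<le> q k"
          unfolding q_def using k x T[of x] assms by (auto intro!: ennreal_leI powr_mono2)
        also have "q k \<le> suminf q"
          using sum_le_suminf[of q "{k}"] by (simp add: summableI)
        finally show ?thesis by (simp add: q_def[abs_def])
      qed
    qed
    also have "\<dots> = (\<Sum>k. ennreal ((real k + 1) powr r) * emeasure \<Omega> (?A k))"
      by (subst nn_integral_suminf) (auto simp: nn_integral_cmult_indicator)
    also have "\<dots> \<le> (\<Sum>k. ennreal (w k))"
    proof (rule suminf_le)
      fix k
      have "emeasure \<Omega> (?A k) \<le> ennreal (if real k < a then 1 else C * exp (- (c * (real k)\<^sup>2)))"
        using tail[of k] emeasure_le_1[of "?A k"] by auto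
      then have "ennreal ((real k + 1) powr r) * emeasure \<Omega> (?A k) \<le> ennreal ((real k + 1) powr r) * ennreal (if real k < a then 1 else C * exp (- (c * (real k)\<^sup>2)))"
        by (rule mult_left_mono) simp
      also have "\<dots> = ennreal (w k)" using assms by (simp add: w_def ennreal_mult)
      finally show "ennreal ((real k + 1) powr r) * emeasure \<Omega> (?A k) \<le> ennreal (w k)" .
    qed (auto intro: summableI)
    also have "\<dots> = ennreal (suminf w)" using w w0 by (rule suminf_ennreal2[rotated])
    finally show "(\<integral>\<^sup>+x. ennreal (T x powr r) \<partial>\<Omega>) \<le> ennreal (suminf w)" .
  qed
qed

section \<open>The score at the minimizer\<close>

lemma smoothing_kernel_supp:
  assumes "smoothing_kernel K" "K z \<noteq> 0"
  shows "\<bar>z $ j\<bar> \<le> 1 / 2"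
proof -
  have "z \<in> closure {z. K z \<noteq> 0}" using assms(2) by (intro subsetD[OF closure_subset]) simp
  then have "z \<in> cbox (vec (- 1 / 2)) (vec (1 / 2))"
    using assms(1) by (auto simp: smoothing_kernel_def)
  then have "vec (- 1 / 2) $ j \<le> z $ j" "z $ j \<le> vec (1 / 2) $ j" by (auto simp: mem_box_cart)
  then show ?thesis by (simp add: abs_le_iff)
qed

lemma smoothing_kernel_bound:
  assumes "smoothing_kernel K"
  obtains k where "0 < k" "\<And>z. K z \<le> k"
proof -
  have "bounded (range K)" using assms by (simp add: smoothing_kernel_def)
  then obtain k where k: "0 < k" "\<forall>y\<in>range K. norm y \<le> k" unfolding bounded_pos by blast
  have "K z \<le> k" for z using bspec[OF k(2), of "K z"] by simp
  then show ?thesis using that[of k] k(1) by blast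
qed

lemma rho_criterion_eq:
  assumes K: "smoothing_kernel K" and h: "0 < h" and z: "\<And>i. i < n \<Longrightarrow> fst (z i) \<in> unit_cube"
  shows "rho_criterion \<rho> K b x0 h n z t = 1 / (real n * h ^ CARD('d)) *
     (\<Sum>i<n. \<rho> (snd (z i) - poly_sum b t ((fst (z i) - x0 :: real ^ 'd::finite) /\<^sub>R h)) * K ((fst (z i) - x0) /\<^sub>R h))"
  unfolding rho_criterion_def
proof (intro arg_cong[of _ _ "(*) _"] sum.cong refl)
  fix i assume i: "i \<in> {..<n}"
  let ?u = "(fst (z i) - x0) /\<^sub>R h"
  show "\<rho> (snd (z i) - local_poly b x0 h t (fst (z i))) * K ?u = \<rho> (snd (z i) - poly_sum b t ?u) * K ?u"
  proof (cases "K ?u = 0")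
    case False
    have "x0 $ j - h / 2 \<le> fst (z i) $ j \<and> fst (z i) $ j \<le> x0 $ j + h / 2" for j
    proof -
      have "\<bar>(fst (z i) $ j - x0 $ j) / h\<bar> \<le> 1 / 2"
        using smoothing_kernel_supp[OF K False, of j] by (simp only: vector_scaleR_component vector_minus_component real_scaleR_def divide_inverse_commute)
      then have "\<bar>fst (z i) $ j - x0 $ j\<bar> \<le> h / 2"
        using h by (simp add: abs_divide divide_le_eq)
      then show ?thesis by (intro conjI; argo)
    qed
    then have "fst (z i) \<in> local_window x0 h" using z i by (simp add: local_window_def)
    then show ?thesis by (simp add: local_poly_def poly_sum_def)
  qed simp
qed

text \<open>The gradient inequality at a point strictly between \<open>t'\<close> and the minimizer \<open>t\<close> replaces the first
  order condition, so that the score may be tested at any prescribed distance from \<open>t'\<close>.\<close>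

lemma minimizer_score_nonneg:
  fixes x0 :: "real ^ 'd::finite"
  assumes \<rho>: "contrast_function g \<rho>" and K: "smoothing_kernel K" and h: "0 < h" and n: "1 \<le> n"
    and min: "is_arg_min (rho_criterion \<rho> K b x0 h n z) (\<lambda>t. t \<in> param_set b M) t"
    and t': "t' \<in> param_set b M" and z: "\<And>i. i < n \<Longrightarrow> fst (z i) \<in> unit_cube"
    and \<tau>: "0 \<le> \<tau>" "\<tau> < 1"
  defines "\<delta> \<equiv> \<lambda>p. \<tau> * (t p - t' p)" and "u \<equiv> \<lambda>i. (fst (z i) - x0) /\<^sub>R h"
  shows "0 \<le> (\<Sum>i<n. deriv \<rho> (snd (z i) - poly_sum b t' (u i) - poly_sum b \<delta> (u i)) * poly_sum b \<delta> (u i) * K (u i))"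
proof -
  let ?P = "multi_indices b :: ('d \<Rightarrow> nat) set"
  \<comment> \<open>The point \<open>(1 - \<tau>) t' + \<tau> t\<close>, which is in the parameter
    set by convexity of the l1 ball. The restriction is needed because parameters are extensional
    functions.\<close>
  define s where "s = restrict (\<lambda>p. t' p + \<delta> p) ?P"
  have t: "t \<in> param_set b M" using min by (simp add: is_arg_min_def)
  have s: "s \<in> param_set b M"
  proof -
    have "(\<Sum>p\<in>?P. \<bar>s p\<bar>) = (\<Sum>p\<in>?P. \<bar>(1 - \<tau>) * t' p + \<tau> * t p\<bar>)"
      by (intro sum.cong) (auto simp: s_def \<delta>_def algebra_simps)
    also have "\<dots> \<le> (\<Sum>p\<in>?P. (1 - \<tau>) * \<bar>t' p\<bar> + \<tau> * \<bar>t p\<bar>)"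
      using \<tau> by (intro sum_mono order_trans[OF abs_triangle_ineq]) (auto simp: abs_mult)
    also have "\<dots> = (1 - \<tau>) * (\<Sum>p\<in>?P. \<bar>t' p\<bar>) + \<tau> * (\<Sum>p\<in>?P. \<bar>t p\<bar>)"
      by (simp add: sum.distrib sum_distrib_left)
    also have "\<dots> \<le> (1 - \<tau>) * M + \<tau> * M"
      using t t' \<tau> by (intro add_mono mult_left_mono) (auto simp: param_set_def)
    finally show ?thesis by (simp add: param_set_def s_def algebra_simps)
  qed
  have poly_s: "poly_sum b s x = poly_sum b t' x + poly_sum b \<delta> x" for x
    unfolding poly_sum_add[symmetric] by (simp add: poly_sum_def s_def)
  have poly_t: "poly_sum b t x - poly_sum b s x = (1 - \<tau>) * poly_sum b (\<lambda>p. t p - t' p) x" for x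
    unfolding poly_s \<delta>_def poly_sum_scale poly_sum_diff by (simp add: algebra_simps)
  have crit: "rho_criterion \<rho> K b x0 h n z r = 1 / (real n * h ^ CARD('d)) *
     (\<Sum>i<n. \<rho> (snd (z i) - poly_sum b r ((fst (z i) - x0) /\<^sub>R h)) * K ((fst (z i) - x0) /\<^sub>R h))" for r
    by (rule rho_criterion_eq[OF K h z])
  have nh: "0 < real n * h ^ CARD('d)" using n h by simp
  have "\<not> rho_criterion \<rho> K b x0 h n z s < rho_criterion \<rho> K b x0 h n z t"
    using min s by (simp add: is_arg_min_def)
  then have "(\<Sum>i<n. \<rho> (snd (z i) - poly_sum b t (u i)) * K (u i)) \<le> (\<Sum>i<n. \<rho> (snd (z i) - poly_sum b s (u i)) * K (u i))"
    unfolding crit u_def using nh by (simp add: not_less divide_le_cancel)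
  moreover have "(\<Sum>i<n. \<rho> (snd (z i) - poly_sum b s (u i)) * K (u i) - (1 - \<tau>) * (deriv \<rho> (snd (z i) - poly_sum b s (u i)) * poly_sum b (\<lambda>p. t p - t' p) (u i) * K (u i)))
      \<le> (\<Sum>i<n. \<rho> (snd (z i) - poly_sum b t (u i)) * K (u i))"
  proof (rule sum_mono)
    fix i
    let ?a = "snd (z i) - poly_sum b s (u i)" and ?d = "poly_sum b (\<lambda>p. t p - t' p) (u i)"
    \<comment> \<open>Tangent at the residual of \<open>s\<close>, evaluated at the residual of the
      minimizer. Summed with the kernel weights and compared with minimality, it fixes the sign of
      the score at \<open>s\<close>.\<close>
    have "\<rho> ?a + deriv \<rho> ?a * ((snd (z i) - poly_sum b t (u i)) - ?a) \<le> \<rho> (snd (z i) - poly_sum b t (u i))"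
      by (rule contrast_tangent[OF \<rho>])
    moreover have "(snd (z i) - poly_sum b t (u i)) - ?a = - ((1 - \<tau>) * ?d)"
      using poly_t[of "u i"] by linarith
    ultimately have "\<rho> ?a + deriv \<rho> ?a * (- ((1 - \<tau>) * ?d)) \<le> \<rho> (snd (z i) - poly_sum b t (u i))"
      by (simp only:)
    then have "\<rho> ?a - (1 - \<tau>) * (deriv \<rho> ?a * ?d) \<le> \<rho> (snd (z i) - poly_sum b t (u i))"
      by (simp add: mult.left_commute)
    moreover have "0 \<le> K (u i)" using K by (simp add: smoothing_kernel_def)
    ultimately have "(\<rho> ?a - (1 - \<tau>) * (deriv \<rho> ?a * ?d)) * K (u i) \<le> \<rho> (snd (z i) - poly_sum b t (u i)) * K (u i)"
      by (rule mult_right_mono)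
    then show "\<rho> ?a * K (u i) - (1 - \<tau>) * (deriv \<rho> ?a * ?d * K (u i)) \<le> \<rho> (snd (z i) - poly_sum b t (u i)) * K (u i)"
      by (simp add: algebra_simps)
  qed
  ultimately have "0 \<le> (1 - \<tau>) * (\<Sum>i<n. deriv \<rho> (snd (z i) - poly_sum b s (u i)) * poly_sum b (\<lambda>p. t p - t' p) (u i) * K (u i))"
    by (simp add: sum_subtractf sum_distrib_left)
  \<comment> \<open>Here \<open>\<tau> < 1\<close> is essential: at the minimizer itself the tangent
    inequality would be void. Multiplication by \<open>\<tau>\<close> then turns the direction
    \<open>t - t'\<close> into \<open>\<delta>\<close>.\<close>
  then have "0 \<le> (\<Sum>i<n. deriv \<rho> (snd (z i) - poly_sum b s (u i)) * poly_sum b (\<lambda>p. t p - t' p) (u i) * K (u i))"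
    using \<tau> by (simp add: zero_le_mult_iff)
  then have "0 \<le> \<tau> * (\<Sum>i<n. deriv \<rho> (snd (z i) - poly_sum b s (u i)) * poly_sum b (\<lambda>p. t p - t' p) (u i) * K (u i))"
    using \<tau> by simp
  also have "\<dots> = (\<Sum>i<n. deriv \<rho> (snd (z i) - poly_sum b t' (u i) - poly_sum b \<delta> (u i)) * poly_sum b \<delta> (u i) * K (u i))"
    unfolding sum_distrib_left poly_s \<delta>_def poly_sum_scale by (intro sum.cong refl) (simp add: algebra_simps)
  finally show ?thesis .
qed

text \<open>A grid on which each coordinate is rounded down. Only the coordinates in
  \<open>P\<close> are compared, so the default values of the grid functions elsewhere do not
  matter.\<close>

lemma finite_l1_net:
  assumes P: "finite P" and \<epsilon>: "0 < \<epsilon>"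
  obtains N :: "('a \<Rightarrow> real) set" where "finite N"
    "\<And>t. (\<Sum>p\<in>P. \<bar>t p\<bar>) \<le> 1 \<Longrightarrow> \<exists>s\<in>N. (\<Sum>p\<in>P. \<bar>t p - s p\<bar>) \<le> \<epsilon>"
proof -
  \<comment> \<open>The summand 1 avoids a division by zero for empty \<open>P\<close>;
    \<open>card P\<close> rounding errors of size at most \<open>m\<close> add up to at most
    \<epsilon>.\<close>
  define m where "m = \<epsilon> / (real (card P) + 1)"
  have m: "0 < m" using \<epsilon> by (simp add: m_def add_nonneg_pos)
  define J where "J = \<lceil>1 / m\<rceil> + 1"
  define N where "N = PiE P (\<lambda>_. (\<lambda>j. m * real_of_int j) ` {- J..J})"
  show ?thesis
  proof (rule that[of N])
    show "finite N" unfolding N_def using P by (intro finite_PiE) auto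
    fix t :: "'a \<Rightarrow> real" assume t: "(\<Sum>p\<in>P. \<bar>t p\<bar>) \<le> 1"
    define s where "s = restrict (\<lambda>p. m * real_of_int \<lfloor>t p / m\<rfloor>) P"
    have "s \<in> N"
      unfolding N_def s_def
    proof (rule restrict_PiE_iff[THEN iffD2], intro ballI imageI)
      fix p assume p: "p \<in> P"
      have "\<bar>t p\<bar> \<le> 1" using member_le_sum[of p P "\<lambda>p. \<bar>t p\<bar>"] p P t by auto
      then have "\<bar>t p / m\<bar> \<le> 1 / m" using m by (simp add: abs_divide divide_right_mono)
      moreover have "\<lfloor>a\<rfloor> \<in> {- (\<lceil>r\<rceil> + 1)..\<lceil>r\<rceil> + 1}" if "\<bar>a\<bar> \<le> r" for a r :: real
      proof -
        have "a \<le> r" "- r \<le> a" using that by auto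
        then have "- (\<lceil>r\<rceil> + 1) \<le> \<lfloor>a\<rfloor>" "\<lfloor>a\<rfloor> \<le> \<lceil>r\<rceil> + 1" by linarith+
        then show ?thesis by simp
      qed
      ultimately show "\<lfloor>t p / m\<rfloor> \<in> {- J..J}" unfolding J_def by blast
    qed
    moreover have "(\<Sum>p\<in>P. \<bar>t p - s p\<bar>) \<le> (\<Sum>p\<in>P. m)"
    proof (rule sum_mono)
      fix p assume p: "p \<in> P"
      have "t p - s p = m * (t p / m - real_of_int \<lfloor>t p / m\<rfloor>)"
        using p m by (simp add: s_def algebra_simps)
      also have "\<bar>\<dots>\<bar> \<le> m * 1"
      proof -
        have "\<bar>t p / m - real_of_int \<lfloor>t p / m\<rfloor>\<bar> \<le> 1" by (simp add: abs_le_iff) linarith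
        then show ?thesis unfolding abs_mult using m by (intro mult_mono) auto
      qed
      finally show "\<bar>t p - s p\<bar> \<le> m" by simp
    qed
    moreover have "(\<Sum>p\<in>P. m) \<le> \<epsilon>"
      using \<epsilon> by (simp add: m_def field_simps)
    ultimately show "\<exists>s\<in>N. (\<Sum>p\<in>P. \<bar>t p - s p\<bar>) \<le> \<epsilon>" by force
  qed
qed


section \<open>The expected score\<close>

definition obs_law :: "(nat \<Rightarrow> real \<Rightarrow> real) \<Rightarrow> nat \<Rightarrow> ((real ^ 'd::finite) \<times> real) measure" where
  "obs_law g i = restrict_space lborel unit_cube \<Otimes>\<^sub>M density lborel (\<lambda>z. ennreal (g i z))"

text \<open>With \<open>e\<close> the Taylor remainder and \<open>snd w\<close> the noise, the
  argument of \<open>deriv \<rho>\<close> is the residual at the parameter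
  \<open>t + \<eta>\<close>. Up to sign and normalization this is one observation's share of the
  partial derivative of the criterion in the coefficient \<open>p\<close>.\<close>

definition score ::
    "(real \<Rightarrow> real) \<Rightarrow> (real ^ 'd::finite \<Rightarrow> real) \<Rightarrow> nat \<Rightarrow> real ^ 'd \<Rightarrow> real \<Rightarrow> (real ^ 'd \<Rightarrow> real)
      \<Rightarrow> (('d \<Rightarrow> nat) \<Rightarrow> real) \<Rightarrow> ('d \<Rightarrow> nat) \<Rightarrow> (real ^ 'd) \<times> real \<Rightarrow> real" where
  "score \<rho> K b x0 h e \<eta> p w = deriv \<rho> (snd w + e (fst w) - poly_sum b \<eta> ((fst w - x0) /\<^sub>R h))
     * monomial p ((fst w - x0) /\<^sub>R h) * K ((fst w - x0) /\<^sub>R h)"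

text \<open>For fixed \<open>\<eta>\<close> the score is linear in the direction
  \<open>\<delta>\<close>. Bounding its finitely many components therefore handles all directions,
  and a net is needed for the base point \<open>\<eta>\<close> only.\<close>

lemma score_lincomb:
  "(\<Sum>p\<in>multi_indices b. \<delta> p * score \<rho> K b x0 h e \<eta> p w) =
     deriv \<rho> (snd w + e (fst w) - poly_sum b \<eta> ((fst w - x0) /\<^sub>R h))
       * poly_sum b \<delta> ((fst w - x0) /\<^sub>R h) * K ((fst w - x0) /\<^sub>R h)"
  by (simp add: score_def poly_sum_def sum_distrib_left sum_distrib_right mult_ac)

lemma unit_cube_sets [measurable]: "unit_cube \<in> sets (borel :: (real ^ 'd::finite) measure)"
  by (simp add: unit_cube_def)

lemma prob_space_restrict_unit_cube:
  "prob_space (restrict_space lborel (unit_cube :: (real ^ 'd::finite) set))"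
proof
  have "emeasure lborel (unit_cube :: (real ^ 'd) set) = 1"
    by (auto simp: unit_cube_def emeasure_lborel_cbox_eq Basis_vec_def inner_axis intro!: prod.neutral)
  then show "emeasure (restrict_space lborel (unit_cube :: (real ^ 'd) set)) (space (restrict_space lborel unit_cube)) = 1"
    by (simp add: emeasure_restrict_space space_restrict_space)
qed

lemma prob_space_obs_law:
  assumes "g \<in> noise_class \<rho> c"
  shows "prob_space (obs_law g i)"
  unfolding obs_law_def
  by (intro prob_space_pair prob_space_restrict_unit_cube prob_space_density_lborel)
     (use assms in \<open>simp add: noise_class_def\<close>)

lemma space_obs_law: "space (obs_law g i) = unit_cube \<times> UNIV"
  by (simp add: obs_law_def space_pair_measure space_restrict_space)

lemma rescale_measurable [measurable]:
  "(\<lambda>x. (x - x0) /\<^sub>R h) \<in> restrict_space lborel unit_cube \<rightarrow>\<^sub>M (borel :: (real ^ 'd::finite) measure)"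
  by (rule measurable_restrict_space1) simp

lemma obs_law_measurable [measurable]:
  fixes x0 :: "real ^ 'd::finite"
  shows "fst \<in> obs_law g i \<rightarrow>\<^sub>M restrict_space lborel unit_cube"
    and "snd \<in> obs_law g i \<rightarrow>\<^sub>M borel"
    and "(\<lambda>w. (fst w - x0) /\<^sub>R h) \<in> obs_law g i \<rightarrow>\<^sub>M borel"
proof -
  show fst: "fst \<in> obs_law g i \<rightarrow>\<^sub>M restrict_space lborel unit_cube"
    unfolding obs_law_def by measurable
  have "snd \<in> obs_law g i \<rightarrow>\<^sub>M density lborel (\<lambda>z. ennreal (g i z))"
    unfolding obs_law_def by measurable
  then show "snd \<in> obs_law g i \<rightarrow>\<^sub>M borel" by (simp cong: measurable_cong_sets)
  show "(\<lambda>w. (fst w - x0) /\<^sub>R h) \<in> obs_law g i \<rightarrow>\<^sub>M borel"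
    using measurable_compose[OF fst rescale_measurable] .
qed

lemma score_measurable:
  assumes "contrast_function g \<rho>" "smoothing_kernel K" "e \<in> borel_measurable (restrict_space lborel unit_cube)"
  shows "score \<rho> K b x0 h e \<eta> p \<in> borel_measurable (obs_law g' i)"
proof -
  note [measurable] = assms(3)
  have [measurable]: "K \<in> borel_measurable borel"
    using assms(2) borel_measurable_integrable[of lborel K] by (simp add: smoothing_kernel_def)
  have [measurable]: "deriv \<rho> \<in> borel_measurable borel"
    by (rule borel_measurable_continuous_onI[OF contrast_deriv_continuous[OF assms(1)]])
  show ?thesis unfolding score_def by measurable
qed

lemma integral_obs_law:
  fixes f :: "(real ^ 'd::finite) \<times> real \<Rightarrow> real"
  assumes "g \<in> noise_class \<rho> c" and f: "f \<in> borel_measurable (obs_law g i)" "\<And>w. w \<in> space (obs_law g i) \<Longrightarrow> \<bar>f w\<bar> \<le> a"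
  shows "integrable (obs_law g i) f"
    and "(LINT w|obs_law g i. f w) =
      (LINT x|restrict_space lborel unit_cube. LINT y|density lborel (\<lambda>z. ennreal (g i z)). f (x, y))"
proof -
  interpret N: prob_space "obs_law g i :: ((real ^ 'd) \<times> real) measure" by (rule prob_space_obs_law[OF assms(1)])
  show int: "integrable (obs_law g i) f"
    by (rule N.integrable_const_bound[of _ a]) (use f in auto)
  interpret X: prob_space "restrict_space lborel (unit_cube :: (real ^ 'd) set)" by (rule prob_space_restrict_unit_cube)
  interpret Y: prob_space "density lborel (\<lambda>z. ennreal (g i z))"
    using assms(1) by (intro prob_space_density_lborel) (simp add: noise_class_def)
  interpret pair_sigma_finite "restrict_space lborel (unit_cube :: (real ^ 'd) set)" "density lborel (\<lambda>z. ennreal (g i z))" ..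
  show "(LINT w|obs_law g i. f w) =
      (LINT x|restrict_space lborel unit_cube. LINT y|density lborel (\<lambda>z. ennreal (g i z)). f (x, y))"
    using integral_fst'[of f] int by (simp add: obs_law_def)
qed

lemma integral_obs_law_fst:
  fixes F :: "real ^ 'd::finite \<Rightarrow> real"
  assumes "g \<in> noise_class \<rho> c" and F: "F \<in> borel_measurable (restrict_space lborel unit_cube)" "\<And>x. x \<in> unit_cube \<Longrightarrow> \<bar>F x\<bar> \<le> a"
  shows "(LINT w|obs_law g i. F (fst w)) = (LINT x|restrict_space lborel unit_cube. F x)"
proof -
  note [measurable] = F(1)
  interpret Y: prob_space "density lborel (\<lambda>z. ennreal (g i z))"
    using assms(1) by (intro prob_space_density_lborel) (simp add: noise_class_def)
  show ?thesis
    using integral_obs_law(2)[OF assms(1), of "\<lambda>w. F (fst w)" i a] F(2) Y.prob_space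
    by (simp add: space_obs_law mem_Times_iff)
qed

lemma integral_restrict_rescale:
  fixes F :: "real ^ 'd::finite \<Rightarrow> real" and x0 :: "real ^ 'd"
  assumes "x0 \<in> unit_cube" and F: "F \<in> borel_measurable borel" and supp: "\<And>z j. F z \<noteq> 0 \<Longrightarrow> \<bar>z $ j\<bar> \<le> 1"
    and h: "0 < h" "\<And>j. x0 $ j \<noteq> 0 \<Longrightarrow> h \<le> x0 $ j" "\<And>j. x0 $ j \<noteq> 1 \<Longrightarrow> h \<le> 1 - x0 $ j"
  shows "(LINT x|restrict_space lborel unit_cube. F ((x - x0) /\<^sub>R h)) = h ^ CARD('d) * (LINT z:inward_cone x0|lborel. F z)"
  using integral_cube_rescale[OF assms]
  by (subst integral_restrict_space) (auto simp: set_lebesgue_integral_def)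

lemma inward_cone_measurable [measurable]: "inward_cone x0 \<in> sets (borel :: (real ^ 'd::finite) measure)"
proof -
  have "closed (inward_cone x0)"
    unfolding inward_cone_def
    by (intro closed_Collect_all closed_Collect_conj closed_Collect_imp open_Collect_const closed_Collect_le continuous_intros)
  then show ?thesis by simp
qed

text \<open>For a given design point, the noise integrates out to \<open>G i\<close> at
  \<open>e x - poly_sum b \<eta> (u x)\<close>. Replacing this argument by minus the polynomial of
  \<open>\<delta>\<close> costs at most \<open>\<epsilon>\<close> plus the distance of
  \<open>\<delta>\<close> and \<open>\<eta>\<close>, since \<open>G i\<close> is 1-Lipschitz, and
  leaves the quadratic drift. Rescaling and coercivity turn the square of the polynomial into the
  square of the l1 norm. Direction and base point are kept apart because the net only approximates
  the latter.\<close>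

lemma score_drift:
  fixes x0 :: "real ^ 'd::finite"
  assumes \<rho>: "contrast_function g \<rho>" and g: "g \<in> noise_class \<rho> c" and c: "0 < c" and A: "0 < A"
    and x0: "x0 \<in> unit_cube" and K: "smoothing_kernel K" and cone: "kernel_charges_cube K x0"
  obtains \<gamma> h0 where "0 < \<gamma>" "0 < h0" "h0 \<le> 1"
    "\<And>i h. 0 < h \<Longrightarrow> h \<le> h0 \<Longrightarrow> (LINT w|obs_law g i. K ((fst w - x0) /\<^sub>R h)) \<le> h ^ CARD('d)"
    "\<And>i h e \<epsilon> \<delta> \<eta>. 0 < h \<Longrightarrow> h \<le> h0 \<Longrightarrow> e \<in> borel_measurable (restrict_space lborel unit_cube) \<Longrightarrow>
      (\<forall>x\<in>unit_cube. K ((x - x0) /\<^sub>R h) \<noteq> 0 \<longrightarrow> \<bar>e x\<bar> \<le> \<epsilon>) \<Longrightarrow>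
      (\<Sum>p\<in>multi_indices b. \<bar>\<delta> p\<bar>) \<le> A \<Longrightarrow>
      (\<Sum>p\<in>multi_indices b. \<delta> p * (LINT w|obs_law g i. score \<rho> K b x0 h e \<eta> p w)) \<le>
        h ^ CARD('d) * (- \<gamma> * (\<Sum>p\<in>multi_indices b. \<bar>\<delta> p\<bar>)\<^sup>2
          + (\<Sum>p\<in>multi_indices b. \<bar>\<delta> p\<bar>) * (max \<epsilon> 0 + (\<Sum>p\<in>multi_indices b. \<bar>\<delta> p - \<eta> p\<bar>)))"
proof -
  let ?P = "multi_indices b :: ('d \<Rightarrow> nat) set"
  let ?R = "restrict_space lborel (unit_cube :: (real ^ 'd) set)"
  \<comment> \<open>The part of the kernel that the cube sees in the limit;
    \<open>kernel_charges_cube\<close> says that its mass is positive.\<close>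
  define \<kappa> where "\<kappa> z = indicator (inward_cone x0) z * K z" for z
  define \<mu> where "\<mu> i = density lborel (\<lambda>z. ennreal (g i z))" for i
  define G where "G i w = (LINT y|\<mu> i. deriv \<rho> (y + w))" for i w
  have K_int: "integrable lborel K" and K0: "\<And>z. 0 \<le> K z" and K1: "(LINT z|lborel. K z) = 1"
    using K by (auto simp: smoothing_kernel_def)
  note [measurable] = borel_measurable_integrable[OF K_int]
  obtain k where k: "0 < k" "\<And>z. K z \<le> k"
    using smoothing_kernel_bound[OF K] by blast
  have K_supp: "\<bar>z $ j\<bar> \<le> 1" if "K z \<noteq> 0" for z j
    using smoothing_kernel_supp[OF K that, of j] by simp
  have \<kappa>_int: "integrable lborel \<kappa>"
    unfolding \<kappa>_def by (rule Bochner_Integration.integrable_bound[OF K_int]) (auto simp: indicator_def)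
  have \<kappa>0: "0 \<le> \<kappa> z" for z by (simp add: \<kappa>_def K0)
  have \<kappa>_supp: "\<bar>z $ j\<bar> \<le> 1" if "\<kappa> z \<noteq> 0" for z j using that K_supp[of z] by (simp add: \<kappa>_def)
  have \<kappa>_pos: "0 < (LINT z|lborel. \<kappa> z)"
    using cone by (simp add: kernel_charges_cube_def set_lebesgue_integral_def \<kappa>_def)
  have \<kappa>_le: "(LINT z|lborel. \<kappa> z) \<le> 1"
    unfolding K1[symmetric] by (intro integral_mono \<kappa>_int K_int) (auto simp: \<kappa>_def K0 indicator_def)
  obtain q where q: "0 < q" "\<And>t. q * (\<Sum>p\<in>?P. \<bar>t p\<bar>)\<^sup>2 \<le> (LINT z|lborel. (poly_sum b t z)\<^sup>2 * \<kappa> z)"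
    using poly_sum_square_coercive[OF \<kappa>_int \<kappa>0 \<kappa>_supp \<kappa>_pos] by metis
  obtain \<gamma> where \<gamma>: "0 < \<gamma>" "\<And>i u. \<bar>u\<bar> \<le> A \<Longrightarrow> \<gamma> * u\<^sup>2 \<le> u * G i u"
    using noise_drift[OF \<rho> g c A] unfolding G_def \<mu>_def by metis
  obtain h0 where h0: "0 < h0" "h0 \<le> 1" "\<And>j. x0 $ j \<noteq> 0 \<Longrightarrow> h0 \<le> x0 $ j" "\<And>j. x0 $ j \<noteq> 1 \<Longrightarrow> h0 \<le> 1 - x0 $ j"
    using bandwidth_fits_inward_cone[OF x0] by metis
  have resc: "(LINT x|?R. F ((x - x0) /\<^sub>R h) * K ((x - x0) /\<^sub>R h)) = h ^ CARD('d) * (LINT z|lborel. F z * \<kappa> z)"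
    if h: "0 < h" "h \<le> h0" and F: "F \<in> borel_measurable borel" for F :: "real ^ 'd \<Rightarrow> real" and h
  proof -
    note [measurable] = F
    have "(LINT x|?R. F ((x - x0) /\<^sub>R h) * K ((x - x0) /\<^sub>R h)) = h ^ CARD('d) * (LINT z:inward_cone x0|lborel. F z * K z)"
    proof (rule integral_restrict_rescale[OF x0, of "\<lambda>z. F z * K z"])
      show "h \<le> x0 $ j" if "x0 $ j \<noteq> 0" for j using h0(3)[OF that] h by linarith
      show "h \<le> 1 - x0 $ j" if "x0 $ j \<noteq> 1" for j using h0(4)[OF that] h by linarith
    qed (use h K_supp in auto)
    then show ?thesis by (simp add: set_lebesgue_integral_def \<kappa>_def mult_ac)
  qed
  have K_mean: "(LINT w|obs_law g i. K ((fst w - x0) /\<^sub>R h)) \<le> h ^ CARD('d)" if h: "0 < h" "h \<le> h0" for i h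
  proof -
    have "(LINT w|obs_law g i. K ((fst w - x0) /\<^sub>R h)) = (LINT x|?R. K ((x - x0) /\<^sub>R h))"
      by (rule integral_obs_law_fst[OF g, where a = k]) (use k K0 in \<open>auto simp: abs_le_iff intro: order_trans[of _ 0]\<close>)
    also have "\<dots> = h ^ CARD('d) * (LINT z|lborel. \<kappa> z)"
      using resc[OF h, of "\<lambda>_. 1"] by simp
    also have "\<dots> \<le> h ^ CARD('d)" using h \<kappa>_le by (simp add: mult_left_le)
    finally show ?thesis .
  qed
  obtain B where B: "0 < B" "\<And>x. \<bar>deriv \<rho> x\<bar> \<le> B" using contrast_deriv_bounded[OF \<rho>] by auto
  have [measurable]: "deriv \<rho> \<in> borel_measurable borel"
    by (rule borel_measurable_continuous_onI[OF contrast_deriv_continuous[OF \<rho>]])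
  have \<mu>: "prob_space (\<mu> i)" for i
    unfolding \<mu>_def using g by (intro prob_space_density_lborel) (simp add: noise_class_def)
  have [measurable_cong]: "sets (\<mu> i) = sets borel" for i by (simp add: \<mu>_def)
  have int_\<psi>: "integrable (\<mu> i) (\<lambda>y. deriv \<rho> (y + w))" for i w
  proof -
    interpret prob_space "\<mu> i" by (rule \<mu>)
    show ?thesis by (rule integrable_const_bound[of _ B]) (auto simp: B)
  qed
  have G_lip: "\<bar>G i w - G i w'\<bar> \<le> \<bar>w - w'\<bar>" for i w w'
  proof -
    interpret prob_space "\<mu> i" by (rule \<mu>)
    have "\<bar>G i w - G i w'\<bar> = \<bar>LINT y|\<mu> i. deriv \<rho> (y + w) - deriv \<rho> (y + w')\<bar>"
      unfolding G_def by (simp add: int_\<psi>)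
    also have "\<dots> \<le> (LINT y|\<mu> i. \<bar>deriv \<rho> (y + w) - deriv \<rho> (y + w')\<bar>)"
      by (rule integral_abs_bound)
    also have "\<dots> \<le> (LINT y|\<mu> i. \<bar>w - w'\<bar>)"
    proof (rule integral_mono)
      show "integrable (\<mu> i) (\<lambda>y. \<bar>deriv \<rho> (y + w) - deriv \<rho> (y + w')\<bar>)"
        by (intro integrable_abs Bochner_Integration.integrable_diff int_\<psi>)
      show "\<bar>deriv \<rho> (y + w) - deriv \<rho> (y + w')\<bar> \<le> \<bar>w - w'\<bar>" for y
        using contrast_deriv_lipschitz[OF \<rho>, of "y + w" "y + w'"] by simp
    qed simp
    finally show ?thesis by (simp add: prob_space)
  qed
  show ?thesis
  proof (rule that[of "\<gamma> * q" h0])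
    fix i :: nat and h \<epsilon> :: real and e :: "real ^ 'd \<Rightarrow> real" and \<delta> \<eta> :: "('d \<Rightarrow> nat) \<Rightarrow> real"
    assume h: "0 < h" "h \<le> h0" and e: "e \<in> borel_measurable ?R"
      and e_le: "\<forall>x\<in>unit_cube. K ((x - x0) /\<^sub>R h) \<noteq> 0 \<longrightarrow> \<bar>e x\<bar> \<le> \<epsilon>"
      and \<delta>: "(\<Sum>p\<in>?P. \<bar>\<delta> p\<bar>) \<le> A"
    note [measurable] = e
    define s where "s = (\<Sum>p\<in>?P. \<bar>\<delta> p\<bar>)"
    define d where "d = (\<Sum>p\<in>?P. \<bar>\<delta> p - \<eta> p\<bar>)"
    define C where "C = s * (max \<epsilon> 0 + d)"
    have s0: "0 \<le> s" and d0: "0 \<le> d" by (simp_all add: s_def d_def sum_nonneg)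
    define u where "u x = (x - x0) /\<^sub>R h" for x
    define f where "f w = deriv \<rho> (snd w + e (fst w) - poly_sum b \<eta> (u (fst w))) * poly_sum b \<delta> (u (fst w)) * K (u (fst w))" for w :: "(real ^ 'd) \<times> real"
    have [measurable]: "(\<lambda>w. u (fst w)) \<in> obs_law g i \<rightarrow>\<^sub>M borel" "u \<in> ?R \<rightarrow>\<^sub>M borel"
      unfolding u_def by measurable
    have mono1: "\<bar>monomial p (u x)\<bar> \<le> 1" if "K (u x) \<noteq> 0" for p x
      using K_supp[OF that] by (rule abs_monomial_le_1)
    have score_le: "\<bar>score \<rho> K b x0 h e \<eta> p w\<bar> \<le> B * k" for p w
    proof (cases "K (u (fst w)) = 0")
      case False
      have "\<bar>score \<rho> K b x0 h e \<eta> p w\<bar> \<le> B * 1 * k"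
        unfolding score_def abs_mult u_def[symmetric]
        using B k K0 mono1[OF False] by (intro mult_mono) (auto simp: abs_of_nonneg)
      then show ?thesis by simp
    qed (use B k in \<open>auto simp: score_def u_def\<close>)
    have "(\<Sum>p\<in>?P. \<delta> p * (LINT w|obs_law g i. score \<rho> K b x0 h e \<eta> p w)) = (LINT w|obs_law g i. (\<Sum>p\<in>?P. \<delta> p * score \<rho> K b x0 h e \<eta> p w))"
      using integral_obs_law(1)[OF g score_measurable[OF \<rho> K e] score_le]
      by (subst Bochner_Integration.integral_sum) auto
    also have "\<dots> = (LINT w|obs_law g i. f w)"
      unfolding score_lincomb f_def u_def ..
    also have "\<dots> = (LINT x|?R. LINT y|\<mu> i. f (x, y))"
      unfolding \<mu>_def
    proof (rule integral_obs_law(2)[OF g])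
      show "f \<in> borel_measurable (obs_law g i)" unfolding f_def by measurable
      show "\<bar>f w\<bar> \<le> B * s * k" for w
      proof (cases "K (u (fst w)) = 0")
        case False
        then show ?thesis
          unfolding f_def abs_mult s_def
          using B k K0 abs_poly_sum_le[of "u (fst w)" b \<delta>] K_supp[OF False]
          by (intro mult_mono) (auto simp: abs_of_nonneg sum_nonneg)
      qed (use B k s0 in \<open>auto simp: f_def\<close>)
    qed
    also have "\<dots> = (LINT x|?R. G i (e x - poly_sum b \<eta> (u x)) * poly_sum b \<delta> (u x) * K (u x))"
      by (simp add: f_def G_def add_diff_eq)
    also have "\<dots> \<le> (LINT x|?R. (- \<gamma> * (poly_sum b \<delta> (u x))\<^sup>2 + C) * K (u x))"
    proof (rule integral_mono)
      interpret X: prob_space ?R by (rule prob_space_restrict_unit_cube)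
      have G_meas [measurable]: "G i \<in> borel_measurable borel"
      proof (rule borel_measurable_continuous_onI, rule lipschitz_on_continuous_on)
        show "1-lipschitz_on UNIV (G i)" using G_lip by (intro lipschitz_onI) (auto simp: dist_real_def)
      qed
      have G_le: "\<bar>G i w\<bar> \<le> B" for w
      proof -
        interpret prob_space "\<mu> i" by (rule \<mu>)
        have "\<bar>G i w\<bar> \<le> (LINT y|\<mu> i. \<bar>deriv \<rho> (y + w)\<bar>)" unfolding G_def by (rule integral_abs_bound)
        also have "\<dots> \<le> (LINT y|\<mu> i. B)" by (intro integral_mono integrable_abs int_\<psi>) (auto simp: B)
        finally show ?thesis by (simp add: prob_space)
      qed
      have poly_le: "\<bar>poly_sum b \<delta> (u x)\<bar> \<le> s" if "K (u x) \<noteq> 0" for x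
        unfolding s_def by (rule abs_poly_sum_le) (use K_supp[OF that] in auto)
      show "integrable ?R (\<lambda>x. G i (e x - poly_sum b \<eta> (u x)) * poly_sum b \<delta> (u x) * K (u x))"
      proof (rule X.integrable_const_bound[of _ "B * s * k"])
        have "\<bar>G i (e x - poly_sum b \<eta> (u x)) * poly_sum b \<delta> (u x) * K (u x)\<bar> \<le> B * s * k" for x
        proof (cases "K (u x) = 0")
          case False
          then show ?thesis unfolding abs_mult using G_le poly_le[OF False] k K0 B s0
            by (intro mult_mono) (auto simp: abs_of_nonneg)
        qed (use B k s0 in auto)
        then show "AE x in ?R. norm (G i (e x - poly_sum b \<eta> (u x)) * poly_sum b \<delta> (u x) * K (u x)) \<le> B * s * k" by simp
      qed measurable
      show "integrable ?R (\<lambda>x. (- \<gamma> * (poly_sum b \<delta> (u x))\<^sup>2 + C) * K (u x))"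
      proof (rule X.integrable_const_bound[of _ "(\<gamma> * s\<^sup>2 + \<bar>C\<bar>) * k"])
        have "\<bar>(- \<gamma> * (poly_sum b \<delta> (u x))\<^sup>2 + C) * K (u x)\<bar> \<le> (\<gamma> * s\<^sup>2 + \<bar>C\<bar>) * k" for x
        proof (cases "K (u x) = 0")
          case False
          have "(poly_sum b \<delta> (u x))\<^sup>2 \<le> s\<^sup>2"
            using poly_le[OF False] s0 by (simp add: abs_le_square_iff[symmetric])
          then have "\<bar>- \<gamma> * (poly_sum b \<delta> (u x))\<^sup>2 + C\<bar> \<le> \<gamma> * s\<^sup>2 + \<bar>C\<bar>"
            using \<gamma> by (intro order_trans[OF abs_triangle_ineq] add_mono) (auto simp: abs_mult)
          then show ?thesis unfolding abs_mult[of _ "K (u x)"] using k K0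
            by (intro mult_mono) (auto simp: abs_of_nonneg)
        qed (use \<gamma> k in auto)
        then show "AE x in ?R. norm ((- \<gamma> * (poly_sum b \<delta> (u x))\<^sup>2 + C) * K (u x)) \<le> (\<gamma> * s\<^sup>2 + \<bar>C\<bar>) * k" by simp
      qed measurable
      fix x assume "x \<in> space ?R"
      then have x: "x \<in> unit_cube" by (simp add: space_restrict_space)
      show "G i (e x - poly_sum b \<eta> (u x)) * poly_sum b \<delta> (u x) * K (u x) \<le> (- \<gamma> * (poly_sum b \<delta> (u x))\<^sup>2 + C) * K (u x)"
      proof (cases "K (u x) = 0")
        case False
        let ?v = "poly_sum b \<delta> (u x)" and ?v' = "poly_sum b \<eta> (u x)"
        have v: "\<bar>?v\<bar> \<le> s" by (rule poly_le[OF False])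
        have "\<bar>poly_sum b (\<lambda>p. \<delta> p - \<eta> p) (u x)\<bar> \<le> d"
          unfolding d_def by (rule abs_poly_sum_le) (use K_supp[OF False] in auto)
        then have vv: "\<bar>?v - ?v'\<bar> \<le> d" by (simp add: poly_sum_diff)
        have ex: "\<bar>e x\<bar> \<le> max \<epsilon> 0" using bspec[OF e_le x] False by (auto simp: u_def)
        \<comment> \<open>The first term is the drift of a well specified model, the second collects
          the bias and the error of the net.\<close>
        have "G i (e x - ?v') * ?v = G i (- ?v) * ?v + (G i (e x - ?v') - G i (- ?v)) * ?v"
          by (simp add: algebra_simps)
        also have "\<dots> \<le> - \<gamma> * ?v\<^sup>2 + (max \<epsilon> 0 + d) * s"
        proof (rule add_mono)
          show "G i (- ?v) * ?v \<le> - \<gamma> * ?v\<^sup>2"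
            using \<gamma>(2)[of "- ?v" i] v \<delta> by (simp add: s_def mult.commute)
          have "\<bar>G i (e x - ?v') - G i (- ?v)\<bar> \<le> \<bar>e x + (?v - ?v')\<bar>"
            using G_lip[of i "e x - ?v'" "- ?v"] by (simp add: algebra_simps)
          also have "\<dots> \<le> max \<epsilon> 0 + d" using ex vv by linarith
          finally have "\<bar>(G i (e x - ?v') - G i (- ?v)) * ?v\<bar> \<le> (max \<epsilon> 0 + d) * s"
            unfolding abs_mult using v s0 d0 by (intro mult_mono) auto
          then show "(G i (e x - ?v') - G i (- ?v)) * ?v \<le> (max \<epsilon> 0 + d) * s" by linarith
        qed
        finally show ?thesis using K0 by (intro mult_right_mono) (auto simp: C_def mult.commute)
      qed simp
    qed
    also have "\<dots> = h ^ CARD('d) * (LINT z|lborel. (- \<gamma> * (poly_sum b \<delta> z)\<^sup>2 + C) * \<kappa> z)"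
      unfolding u_def by (rule resc[OF h]) measurable
    also have "\<dots> \<le> h ^ CARD('d) * (- (\<gamma> * q) * s\<^sup>2 + C)"
    proof (rule mult_left_mono)
      have int_sq: "integrable lborel (\<lambda>z. (poly_sum b \<delta> z)\<^sup>2 * \<kappa> z)"
      proof (rule Bochner_Integration.integrable_bound)
        show "integrable lborel (\<lambda>z. s\<^sup>2 * \<kappa> z)" using \<kappa>_int by simp
        have "\<bar>(poly_sum b \<delta> z)\<^sup>2 * \<kappa> z\<bar> \<le> s\<^sup>2 * \<kappa> z" for z
        proof (cases "\<kappa> z = 0")
          case False
          have "\<bar>poly_sum b \<delta> z\<bar> \<le> s"
            unfolding s_def by (rule abs_poly_sum_le) (use \<kappa>_supp[OF False] in auto)
          then have "(poly_sum b \<delta> z)\<^sup>2 \<le> s\<^sup>2" using s0 by (simp add: abs_le_square_iff[symmetric])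
          then show ?thesis using \<kappa>0 by (simp add: abs_mult mult_right_mono)
        qed simp
        then show "AE z in lborel. norm ((poly_sum b \<delta> z)\<^sup>2 * \<kappa> z) \<le> norm (s\<^sup>2 * \<kappa> z)"
          using \<kappa>0 by (simp add: abs_mult)
      qed (use \<kappa>_int in measurable)
      have "(LINT z|lborel. (- \<gamma> * (poly_sum b \<delta> z)\<^sup>2 + C) * \<kappa> z) = (LINT z|lborel. - \<gamma> * ((poly_sum b \<delta> z)\<^sup>2 * \<kappa> z) + C * \<kappa> z)"
        by (simp add: algebra_simps)
      also have "\<dots> = - \<gamma> * (LINT z|lborel. (poly_sum b \<delta> z)\<^sup>2 * \<kappa> z) + C * (LINT z|lborel. \<kappa> z)"
        using int_sq \<kappa>_int by (subst Bochner_Integration.integral_add) auto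
      also have "\<dots> \<le> - \<gamma> * (q * s\<^sup>2) + C * 1"
      proof (rule add_mono)
        show "- \<gamma> * (LINT z|lborel. (poly_sum b \<delta> z)\<^sup>2 * \<kappa> z) \<le> - \<gamma> * (q * s\<^sup>2)"
          using q(2)[of \<delta>] \<gamma>(1) by (simp add: s_def)
        show "C * (LINT z|lborel. \<kappa> z) \<le> C * 1"
          using \<kappa>_le s0 d0 by (intro mult_left_mono) (auto simp: C_def)
      qed
      finally show "(LINT z|lborel. (- \<gamma> * (poly_sum b \<delta> z)\<^sup>2 + C) * \<kappa> z) \<le> - (\<gamma> * q) * s\<^sup>2 + C" by simp
    qed (use h in simp)
    finally show "(\<Sum>p\<in>?P. \<delta> p * (LINT w|obs_law g i. score \<rho> K b x0 h e \<eta> p w)) \<le>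
        h ^ CARD('d) * (- (\<gamma> * q) * (\<Sum>p\<in>?P. \<bar>\<delta> p\<bar>)\<^sup>2 + (\<Sum>p\<in>?P. \<bar>\<delta> p\<bar>) * (max \<epsilon> 0 + (\<Sum>p\<in>?P. \<bar>\<delta> p - \<eta> p\<bar>)))"
      by (simp add: s_def d_def C_def)
  qed (use h0 \<gamma> q K_mean in auto)
qed

lemma design_noise_law_eq: "design_noise_law n g = Pi\<^sub>M {..<n} (obs_law g)"
  by (simp add: design_noise_law_def obs_law_def[abs_def])

text \<open>By homogeneity one finite net serves all radii \<open>s\<close>: the score is Lipschitz in its parameter, so it
  suffices to control its fluctuations at the points \<open>s \<eta>\<close> with an error proportional to \<open>s\<close>.\<close>

lemma score_negative_tail:
  fixes x0 :: "real ^ 'd::finite"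
  assumes \<rho>: "contrast_function g \<rho>" and g: "g \<in> noise_class \<rho> c" and c: "0 < c" and A: "0 < A"
    and x0: "x0 \<in> unit_cube" and K: "smoothing_kernel K" and cone: "kernel_charges_cube K x0"
  obtains C c1 a1 h0 where "0 \<le> C" "0 < c1" "0 < a1" "0 < h0" "h0 \<le> 1"
    "\<And>n h e \<epsilon> s. 1 \<le> n \<Longrightarrow> 0 < h \<Longrightarrow> h \<le> h0 \<Longrightarrow> e \<in> borel_measurable (restrict_space lborel unit_cube) \<Longrightarrow>
      (\<forall>x\<in>unit_cube. K ((x - x0) /\<^sub>R h) \<noteq> 0 \<longrightarrow> \<bar>e x\<bar> \<le> \<epsilon>) \<Longrightarrow> 0 \<le> \<epsilon> \<Longrightarrow> a1 * \<epsilon> < s \<Longrightarrow> s \<le> A \<Longrightarrow>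
      \<exists>Bd\<in>sets (design_noise_law n g).
        emeasure (design_noise_law n g) Bd \<le> ennreal (C * exp (- (c1 * s\<^sup>2 * (real n * h ^ CARD('d))))) \<and>
        (\<forall>\<omega>\<in>space (design_noise_law n g) - Bd. \<forall>\<delta>. (\<Sum>p\<in>multi_indices b. \<bar>\<delta> p\<bar>) = s \<longrightarrow>
          (\<Sum>i<n. deriv \<rho> (snd (\<omega> i) + e (fst (\<omega> i)) - poly_sum b \<delta> ((fst (\<omega> i) - x0) /\<^sub>R h))
            * poly_sum b \<delta> ((fst (\<omega> i) - x0) /\<^sub>R h) * K ((fst (\<omega> i) - x0) /\<^sub>R h)) < 0)"
proof -
  let ?P = "multi_indices b :: ('d \<Rightarrow> nat) set"
  obtain \<gamma> h0 where h0_le: "h0 \<le> 1" and \<gamma>: "0 < \<gamma>" and h0: "0 < h0"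
    and K_mean: "\<And>i h. 0 < h \<Longrightarrow> h \<le> h0 \<Longrightarrow> (LINT w|obs_law g i. K ((fst w - x0) /\<^sub>R h)) \<le> h ^ CARD('d)"
    and drift: "\<And>i h e \<epsilon> \<delta> \<eta>. 0 < h \<Longrightarrow> h \<le> h0 \<Longrightarrow> e \<in> borel_measurable (restrict_space lborel unit_cube) \<Longrightarrow>
      (\<forall>x\<in>unit_cube. K ((x - x0) /\<^sub>R h) \<noteq> 0 \<longrightarrow> \<bar>e x\<bar> \<le> \<epsilon>) \<Longrightarrow>
      (\<Sum>p\<in>?P. \<bar>\<delta> p\<bar>) \<le> A \<Longrightarrow>
      (\<Sum>p\<in>?P. \<delta> p * (LINT w|obs_law g i. score \<rho> K b x0 h e \<eta> p w)) \<le>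
        h ^ CARD('d) * (- \<gamma> * (\<Sum>p\<in>?P. \<bar>\<delta> p\<bar>)\<^sup>2
          + (\<Sum>p\<in>?P. \<bar>\<delta> p\<bar>) * (max \<epsilon> 0 + (\<Sum>p\<in>?P. \<bar>\<delta> p - \<eta> p\<bar>)))"
    by (rule score_drift[OF \<rho> g c A x0 K cone, of b]) (rule that)
  obtain B where B: "0 < B" "\<And>x. \<bar>deriv \<rho> x\<bar> \<le> B" using contrast_deriv_bounded[OF \<rho>] by auto
  have K0: "\<And>z. 0 \<le> K z" and [measurable]: "K \<in> borel_measurable borel"
    using K borel_measurable_integrable[of lborel K] by (auto simp: smoothing_kernel_def)
  obtain k where k: "0 < k" "\<And>z. K z \<le> k"
    using smoothing_kernel_bound[OF K] by blast
  have K_supp: "\<bar>z $ j\<bar> \<le> 1" if "K z \<noteq> 0" for z j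
    using smoothing_kernel_supp[OF K that, of j] by simp
  \<comment> \<open>Share of the fluctuations in the drift \<open>\<gamma> * s\<close>: one quarter
    goes to them, one quarter to the net, and one half to the bias through
    \<open>a1 = 2 / \<gamma>\<close>. The cap at 1 helps in the condition on
    \<open>\<tau>\<close>.\<close>
  define \<kappa> where "\<kappa> = min (\<gamma> / 4) 1"
  have \<kappa>: "0 < \<kappa>" "\<kappa> \<le> 1" "\<kappa> \<le> \<gamma> / 4" using \<gamma> by (auto simp: \<kappa>_def)
  \<comment> \<open>The net error is paid once in the expected score and \<open>1 + A\<close> times
    in the empirical one, where it is multiplied by the sum of the kernel weights.\<close>
  define m where "m = \<gamma> / (4 * (2 + A))"
  have m: "0 < m" "m * (2 + A) = \<gamma> / 4" using \<gamma> A by (auto simp: m_def field_simps)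
  obtain N where N: "finite N" "\<And>t :: ('d \<Rightarrow> nat) \<Rightarrow> real. (\<Sum>p\<in>?P. \<bar>t p\<bar>) \<le> 1 \<Longrightarrow> \<exists>s\<in>N. (\<Sum>p\<in>?P. \<bar>t p - s p\<bar>) \<le> m"
    using finite_l1_net[OF finite_multi_indices m(1)] by metis
  define a where "a = (B + 1) * k"
  \<comment> \<open>The first part bounds the second moments of the family \<open>F\<close> up to
    the factor \<open>h^d\<close>; the part \<open>A * a\<close> ensures
    \<open>\<tau> * a \<le> 2\<close> for every \<open>s \<le> A\<close>.\<close>
  define Cv where "Cv = (B\<^sup>2 + 1) * k + A * a"
  have a: "0 < a" "B * k \<le> a" "k \<le> a" using B k by (auto simp: a_def algebra_simps add_pos_pos)
  have Cv: "0 < Cv" "B\<^sup>2 * k \<le> Cv" "k \<le> Cv" "A * a \<le> Cv"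
    using A k a B by (auto simp: Cv_def algebra_simps intro!: add_pos_pos add_nonneg_nonneg)
  define C where "C = 2 * real (card N * card ?P + 1)"
  define c1 where "c1 = \<kappa>\<^sup>2 / (4 * Cv)"
  show ?thesis
  proof (rule that[of C c1 "2 / \<gamma>" h0])
    fix n :: nat and h \<epsilon> s :: real and e :: "real ^ 'd \<Rightarrow> real"
    assume n: "1 \<le> n" and h: "0 < h" "h \<le> h0" and e: "e \<in> borel_measurable (restrict_space lborel unit_cube)"
      and e_le: "\<forall>x\<in>unit_cube. K ((x - x0) /\<^sub>R h) \<noteq> 0 \<longrightarrow> \<bar>e x\<bar> \<le> \<epsilon>"
      and \<epsilon>: "0 \<le> \<epsilon>" and s: "2 / \<gamma> * \<epsilon> < s" "s \<le> A"
    let ?L = "Pi\<^sub>M {..<n} (obs_law g) :: (nat \<Rightarrow> (real ^ 'd) \<times> real) measure"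
    define H where "H = h ^ CARD('d)"
    have H: "0 < H" using h by (simp add: H_def)
    have "0 \<le> 2 / \<gamma> * \<epsilon>" using \<gamma> \<epsilon> by simp
    then have s0: "0 < s" using s(1) by linarith
    have s\<epsilon>: "\<epsilon> < \<gamma> * s / 2" using s(1) \<gamma> by (simp add: field_simps)
    define u where "u x = (x - x0) /\<^sub>R h" for x
    define Kf where "Kf w = K (u (fst w))" for w :: "(real ^ 'd) \<times> real"
    define sc where "sc \<eta> p = score \<rho> K b x0 h e (\<lambda>q. s * \<eta> q) p" for \<eta> p
    \<comment> \<open>Besides the scores at the scaled net points, \<open>F\<close> contains the
      kernel weight itself, whose sum controls the error of passing to the net.\<close>
    define F where "F = insert Kf ((\<lambda>(\<eta>, p). sc \<eta> p) ` (N \<times> ?P))"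
    \<comment> \<open>Chosen so that the threshold \<open>\<tau> * (real n * v)\<close> is
      \<open>\<kappa> * s * (real n * H)\<close>, a fixed fraction of the drift.\<close>
    define \<tau> where "\<tau> = \<kappa> * s / Cv"
    define v where "v = Cv * H"
    have [measurable]: "(\<lambda>w. u (fst w)) \<in> obs_law g i \<rightarrow>\<^sub>M borel" for i
      unfolding u_def by measurable
    have Kf_meas: "Kf \<in> borel_measurable (obs_law g i)" for i unfolding Kf_def by measurable
    have Kf: "0 \<le> Kf w" "Kf w \<le> k" for w using K0 k by (auto simp: Kf_def)
    have Kf_mean: "(LINT w|obs_law g i. Kf w) \<le> H" for i
      using K_mean[OF h] by (simp add: Kf_def u_def H_def)
    have Kf_int: "integrable (obs_law g i) Kf" for i
      by (rule integral_obs_law(1)[OF g Kf_meas, where a = k]) (use Kf in auto)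
    have sc_meas: "sc \<eta> p \<in> borel_measurable (obs_law g i)" for \<eta> p i
      unfolding sc_def by (rule score_measurable[OF \<rho> K e])
    have sc_le: "\<bar>sc \<eta> p w\<bar> \<le> B * Kf w" for \<eta> p w
    proof (cases "Kf w = 0")
      case False
      then have "\<bar>monomial p (u (fst w))\<bar> \<le> 1"
        using K_supp by (intro abs_monomial_le_1) (auto simp: Kf_def)
      then have "\<bar>sc \<eta> p w\<bar> \<le> B * 1 * Kf w"
        unfolding sc_def score_def abs_mult u_def[symmetric] Kf_def using B K0
        by (intro mult_mono) (auto simp: abs_of_nonneg)
      then show ?thesis by simp
    qed (simp add: sc_def score_def u_def[symmetric] Kf_def)
    have sc_le': "\<bar>sc \<eta> p w\<bar> \<le> B * k" for \<eta> p w
      using sc_le[of \<eta> p w] mult_left_mono[OF Kf(2)[of w], of B] B by linarith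
    have F_meas: "f \<in> borel_measurable (obs_law g i)" if "f \<in> F" for f i
      using that Kf_meas sc_meas by (auto simp: F_def)
    have F_bd: "\<bar>f w\<bar> \<le> a" if "f \<in> F" for f w
      using that a Kf[of w] by (auto simp: F_def intro: order_trans[OF sc_le'])
    have F_var: "(LINT w|obs_law g i. (f w)\<^sup>2) \<le> v" if f: "f \<in> F" for f i
    proof -
      define q where "q = max (B\<^sup>2 * k) k"
      have q: "0 < q" "q \<le> Cv" using k Cv by (simp_all add: q_def less_max_iff_disj)
      have sq: "(f w)\<^sup>2 \<le> q * Kf w" for w
      proof -
        have "\<bar>f w\<bar> \<le> B * Kf w \<or> \<bar>f w\<bar> \<le> Kf w"
          using f sc_le[of _ _ w] Kf(1)[of w] by (auto simp: F_def)
        then have "(f w)\<^sup>2 \<le> (B * Kf w)\<^sup>2 \<or> (f w)\<^sup>2 \<le> (Kf w)\<^sup>2"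
          by (metis abs_ge_zero power2_abs power_mono)
        moreover have "(Kf w)\<^sup>2 \<le> k * Kf w"
          unfolding power2_eq_square using Kf by (intro mult_right_mono)
        moreover from this have "(B * Kf w)\<^sup>2 \<le> (B\<^sup>2 * k) * Kf w"
          by (simp add: power_mult_distrib mult.assoc mult_left_mono)
        moreover have "(B\<^sup>2 * k) * Kf w \<le> q * Kf w" "k * Kf w \<le> q * Kf w"
          using Kf[of w] by (auto intro!: mult_right_mono simp: q_def)
        ultimately show ?thesis by linarith
      qed
      have "(LINT w|obs_law g i. (f w)\<^sup>2) \<le> (LINT w|obs_law g i. q * Kf w)"
      proof (rule integral_mono)
        show "integrable (obs_law g i) (\<lambda>w. (f w)\<^sup>2)"
        proof (rule integral_obs_law(1)[OF g, where a = "q * k"])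
          show "(\<lambda>w. (f w)\<^sup>2) \<in> borel_measurable (obs_law g i)" using F_meas[OF f] by simp
          show "\<bar>(f w)\<^sup>2\<bar> \<le> q * k" for w
            using order_trans[OF sq[of w] mult_left_mono[OF Kf(2)[of w], of q]] q by simp
        qed
      qed (use Kf_int sq in auto)
      also have "\<dots> \<le> q * H" using Kf_mean[of i] q by simp
      also have "\<dots> \<le> v" unfolding v_def using q H by simp
      finally show ?thesis .
    qed
    have \<tau>: "0 \<le> \<tau>" "\<tau> * a \<le> 2"
    proof -
      show "0 \<le> \<tau>" using \<kappa> s0 Cv by (simp add: \<tau>_def)
      have "\<kappa> * s * a \<le> 1 * A * a" using \<kappa> s s0 a A by (intro mult_mono) auto
      also have "\<dots> \<le> 2 * Cv" using Cv by simp
      finally show "\<tau> * a \<le> 2" using Cv by (simp add: \<tau>_def field_simps)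
    qed
    have fin: "finite F" unfolding F_def using N(1) by simp
    have card: "card F \<le> card N * card ?P + 1"
    proof -
      have "card F \<le> card ((\<lambda>(\<eta>, p). sc \<eta> p) ` (N \<times> ?P)) + 1"
        unfolding F_def using N(1) by (simp add: card_insert_if)
      also have "\<dots> \<le> card (N \<times> ?P) + 1" using N(1) by (intro add_mono card_image_le) auto
      finally show ?thesis by (simp add: card_cartesian_product)
    qed
    define Bd where "Bd = {\<omega> \<in> space ?L. \<exists>f\<in>F. \<tau> * (real n * v) < \<bar>(\<Sum>i<n. f (\<omega> i)) - (\<Sum>i<n. LINT x|obs_law g i. f x)\<bar>}"
    have \<tau>nv: "\<tau> * (real n * v) = \<kappa> * s * (real n * H)" using Cv by (simp add: \<tau>_def v_def)
    have Bd_sets: "Bd \<in> sets ?L"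
      unfolding Bd_def by (rule chernoff_PiM_family(1)) (rule prob_space_obs_law[OF g] fin F_meas F_bd F_var \<tau>, assumption?)+
    have Bd_le: "emeasure ?L Bd \<le> ennreal (2 * real (card F) * exp (- (\<tau>\<^sup>2 * (real n * v) / 4)))"
      unfolding Bd_def by (rule chernoff_PiM_family(2)) (rule prob_space_obs_law[OF g] fin F_meas F_bd F_var \<tau>, assumption?)+
    show "\<exists>Bd\<in>sets (design_noise_law n g).
        emeasure (design_noise_law n g) Bd \<le> ennreal (C * exp (- (c1 * s\<^sup>2 * (real n * h ^ CARD('d))))) \<and>
        (\<forall>\<omega>\<in>space (design_noise_law n g) - Bd. \<forall>\<delta>. (\<Sum>p\<in>?P. \<bar>\<delta> p\<bar>) = s \<longrightarrow>
          (\<Sum>i<n. deriv \<rho> (snd (\<omega> i) + e (fst (\<omega> i)) - poly_sum b \<delta> ((fst (\<omega> i) - x0) /\<^sub>R h))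
            * poly_sum b \<delta> ((fst (\<omega> i) - x0) /\<^sub>R h) * K ((fst (\<omega> i) - x0) /\<^sub>R h)) < 0)"
      unfolding design_noise_law_eq
    proof (intro bexI[of _ Bd] conjI ballI allI impI)
      show "Bd \<in> sets ?L" by (rule Bd_sets)
      note Bd_le
      also have "\<tau>\<^sup>2 * (real n * v) / 4 = c1 * s\<^sup>2 * (real n * H)"
        using Cv(1) by (simp add: \<tau>_def v_def c1_def power2_eq_square mult_ac)
      also have "ennreal (2 * real (card F) * exp (- (c1 * s\<^sup>2 * (real n * H)))) \<le> ennreal (C * exp (- (c1 * s\<^sup>2 * (real n * H))))"
        using card unfolding C_def by (intro ennreal_leI mult_right_mono) (auto simp flip: of_nat_mult of_nat_Suc)
      finally show "emeasure ?L Bd \<le> ennreal (C * exp (- (c1 * s\<^sup>2 * (real n * h ^ CARD('d)))))" by (simp add: H_def)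
    next
      fix \<omega> \<delta> assume \<omega>: "\<omega> \<in> space ?L - Bd" and \<delta>: "(\<Sum>p\<in>?P. \<bar>\<delta> p\<bar>) = s"
      have dev: "\<bar>(\<Sum>i<n. f (\<omega> i)) - (\<Sum>i<n. LINT x|obs_law g i. f x)\<bar> \<le> \<kappa> * s * (real n * H)" if "f \<in> F" for f
        using \<omega> that unfolding Bd_def \<tau>nv by (auto simp: not_less)
      have "(\<Sum>p\<in>?P. \<bar>\<delta> p / s\<bar>) \<le> 1"
        using \<delta> s0 by (simp add: abs_divide flip: sum_divide_distrib)
      then obtain \<eta> where \<eta>: "\<eta> \<in> N" "(\<Sum>p\<in>?P. \<bar>\<delta> p / s - \<eta> p\<bar>) \<le> m"
        using N(2)[of "\<lambda>p. \<delta> p / s"] by blast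
      have \<delta>\<eta>: "(\<Sum>p\<in>?P. \<bar>\<delta> p - s * \<eta> p\<bar>) \<le> s * m"
      proof -
        have "(\<Sum>p\<in>?P. \<bar>\<delta> p - s * \<eta> p\<bar>) = (\<Sum>p\<in>?P. s * \<bar>\<delta> p / s - \<eta> p\<bar>)"
        proof (intro sum.cong refl)
          fix p
          have "\<delta> p - s * \<eta> p = s * (\<delta> p / s - \<eta> p)" using s0 by (simp add: field_simps)
          then show "\<bar>\<delta> p - s * \<eta> p\<bar> = s * \<bar>\<delta> p / s - \<eta> p\<bar>" using s0 by (simp add: abs_mult)
        qed
        also have "\<dots> \<le> s * m" using \<eta>(2) s0 by (simp flip: sum_distrib_left)
        finally show ?thesis .
      qed
      let ?S = "\<Sum>i<n. deriv \<rho> (snd (\<omega> i) + e (fst (\<omega> i)) - poly_sum b \<delta> (u (fst (\<omega> i)))) * poly_sum b \<delta> (u (fst (\<omega> i))) * K (u (fst (\<omega> i)))"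
      \<comment> \<open>Only the base point moves from \<open>\<delta>\<close> to
        \<open>s \<eta>\<close>; the direction stays \<open>\<delta>\<close>. One factor
        \<open>s\<close> of the error comes from the scaled net, the other from the size of the
        polynomial in the direction \<open>\<delta>\<close>.\<close>
      have "?S \<le> (\<Sum>i<n. (\<Sum>p\<in>?P. \<delta> p * sc \<eta> p (\<omega> i)) + s\<^sup>2 * m * Kf (\<omega> i))"
      proof (rule sum_mono)
        fix i
        let ?u = "u (fst (\<omega> i))" and ?y = "snd (\<omega> i) + e (fst (\<omega> i))"
        let ?v = "poly_sum b \<delta> ?u" and ?v' = "poly_sum b (\<lambda>q. s * \<eta> q) ?u"
        have eq: "(\<Sum>p\<in>?P. \<delta> p * sc \<eta> p (\<omega> i)) = deriv \<rho> (?y - ?v') * ?v * K ?u"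
          unfolding sc_def score_lincomb u_def ..
        show "deriv \<rho> (?y - ?v) * ?v * K ?u \<le> (\<Sum>p\<in>?P. \<delta> p * sc \<eta> p (\<omega> i)) + s\<^sup>2 * m * Kf (\<omega> i)"
        proof (cases "K ?u = 0")
          case False
          have v: "\<bar>?v\<bar> \<le> s" unfolding \<delta>[symmetric] by (rule abs_poly_sum_le) (use K_supp[OF False] in auto)
          have "\<bar>?v - ?v'\<bar> \<le> s * m"
            unfolding poly_sum_diff[symmetric]
            by (rule order_trans[OF abs_poly_sum_le \<delta>\<eta>]) (use K_supp[OF False] in auto)
          then have "\<bar>deriv \<rho> (?y - ?v) - deriv \<rho> (?y - ?v')\<bar> \<le> s * m"
            using contrast_deriv_lipschitz[OF \<rho>, of "?y - ?v" "?y - ?v'"] by simp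
          then have "\<bar>(deriv \<rho> (?y - ?v) - deriv \<rho> (?y - ?v')) * ?v\<bar> \<le> (s * m) * s"
            unfolding abs_mult using v s0 m by (intro mult_mono) auto
          then have "(deriv \<rho> (?y - ?v) - deriv \<rho> (?y - ?v')) * ?v \<le> s\<^sup>2 * m"
            by (simp add: power2_eq_square mult_ac)
          then have "(deriv \<rho> (?y - ?v) - deriv \<rho> (?y - ?v')) * ?v * K ?u \<le> s\<^sup>2 * m * K ?u"
            using K0 by (rule mult_right_mono)
          then show ?thesis unfolding eq Kf_def by (simp add: algebra_simps)
        qed (simp add: eq Kf_def)
      qed
      also have "\<dots> = (\<Sum>p\<in>?P. \<delta> p * (\<Sum>i<n. sc \<eta> p (\<omega> i))) + s\<^sup>2 * m * (\<Sum>i<n. Kf (\<omega> i))"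
        by (simp add: sum.distrib sum_distrib_left) (rule sum.swap)
      \<comment> \<open>The deviations of the components are weighted by
        \<open>\<bar>\<delta> p\<bar>\<close>, which sum to \<open>s\<close>. The kernel weights sum
        to at most \<open>1 + A\<close> times \<open>real n * H\<close>, as
        \<open>\<kappa> * s \<le> A\<close>.\<close>
      also have "\<dots> \<le> ((\<Sum>p\<in>?P. \<delta> p * (\<Sum>i<n. LINT w|obs_law g i. sc \<eta> p w)) + s * (\<kappa> * s * (real n * H))) + s\<^sup>2 * m * ((1 + A) * (real n * H))"
      proof (intro add_mono mult_left_mono)
        have "(\<Sum>p\<in>?P. \<delta> p * (\<Sum>i<n. sc \<eta> p (\<omega> i))) \<le> (\<Sum>p\<in>?P. \<delta> p * (\<Sum>i<n. LINT w|obs_law g i. sc \<eta> p w) + \<bar>\<delta> p\<bar> * (\<kappa> * s * (real n * H)))"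
        proof (rule sum_mono)
          fix p assume "p \<in> ?P"
          then have "sc \<eta> p \<in> F" using \<eta>(1) by (auto simp: F_def)
          from dev[OF this] have "\<bar>\<delta> p * ((\<Sum>i<n. sc \<eta> p (\<omega> i)) - (\<Sum>i<n. LINT w|obs_law g i. sc \<eta> p w))\<bar> \<le> \<bar>\<delta> p\<bar> * (\<kappa> * s * (real n * H))"
            unfolding abs_mult by (intro mult_left_mono) auto
          then have "\<delta> p * ((\<Sum>i<n. sc \<eta> p (\<omega> i)) - (\<Sum>i<n. LINT w|obs_law g i. sc \<eta> p w)) \<le> \<bar>\<delta> p\<bar> * (\<kappa> * s * (real n * H))"
            by (rule order_trans[OF abs_ge_self])
          then show "\<delta> p * (\<Sum>i<n. sc \<eta> p (\<omega> i)) \<le> \<delta> p * (\<Sum>i<n. LINT w|obs_law g i. sc \<eta> p w) + \<bar>\<delta> p\<bar> * (\<kappa> * s * (real n * H))"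
            by (simp add: right_diff_distrib)
        qed
        also have "\<dots> = (\<Sum>p\<in>?P. \<delta> p * (\<Sum>i<n. LINT w|obs_law g i. sc \<eta> p w)) + s * (\<kappa> * s * (real n * H))"
          by (simp only: sum.distrib \<delta> flip: sum_distrib_right)
        finally show "(\<Sum>p\<in>?P. \<delta> p * (\<Sum>i<n. sc \<eta> p (\<omega> i))) \<le> (\<Sum>p\<in>?P. \<delta> p * (\<Sum>i<n. LINT w|obs_law g i. sc \<eta> p w)) + s * (\<kappa> * s * (real n * H))" .
        have "(\<Sum>i<n. Kf (\<omega> i)) \<le> (\<Sum>i<n. LINT w|obs_law g i. Kf w) + \<kappa> * s * (real n * H)"
          using dev[of Kf] by (simp add: F_def abs_le_iff)
        also have "(\<Sum>i<n. LINT w|obs_law g i. Kf w) \<le> (\<Sum>i<n. H)" by (intro sum_mono Kf_mean)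
        also have "(\<Sum>i<n. H) + \<kappa> * s * (real n * H) \<le> real n * H + 1 * A * (real n * H)"
          using \<kappa> s s0 A H by (intro add_mono mult_right_mono mult_mono) auto
        finally show "(\<Sum>i<n. Kf (\<omega> i)) \<le> (1 + A) * (real n * H)" by (simp add: algebra_simps)
      qed (use m s0 in auto)
      also have "(\<Sum>p\<in>?P. \<delta> p * (\<Sum>i<n. LINT w|obs_law g i. sc \<eta> p w)) = (\<Sum>i<n. \<Sum>p\<in>?P. \<delta> p * (LINT w|obs_law g i. sc \<eta> p w))"
        unfolding sum_distrib_left by (rule sum.swap)
      also have "\<dots> \<le> (\<Sum>i<n. H * (- \<gamma> * s\<^sup>2 + s * (\<epsilon> + s * m)))"
      proof (rule sum_mono)
        fix i
        have "(\<Sum>p\<in>?P. \<delta> p * (LINT w|obs_law g i. sc \<eta> p w)) \<le> H * (- \<gamma> * s\<^sup>2 + s * (max \<epsilon> 0 + (\<Sum>p\<in>?P. \<bar>\<delta> p - s * \<eta> p\<bar>)))"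
          using drift[OF h e e_le, of \<delta> i "\<lambda>q. s * \<eta> q"] \<delta> s(2) by (simp add: sc_def H_def)
        also have "\<dots> \<le> H * (- \<gamma> * s\<^sup>2 + s * (\<epsilon> + s * m))"
          using H s0 \<epsilon> \<delta>\<eta> by (intro mult_left_mono add_left_mono) auto
        finally show "(\<Sum>p\<in>?P. \<delta> p * (LINT w|obs_law g i. sc \<eta> p w)) \<le> H * (- \<gamma> * s\<^sup>2 + s * (\<epsilon> + s * m))" .
      qed
      also have "(\<Sum>i<n. H * (- \<gamma> * s\<^sup>2 + s * (\<epsilon> + s * m))) + s * (\<kappa> * s * (real n * H)) + s\<^sup>2 * m * ((1 + A) * (real n * H))
          = real n * H * (s * (\<epsilon> - \<gamma> * s + \<kappa> * s + m * (2 + A) * s))"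
        by (simp add: power2_eq_square algebra_simps)
      also have "\<dots> < 0"
      proof -
        have "\<kappa> * s \<le> \<gamma> / 4 * s" using \<kappa> s0 by (intro mult_right_mono) auto
        then have "\<epsilon> - \<gamma> * s + \<kappa> * s + m * (2 + A) * s < 0" unfolding m(2) using s\<epsilon> by simp
        then show ?thesis using n H s0 by (simp add: mult_pos_neg)
      qed
      finally show "(\<Sum>i<n. deriv \<rho> (snd (\<omega> i) + e (fst (\<omega> i)) - poly_sum b \<delta> ((fst (\<omega> i) - x0) /\<^sub>R h))
            * poly_sum b \<delta> ((fst (\<omega> i) - x0) /\<^sub>R h) * K ((fst (\<omega> i) - x0) /\<^sub>R h)) < 0"
        by (simp add: u_def)
    qed
  qed (use h0 h0_le \<gamma> \<kappa> Cv in \<open>auto simp: C_def c1_def\<close>)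
qed

section \<open>The risk of the estimator\<close>

text \<open>For \<open>h \<le> 1\<close> the rescaled Taylor coefficients are bounded by the
  derivatives at \<open>x0\<close>, whose suprema add up to at most \<open>M\<close>. Hence the
  radius \<open>M\<close> of the parameter set matches that of the Hoelder class.\<close>

lemma holder_class_taylor_param:
  fixes x0 :: "real ^ 'd::finite"
  assumes f: "f \<in> holder_class \<beta> L M" and \<beta>: "0 < \<beta>" and L: "0 \<le> L" and M: "0 \<le> M" and x0: "x0 \<in> unit_cube" and h: "0 < h" "h \<le> 1"
  obtains t where "t \<in> param_set (strict_floor \<beta>) M" "t (\<lambda>_. 0) = f x0"
    "\<And>x. x \<in> unit_cube \<Longrightarrow> \<bar>f x - poly_sum (strict_floor \<beta>) t ((x - x0) /\<^sub>R h)\<bar> \<le> L * norm1 (x - x0) powr \<beta>"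
proof -
  define b where "b = strict_floor \<beta>"
  let ?P = "multi_indices b :: ('d \<Rightarrow> nat) set"
  obtain D where D: "partial_derivatives b f D"
     "\<forall>p. (\<Sum>j\<in>UNIV. p j) = b \<longrightarrow> (\<forall>x\<in>unit_cube. \<forall>y\<in>unit_cube.
        \<bar>D p x - D p y\<bar> \<le> L * norm1 (x - y) powr (\<beta> - real b))"
     and DM: "(\<Sum>p\<in>?P. SUP x\<in>unit_cube. ennreal \<bar>D p x\<bar>) \<le> ennreal M"
    using f unfolding holder_class_def b_def by blast
  \<comment> \<open>The power of \<open>h\<close> compensates for the rescaled argument of the
    monomials; the restriction makes \<open>t\<close> extensional.\<close>
  define t where "t = restrict (\<lambda>p. h ^ (\<Sum>j\<in>UNIV. p j) * (D p x0 / (\<Prod>j\<in>UNIV. fact (p j)))) ?P"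
  have poly: "poly_sum b t ((x - x0) /\<^sub>R h) = taylor_poly b D x0 x" for x
    unfolding poly_sum_def taylor_poly_def
  proof (intro sum.cong refl)
    fix p assume p: "p \<in> ?P"
    have "monomial p ((x - x0) /\<^sub>R h) = inverse h ^ (\<Sum>j\<in>UNIV. p j) * monomial p (x - x0)"
      by (simp add: monomial_def power_mult_distrib prod.distrib power_sum)
    then show "t p * monomial p ((x - x0) /\<^sub>R h) = D p x0 / (\<Prod>j\<in>UNIV. fact (p j)) * monomial p (x - x0)"
      using p h by (simp add: t_def field_simps)
  qed
  have t_le: "\<bar>t p\<bar> \<le> \<bar>D p x0\<bar>" if "p \<in> ?P" for p
  proof -
    have "(1::real) \<le> (\<Prod>j\<in>UNIV. fact (p j))" by (intro prod_ge_1) (auto simp: fact_ge_1)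
    then have "\<bar>D p x0 / (\<Prod>j\<in>UNIV. fact (p j))\<bar> \<le> \<bar>D p x0\<bar> / 1"
      unfolding abs_divide by (intro divide_left_mono) auto
    moreover have "\<bar>h ^ (\<Sum>j\<in>UNIV. p j)\<bar> \<le> 1" using h by (simp add: power_le_one)
    ultimately have "\<bar>h ^ (\<Sum>j\<in>UNIV. p j)\<bar> * \<bar>D p x0 / (\<Prod>j\<in>UNIV. fact (p j))\<bar> \<le> 1 * \<bar>D p x0\<bar>"
      by (intro mult_mono) auto
    then show ?thesis using that by (simp add: t_def abs_mult)
  qed
  have "ennreal (\<Sum>p\<in>?P. \<bar>D p x0\<bar>) = (\<Sum>p\<in>?P. ennreal \<bar>D p x0\<bar>)" by (simp add: sum_ennreal)
  also have "\<dots> \<le> (\<Sum>p\<in>?P. SUP x\<in>unit_cube. ennreal \<bar>D p x\<bar>)"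
    using x0 by (intro sum_mono SUP_upper)
  also note DM
  finally have "(\<Sum>p\<in>?P. \<bar>D p x0\<bar>) \<le> M" using M by simp
  then have "(\<Sum>p\<in>?P. \<bar>t p\<bar>) \<le> M" using sum_mono[OF t_le] by (rule order_trans[rotated])
  then have "t \<in> param_set b M" by (simp add: param_set_def t_def)
  moreover have "t (\<lambda>_. 0) = f x0"
    using D(1) x0 by (simp add: t_def partial_derivatives_def)
  moreover have "\<bar>f x - poly_sum b t ((x - x0) /\<^sub>R h)\<bar> \<le> L * norm1 (x - x0) powr \<beta>" if "x \<in> unit_cube" for x
    unfolding poly unfolding b_def by (rule taylor_remainder[OF D[unfolded b_def] L \<beta> x0 that])
  ultimately show ?thesis using that unfolding b_def by blast
qed

lemma space_design_noise_law:
  "\<omega> \<in> space (design_noise_law n g) \<Longrightarrow> i < n \<Longrightarrow> fst (\<omega> i) \<in> unit_cube"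
  by (auto simp: design_noise_law_eq space_PiM space_obs_law PiE_def Pi_def mem_Times_iff)

lemma sample_map_measurable:
  fixes f :: "real ^ 'd::finite \<Rightarrow> real"
  assumes f: "f \<in> borel_measurable (restrict_space lborel unit_cube)"
  shows "(\<lambda>\<omega>. \<lambda>i\<in>{..<n}. (fst (\<omega> i), f (fst (\<omega> i)) + snd (\<omega> i))) \<in> design_noise_law n g \<rightarrow>\<^sub>M sample_space n"
  unfolding sample_space_def design_noise_law_eq
proof (rule measurable_restrict)
  fix i assume i: "i \<in> {..<n}"
  note [measurable] = f
  have comp: "(\<lambda>\<omega>. \<omega> i) \<in> Pi\<^sub>M {..<n} (obs_law g) \<rightarrow>\<^sub>M obs_law g i"
    using i by (rule measurable_component_singleton)
  have "(\<lambda>x. x) \<in> restrict_space lborel unit_cube \<rightarrow>\<^sub>M (borel :: (real ^ 'd) measure)"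
    by (rule measurable_restrict_space1) simp
  from measurable_compose[OF obs_law_measurable(1) this]
  have [measurable]: "(\<lambda>w. fst w) \<in> obs_law g i \<rightarrow>\<^sub>M (borel :: (real ^ 'd) measure)" .
  have "(\<lambda>w. (fst w, f (fst w) + snd w)) \<in> obs_law g i \<rightarrow>\<^sub>M (borel \<Otimes>\<^sub>M borel)"
    using measurable_compose[OF obs_law_measurable(1) f] by measurable
  from measurable_compose[OF comp this]
  show "(\<lambda>\<omega>. (fst (\<omega> i), f (fst (\<omega> i)) + snd (\<omega> i))) \<in> Pi\<^sub>M {..<n} (obs_law g) \<rightarrow>\<^sub>M (borel \<Otimes>\<^sub>M borel)" .
qed

lemma bandwidth_tendsto_0:
  assumes "0 < \<beta>" "0 < L"
  shows "(\<lambda>n. bandwidth \<beta> L d n) \<longlonglongrightarrow> 0"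
  unfolding bandwidth_def
proof (rule tendsto_neg_powr)
  show "- 1 / (2 * \<beta> + real d) < 0" using assms by (simp add: divide_neg_pos add_pos_nonneg)
  show "filterlim (\<lambda>n. L\<^sup>2 * real n) at_top sequentially"
    using assms by (intro filterlim_tendsto_pos_mult_at_top[OF tendsto_const _ filterlim_real_sequentially]) auto
qed

text \<open>The balance behind the bandwidth: the effective sample size \<open>n h^d\<close> is of
  the order of the inverse squared bias. At \<open>s = k h^\<beta>\<close> the exponent
  \<open>c1 s^2 n h^d\<close> becomes \<open>c1 k^2 / L^2\<close>, free of \<open>n\<close>.\<close>

lemma bandwidth_effective_size:
  assumes "0 < \<beta>" "0 < L" "1 \<le> n"
  shows "real n * bandwidth \<beta> L d n ^ d * (bandwidth \<beta> L d n powr \<beta>)\<^sup>2 = 1 / L\<^sup>2"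
proof -
  let ?h = "bandwidth \<beta> L d n"
  have pos: "0 < L\<^sup>2 * real n" using assms by simp
  then have h: "0 < ?h" using assms by (simp add: bandwidth_def)
  have "?h ^ d * (?h powr \<beta>)\<^sup>2 = ?h powr (2 * \<beta> + real d)"
    using h by (simp add: powr_realpow[symmetric] powr_powr powr_add[symmetric] algebra_simps)
  also have "\<dots> = (L\<^sup>2 * real n) powr (- 1)"
    unfolding bandwidth_def powr_powr using assms by (simp add: add_pos_nonneg less_imp_neq[symmetric])
  also have "\<dots> = 1 / (L\<^sup>2 * real n)" using pos by (simp add: powr_minus_divide)
  finally show ?thesis using assms by (simp add: mult.assoc field_simps)
qed

lemma bandwidth_powr_rate:
  assumes "0 < \<beta>" "0 < L" "1 \<le> n"
  shows "bandwidth \<beta> L d n powr \<beta> = (L\<^sup>2) powr (- \<beta> / (2 * \<beta> + real d)) * rate \<beta> d n"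
  using assms by (simp add: bandwidth_def rate_def powr_powr powr_mult)

theorem theorem1:
  fixes \<beta> L M c :: real
    and x\<^sub>0 :: "real ^ 'd::finite"
    and K :: "real ^ 'd \<Rightarrow> real"
    and \<rho> :: "real \<Rightarrow> real"
    and g :: "nat \<Rightarrow> real \<Rightarrow> real"
    and \<theta> :: "nat \<Rightarrow> (nat \<Rightarrow> (real ^ 'd) \<times> real) \<Rightarrow> ('d \<Rightarrow> nat) \<Rightarrow> real"
  assumes "\<beta> > 0" and "L > 0" and "M > 0" and "c > 0"
    and "x\<^sub>0 \<in> unit_cube"
    and "smoothing_kernel K" and "kernel_charges_cube K x\<^sub>0"
    and "contrast_function g \<rho>"
    and "g \<in> noise_class \<rho> c"
    and "\<And>n. n \<ge> 1 \<Longrightarrow>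
           rho_lpa \<rho> K (strict_floor \<beta>) M x\<^sub>0 (bandwidth \<beta> L CARD('d) n) n (\<theta> n)"
  shows "\<forall>r::real. r \<ge> 1 \<longrightarrow>
     limsup (\<lambda>n. ennreal (rate \<beta> CARD('d) n powr (- r)) *
       (SUP f\<in>holder_class \<beta> L M.
          \<integral>\<^sup>+ z. ennreal (\<bar>\<theta> n z (\<lambda>_. 0) - f x\<^sub>0\<bar> powr r) \<partial>sample_law n g f)) < \<infinity>"
proof (intro allI impI)
  fix r :: real assume r: "1 \<le> r"
  let ?b = "strict_floor \<beta>" and ?d = "CARD('d)"
  let ?P = "multi_indices ?b :: ('d \<Rightarrow> nat) set"
  let ?h = "\<lambda>n. bandwidth \<beta> L ?d n"
  have A: "0 < 2 * M" using assms by simp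
  obtain C c1 a1 h0 where h0_le: "h0 \<le> 1" and h0: "0 < h0" and C: "0 \<le> C" and c1: "0 < c1" and a1: "0 < a1"
    and tail: "\<And>n h e \<epsilon> s. 1 \<le> n \<Longrightarrow> 0 < h \<Longrightarrow> h \<le> h0 \<Longrightarrow> e \<in> borel_measurable (restrict_space lborel unit_cube) \<Longrightarrow>
      (\<forall>x\<in>unit_cube. K ((x - x\<^sub>0) /\<^sub>R h) \<noteq> 0 \<longrightarrow> \<bar>e x\<bar> \<le> \<epsilon>) \<Longrightarrow> 0 \<le> \<epsilon> \<Longrightarrow> a1 * \<epsilon> < s \<Longrightarrow> s \<le> 2 * M \<Longrightarrow>
      \<exists>Bd\<in>sets (design_noise_law n g).
        emeasure (design_noise_law n g) Bd \<le> ennreal (C * exp (- (c1 * s\<^sup>2 * (real n * h ^ ?d)))) \<and>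
        (\<forall>\<omega>\<in>space (design_noise_law n g) - Bd. \<forall>\<delta>. (\<Sum>p\<in>?P. \<bar>\<delta> p\<bar>) = s \<longrightarrow>
          (\<Sum>i<n. deriv \<rho> (snd (\<omega> i) + e (fst (\<omega> i)) - poly_sum ?b \<delta> ((fst (\<omega> i) - x\<^sub>0) /\<^sub>R h))
            * poly_sum ?b \<delta> ((fst (\<omega> i) - x\<^sub>0) /\<^sub>R h) * K ((fst (\<omega> i) - x\<^sub>0) /\<^sub>R h)) < 0)"
  proof (rule score_negative_tail[OF assms(8,9,4) A assms(5,6,7), of ?b], goal_cases)
    case (1 C c1 a1 h0)
    show ?case by (rule 1(1)[OF 1(6,5,2,3,4)]) (rule 1(7))
  qed
  \<comment> \<open>Where the rescaled kernel is nonzero the l1 distance to \<open>x\<^sub>0\<close>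
    is at most \<open>d h\<close>, so the bias is at most
    \<open>L * D * h powr \<beta>\<close>.\<close>
  define D where "D = real ?d powr \<beta>"
  define q where "q = (L\<^sup>2) powr (- \<beta> / (2 * \<beta> + real ?d))"
  have D: "0 < D" by (simp add: D_def)
  have q: "0 < q" using assms by (simp add: q_def)
  have c: "0 < c1 / L\<^sup>2" using c1 assms by simp
  have r0: "0 \<le> r" using r by simp
  \<comment> \<open>In units of \<open>h powr \<beta>\<close> the tail estimate is valid strictly
    above \<open>a1 * L * D\<close>; the summand 1 secures strictness.\<close>
  obtain R where R: "0 \<le> R"
    and moment: "\<And>(\<Omega> :: (nat \<Rightarrow> (real ^ 'd) \<times> real) measure) T. prob_space \<Omega> \<Longrightarrow> T \<in> borel_measurable \<Omega> \<Longrightarrow> \<forall>x. 0 \<le> T x \<Longrightarrow>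
      \<forall>k::nat. a1 * L * D + 1 \<le> real k \<longrightarrow> emeasure \<Omega> {x \<in> space \<Omega>. real k < T x} \<le> ennreal (C * exp (- (c1 / L\<^sup>2 * (real k)\<^sup>2))) \<Longrightarrow>
      (\<integral>\<^sup>+x. ennreal (T x powr r) \<partial>\<Omega>) \<le> ennreal R"
    by (rule moment_bound_from_gaussian_tail[OF c C r0, where a = "a1 * L * D + 1"]) (rule that)
  have risk: "(\<integral>\<^sup>+ z. ennreal (\<bar>\<theta> n z (\<lambda>_. 0) - f x\<^sub>0\<bar> powr r) \<partial>sample_law n g f) \<le> ennreal ((?h n powr \<beta>) powr r * R)"
    if n: "1 \<le> n" and h_le: "?h n \<le> h0" and f: "f \<in> holder_class \<beta> L M" for n and f :: "real ^ 'd \<Rightarrow> real"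
  proof -
    define h where "h = ?h n"
    have h: "0 < h" "h \<le> h0" "h \<le> 1" using n assms h_le h0_le by (auto simp: h_def bandwidth_def)
    let ?\<Omega> = "design_noise_law n g :: (nat \<Rightarrow> (real ^ 'd) \<times> real) measure"
    let ?u = "\<lambda>x. (x - x\<^sub>0) /\<^sub>R h"
    define Z where "Z \<omega> = (\<lambda>i\<in>{..<n}. (fst (\<omega> i), f (fst (\<omega> i)) + snd (\<omega> i)))" for \<omega> :: "nat \<Rightarrow> (real ^ 'd) \<times> real"
    have f_meas: "f \<in> borel_measurable (restrict_space lborel unit_cube)"
    proof -
      have "f \<in> borel_measurable (restrict_space borel unit_cube)"
        using holder_class_continuous[OF f] assms by (intro borel_measurable_continuous_on_restrict) auto
      moreover have "sets (restrict_space lborel unit_cube) = sets (restrict_space borel (unit_cube :: (real ^ 'd) set))"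
        by (rule sets_restrict_space_cong) simp
      ultimately show ?thesis by (simp cong: measurable_cong_sets)
    qed
    have Z_meas: "Z \<in> ?\<Omega> \<rightarrow>\<^sub>M sample_space n"
      unfolding Z_def by (rule sample_map_measurable[OF f_meas])
    have prob: "prob_space ?\<Omega>"
      unfolding design_noise_law_eq by (intro prob_space_PiM prob_space_obs_law[OF assms(9)])
    have lpa: "rho_lpa \<rho> K ?b M x\<^sub>0 h n (\<theta> n)" unfolding h_def by (rule assms(10)[OF n])
    then have \<theta>_meas: "(\<lambda>z. \<theta> n z (\<lambda>_. 0)) \<in> borel_measurable (sample_space n)" by (simp add: rho_lpa_def)
    obtain t where t: "t \<in> param_set ?b M" "t (\<lambda>_. 0) = f x\<^sub>0"
      "\<And>x. x \<in> unit_cube \<Longrightarrow> \<bar>f x - poly_sum ?b t (?u x)\<bar> \<le> L * norm1 (x - x\<^sub>0) powr \<beta>"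
      using holder_class_taylor_param[OF f assms(1) _ _ assms(5) h(1,3)] assms(2,3) by (metis less_imp_le)
    define e where "e x = f x - poly_sum ?b t (?u x)" for x
    define \<epsilon> where "\<epsilon> = L * D * h powr \<beta>"
    have e_meas: "e \<in> borel_measurable (restrict_space lborel unit_cube)"
      unfolding e_def using f_meas measurable_compose[OF rescale_measurable poly_sum_measurable] by measurable
    have e_le: "\<forall>x\<in>unit_cube. K (?u x) \<noteq> 0 \<longrightarrow> \<bar>e x\<bar> \<le> \<epsilon>"
    proof (intro ballI impI)
      fix x :: "real ^ 'd" assume x: "x \<in> unit_cube" "K (?u x) \<noteq> 0"
      have "\<bar>(x - x\<^sub>0) $ j\<bar> \<le> h" for j
      proof -
        have "\<bar>(x - x\<^sub>0) $ j\<bar> = h * \<bar>?u x $ j\<bar>" using h by (simp add: abs_mult)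
        also have "\<dots> \<le> h * 1"
          using smoothing_kernel_supp[OF assms(6) x(2), of j] h by (intro mult_left_mono) auto
        finally show ?thesis by simp
      qed
      then have "norm1 (x - x\<^sub>0) \<le> (\<Sum>j\<in>(UNIV :: 'd set). h)" unfolding norm1_def by (rule sum_mono)
      then have "norm1 (x - x\<^sub>0) powr \<beta> \<le> (real ?d * h) powr \<beta>"
        using norm1_nonneg assms by (intro powr_mono2) auto
      then have "L * norm1 (x - x\<^sub>0) powr \<beta> \<le> \<epsilon>"
        using assms h by (simp add: \<epsilon>_def D_def powr_mult mult.assoc)
      then show "\<bar>e x\<bar> \<le> \<epsilon>" using t(3)[OF x(1)] unfolding e_def by linarith
    qed
    have \<epsilon>: "0 \<le> \<epsilon>" using assms D by (simp add: \<epsilon>_def)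
    have dev: "emeasure ?\<Omega> {\<omega> \<in> space ?\<Omega>. s < \<bar>\<theta> n (Z \<omega>) (\<lambda>_. 0) - f x\<^sub>0\<bar>} \<le> ennreal (C * exp (- (c1 * s\<^sup>2 * (real n * h ^ ?d))))"
      (is "emeasure _ ?E \<le> _") if s: "a1 * \<epsilon> < s" for s
    proof -
      have s0: "0 < s" using s \<epsilon> a1 by (meson le_less_trans mult_nonneg_nonneg less_imp_le)
      define \<Delta> where "\<Delta> \<omega> p = \<theta> n (Z \<omega>) p - t p" for \<omega> p
      have E: "\<exists>\<sigma>. \<sigma> = (\<Sum>p\<in>?P. \<bar>\<Delta> \<omega> p\<bar>) \<and> s < \<sigma> \<and> \<sigma> \<le> 2 * M \<and>
          is_arg_min (rho_criterion \<rho> K ?b x\<^sub>0 h n (Z \<omega>)) (\<lambda>t. t \<in> param_set ?b M) (\<theta> n (Z \<omega>))"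
        if \<omega>: "\<omega> \<in> ?E" for \<omega>
      proof (intro exI conjI)
        have "Z \<omega> \<in> space (sample_space n)" using \<omega> measurable_space[OF Z_meas] by blast
        then show min: "is_arg_min (rho_criterion \<rho> K ?b x\<^sub>0 h n (Z \<omega>)) (\<lambda>t. t \<in> param_set ?b M) (\<theta> n (Z \<omega>))"
          using lpa by (simp add: rho_lpa_def)
        have "\<bar>\<Delta> \<omega> (\<lambda>_. 0)\<bar> \<le> (\<Sum>p\<in>?P. \<bar>\<Delta> \<omega> p\<bar>)" by (rule member_le_sum) auto
        then show "s < (\<Sum>p\<in>?P. \<bar>\<Delta> \<omega> p\<bar>)" using \<omega> t(2) by (auto simp: \<Delta>_def)
        have "(\<Sum>p\<in>?P. \<bar>\<Delta> \<omega> p\<bar>) \<le> (\<Sum>p\<in>?P. \<bar>\<theta> n (Z \<omega>) p\<bar>) + (\<Sum>p\<in>?P. \<bar>t p\<bar>)"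
          unfolding \<Delta>_def sum.distrib[symmetric] by (intro sum_mono abs_triangle_ineq4)
        also have "\<dots> \<le> M + M"
          using min t(1) by (intro add_mono) (auto simp: is_arg_min_def param_set_def)
        finally show "(\<Sum>p\<in>?P. \<bar>\<Delta> \<omega> p\<bar>) \<le> 2 * M" by simp
      qed simp
      show ?thesis
      \<comment> \<open>Beyond \<open>2 * M\<close> the event is empty, since both parameters have
        norm at most \<open>M\<close>; up to there the tail estimate applies.\<close>
      proof (cases "s \<le> 2 * M")
        case True
        obtain Bd where Bd: "Bd \<in> sets ?\<Omega>" "emeasure ?\<Omega> Bd \<le> ennreal (C * exp (- (c1 * s\<^sup>2 * (real n * h ^ ?d))))"
          "\<And>\<omega> \<delta>. \<omega> \<in> space ?\<Omega> - Bd \<Longrightarrow> (\<Sum>p\<in>?P. \<bar>\<delta> p\<bar>) = s \<Longrightarrow>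
            (\<Sum>i<n. deriv \<rho> (snd (\<omega> i) + e (fst (\<omega> i)) - poly_sum ?b \<delta> (?u (fst (\<omega> i))))
              * poly_sum ?b \<delta> (?u (fst (\<omega> i))) * K (?u (fst (\<omega> i)))) < 0"
          using tail[OF n h(1,2) e_meas e_le \<epsilon> s True] by blast
        have "?E \<subseteq> Bd"
        proof (rule subsetI, rule ccontr)
          fix \<omega> assume \<omega>: "\<omega> \<in> ?E" "\<omega> \<notin> Bd"
          obtain \<sigma> where \<sigma>: "\<sigma> = (\<Sum>p\<in>?P. \<bar>\<Delta> \<omega> p\<bar>)" "s < \<sigma>"
            and min: "is_arg_min (rho_criterion \<rho> K ?b x\<^sub>0 h n (Z \<omega>)) (\<lambda>t. t \<in> param_set ?b M) (\<theta> n (Z \<omega>))"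
            using E[OF \<omega>(1)] by blast
          \<comment> \<open>The error is shrunk to norm exactly \<open>s\<close>, with ratio
            \<open>s / \<sigma> < 1\<close>. The resulting score is nonnegative by minimality and
            negative off \<open>Bd\<close>, a contradiction.\<close>
          define \<delta> where "\<delta> p = s / \<sigma> * \<Delta> \<omega> p" for p
          have cube: "fst (\<omega> i) \<in> unit_cube" if "i < n" for i
            using \<omega>(1) that by (intro space_design_noise_law) auto
          have "0 \<le> (\<Sum>i<n. deriv \<rho> (snd (Z \<omega> i) - poly_sum ?b t (?u (fst (Z \<omega> i))) - poly_sum ?b \<delta> (?u (fst (Z \<omega> i))))
              * poly_sum ?b \<delta> (?u (fst (Z \<omega> i))) * K (?u (fst (Z \<omega> i))))"
            unfolding \<delta>_def \<Delta>_def
            by (rule minimizer_score_nonneg[OF assms(8,6) h(1) n min t(1)])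
               (use cube s0 \<sigma>(2) in \<open>auto simp: Z_def\<close>)
          also have "\<dots> = (\<Sum>i<n. deriv \<rho> (snd (\<omega> i) + e (fst (\<omega> i)) - poly_sum ?b \<delta> (?u (fst (\<omega> i))))
              * poly_sum ?b \<delta> (?u (fst (\<omega> i))) * K (?u (fst (\<omega> i))))"
            by (intro sum.cong refl) (simp add: Z_def e_def algebra_simps)
          also have "\<dots> < 0"
          proof (rule Bd(3))
            show "\<omega> \<in> space ?\<Omega> - Bd" using \<omega> by blast
            have "(\<Sum>p\<in>?P. \<bar>\<delta> p\<bar>) = s / \<sigma> * \<sigma>"
              using s0 \<sigma>(2) unfolding \<sigma>(1) \<delta>_def by (simp add: abs_mult sum_distrib_left abs_divide)
            then show "(\<Sum>p\<in>?P. \<bar>\<delta> p\<bar>) = s" using s0 \<sigma>(2) by simp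
          qed
          finally show False by simp
        qed
        then show ?thesis using emeasure_mono[OF _ Bd(1)] Bd(2) by (meson order_trans)
      next
        case False
        then have "?E = {}" using E by fastforce
        then show ?thesis by (simp only: emeasure_empty zero_le)
      qed
    qed
    define H where "H = h powr \<beta>"
    have H: "0 < H" using h by (simp add: H_def)
    \<comment> \<open>The error in units of the rate; its tails, hence its moments, are bounded
      independently of \<open>n\<close> and \<open>f\<close>.\<close>
    define T where "T \<omega> = \<bar>\<theta> n (Z \<omega>) (\<lambda>_. 0) - f x\<^sub>0\<bar> / H" for \<omega>
    have T_meas: "T \<in> borel_measurable ?\<Omega>"
      unfolding T_def using measurable_compose[OF Z_meas \<theta>_meas] by measurable
    have T0: "\<forall>\<omega>. 0 \<le> T \<omega>" using H by (simp add: T_def)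
    have "(\<integral>\<^sup>+\<omega>. ennreal (T \<omega> powr r) \<partial>?\<Omega>) \<le> ennreal R"
    proof (rule moment[OF prob T_meas T0], intro allI impI)
      fix k :: nat assume k: "a1 * L * D + 1 \<le> real k"
      have "a1 * \<epsilon> = a1 * L * D * H" by (simp add: \<epsilon>_def H_def)
      also have "\<dots> < real k * H" using k H by (intro mult_strict_right_mono) auto
      finally have "a1 * \<epsilon> < real k * H" .
      from dev[OF this]
      have "emeasure ?\<Omega> {\<omega> \<in> space ?\<Omega>. real k < T \<omega>} \<le> ennreal (C * exp (- (c1 * (real k * H)\<^sup>2 * (real n * h ^ ?d))))"
        using H by (simp add: T_def pos_less_divide_eq)
      also have "c1 * (real k * H)\<^sup>2 * (real n * h ^ ?d) = c1 * (real k)\<^sup>2 * (real n * h ^ ?d * H\<^sup>2)"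
        by (simp add: power_mult_distrib mult_ac)
      also have "real n * h ^ ?d * H\<^sup>2 = 1 / L\<^sup>2"
        unfolding h_def H_def by (rule bandwidth_effective_size[OF assms(1,2) n])
      finally show "emeasure ?\<Omega> {\<omega> \<in> space ?\<Omega>. real k < T \<omega>} \<le> ennreal (C * exp (- (c1 / L\<^sup>2 * (real k)\<^sup>2)))"
        by (simp add: mult_ac)
    qed
    then have T_le: "ennreal (H powr r) * (\<integral>\<^sup>+\<omega>. ennreal (T \<omega> powr r) \<partial>?\<Omega>) \<le> ennreal (H powr r) * ennreal R"
      by (rule mult_left_mono) simp
    have "(\<integral>\<^sup>+ z. ennreal (\<bar>\<theta> n z (\<lambda>_. 0) - f x\<^sub>0\<bar> powr r) \<partial>sample_law n g f)
        = (\<integral>\<^sup>+ \<omega>. ennreal (\<bar>\<theta> n (Z \<omega>) (\<lambda>_. 0) - f x\<^sub>0\<bar> powr r) \<partial>?\<Omega>)"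
      unfolding sample_law_def Z_def[symmetric]
    proof (rule nn_integral_distr[OF Z_meas])
      note [measurable] = \<theta>_meas
      show "(\<lambda>z. ennreal (\<bar>\<theta> n z (\<lambda>_. 0) - f x\<^sub>0\<bar> powr r)) \<in> borel_measurable (distr ?\<Omega> (sample_space n) Z)"
        unfolding measurable_distr_eq1 by measurable
    qed
    also have "\<dots> = (\<integral>\<^sup>+ \<omega>. ennreal (H powr r) * ennreal (T \<omega> powr r) \<partial>?\<Omega>)"
      using H by (intro nn_integral_cong) (simp add: T_def powr_divide flip: ennreal_mult)
    also have "\<dots> = ennreal (H powr r) * (\<integral>\<^sup>+\<omega>. ennreal (T \<omega> powr r) \<partial>?\<Omega>)"
      using T_meas by (intro nn_integral_cmult) measurable
    also note T_le
    finally show ?thesis using R by (simp add: H_def h_def ennreal_mult)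
  qed
  have "\<forall>\<^sub>F n in sequentially. ?h n < h0"
    using order_tendstoD(2)[OF bandwidth_tendsto_0[OF assms(1,2)] h0] .
  then have "\<forall>\<^sub>F n in sequentially. ennreal (rate \<beta> ?d n powr (- r)) *
       (SUP f\<in>holder_class \<beta> L M. \<integral>\<^sup>+ z. ennreal (\<bar>\<theta> n z (\<lambda>_. 0) - f x\<^sub>0\<bar> powr r) \<partial>sample_law n g f)
       \<le> ennreal (q powr r * R)"
    using eventually_ge_at_top[of 1]
  proof eventually_elim
    case (elim n)
    have rate: "0 < rate \<beta> ?d n" using elim by (simp add: rate_def)
    have "(SUP f\<in>holder_class \<beta> L M. \<integral>\<^sup>+ z. ennreal (\<bar>\<theta> n z (\<lambda>_. 0) - f x\<^sub>0\<bar> powr r) \<partial>sample_law n g f)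
        \<le> ennreal ((?h n powr \<beta>) powr r * R)"
      using elim by (intro SUP_least risk) auto
    then have "ennreal (rate \<beta> ?d n powr (- r)) *
       (SUP f\<in>holder_class \<beta> L M. \<integral>\<^sup>+ z. ennreal (\<bar>\<theta> n z (\<lambda>_. 0) - f x\<^sub>0\<bar> powr r) \<partial>sample_law n g f)
       \<le> ennreal (rate \<beta> ?d n powr (- r)) * ennreal ((?h n powr \<beta>) powr r * R)"
      by (rule mult_left_mono) simp
    also have "\<dots> = ennreal (rate \<beta> ?d n powr (- r) * ((?h n powr \<beta>) powr r * R))"
      using R by (simp add: ennreal_mult)
    also have "rate \<beta> ?d n powr (- r) * ((?h n powr \<beta>) powr r * R) = q powr r * R"
      unfolding bandwidth_powr_rate[OF assms(1,2) elim(2)] q_def[symmetric]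
      using q rate by (simp add: powr_mult powr_minus)
    finally show ?case .
  qed
  then have "limsup (\<lambda>n. ennreal (rate \<beta> ?d n powr (- r)) *
       (SUP f\<in>holder_class \<beta> L M. \<integral>\<^sup>+ z. ennreal (\<bar>\<theta> n z (\<lambda>_. 0) - f x\<^sub>0\<bar> powr r) \<partial>sample_law n g f))
       \<le> ennreal (q powr r * R)"
    by (rule Limsup_bounded)
  also have "\<dots> < \<infinity>" by simp
  finally show "limsup (\<lambda>n. ennreal (rate \<beta> ?d n powr (- r)) *
       (SUP f\<in>holder_class \<beta> L M. \<integral>\<^sup>+ z. ennreal (\<bar>\<theta> n z (\<lambda>_. 0) - f x\<^sub>0\<bar> powr r) \<partial>sample_law n g f)) < \<infinity>" .
qed

end
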